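(* Let $M$ be either the torus $\mathbb T$ or the Klein bottle $\mathbb K$, let $n\geq 2$, and let $B_n(M)$ be the braid group of $M$ on $n$ strings. Then $\Sigma^1(B_n(M))=S(B_n(M))$, and $S(B_n(M))$ is homeomorphic to $\mathbb S^1$ if $M=\mathbb T$ and to $\mathbb S^0$ if $M=\mathbb K$.
   Context: **Braid groups.** $F_n(M)=\{(x_1,\dots,x_n)\in M^n : x_i\ne x_j\text{ for }i\ne j\}$; the symmetric group $S_n$ acts freely on it by permuting coordinates, and $B_n(M)=\pi_1(F_n(M)/S_n)$. **BNS invariant.** For a finitely generated group $G$, the character sphere is $S(G)=(\mathrm{Hom}(G,\mathbb R)\setminus\{0\})/\sim$, where $\chi\sim\chi'$ iff $\chi'=r\chi$ for some real $r>0$; the class of $\chi$ is $[\chi]$. Fix a finite generating set $X$ of $G$ and let $\Gamma$ be the Cayley graph with vertex set $G$ and edges joining $g$ to $gz$, $z\in X^{\pm1}$. For a nonzero $\chi$ let $\Gamma_\chi$ be the full subgraph of $\Gamma$ on the vertices $g$ with $\chi(g)\ge 0$. Then $\Sigma^1(G)=\{[\chi]\in S(G) : \Gamma_\chi \text{ is connected}\}$ (this does not depend on $X$). *)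

theory Defs
  imports
    "HOL-Analysis.Analysis"
    "HOL-Algebra.Generated_Groups"
    "HOL-Combinatorics.Permutations"
    "Graph_Theory.Digraph_Component"
begin

section \<open>Quotient topologies\<close>

definition quotient_topology :: "'a topology \<Rightarrow> ('a \<times> 'a) set \<Rightarrow> 'a set topology" where
  "quotient_topology X r =
     topology (\<lambda>\<U>. \<U> \<subseteq> topspace X // r \<and> openin X (\<Union>\<U>))"

lemma openin_quotient_topology:
  assumes r: "equiv (topspace X) r"
  shows "openin (quotient_topology X r) \<U> \<longleftrightarrow> \<U> \<subseteq> topspace X // r \<and> openin X (\<Union>\<U>)"
proof -
  have "istopology (\<lambda>\<U>. \<U> \<subseteq> topspace X // r \<and> openin X (\<Union>\<U>))"
    unfolding istopology_def
  proof (intro conjI allI impI)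
    fix S T
    assume S: "S \<subseteq> topspace X // r \<and> openin X (\<Union>S)"
      and T: "T \<subseteq> topspace X // r \<and> openin X (\<Union>T)"
    show "S \<inter> T \<subseteq> topspace X // r" using S by blast
    have "\<Union>(S \<inter> T) = \<Union>S \<inter> \<Union>T"
    proof
      show "\<Union>S \<inter> \<Union>T \<subseteq> \<Union>(S \<inter> T)"
      proof
        fix x assume "x \<in> \<Union>S \<inter> \<Union>T"
        then obtain A B where A: "A \<in> S" "x \<in> A" and B: "B \<in> T" "x \<in> B" by blast
        then have "A = B" using quotient_disj[OF r, of A B] S T by blast
        then show "x \<in> \<Union>(S \<inter> T)" using A B by blast
      qed
    qed blast
    then show "openin X (\<Union>(S \<inter> T))" using S T by auto
  next
    fix K assume K: "\<forall>S\<in>K. S \<subseteq> topspace X // r \<and> openin X (\<Union>S)"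
    then show "\<Union>K \<subseteq> topspace X // r" by blast
    have "\<Union>(\<Union>K) = \<Union>(Union ` K)" by blast
    then show "openin X (\<Union>(\<Union>K))" using K by (metis (no_types, lifting) imageE openin_Union)
  qed
  then show ?thesis by (simp add: quotient_topology_def)
qed

lemma topspace_quotient_topology:
  assumes r: "equiv (topspace X) r"
  shows "topspace (quotient_topology X r) = topspace X // r"
proof
  show "topspace (quotient_topology X r) \<subseteq> topspace X // r"
    using openin_quotient_topology[OF r] openin_topspace by blast
  have "openin (quotient_topology X r) (topspace X // r)"
    by (simp add: openin_quotient_topology[OF r] Union_quotient[OF r])
  then show "topspace X // r \<subseteq> topspace (quotient_topology X r)"
    by (rule openin_subset)
qed

lemma quotient_map_quotient_topology:
  assumes r: "equiv (topspace X) r"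
  shows "quotient_map X (quotient_topology X r) (\<lambda>x. r `` {x})"
  unfolding quotient_map_def topspace_quotient_topology[OF r]
proof (intro conjI allI impI)
  show "(\<lambda>x. r `` {x}) ` topspace X = topspace X // r"
    by (auto simp: quotient_def)
  fix \<U> assume U: "\<U> \<subseteq> topspace X // r"
  have "{x \<in> topspace X. r `` {x} \<in> \<U>} = \<Union>\<U>"
  proof (intro equalityI subsetI)
    fix x assume "x \<in> {x \<in> topspace X. r `` {x} \<in> \<U>}"
    then show "x \<in> \<Union>\<U>" using equiv_class_self[OF r] by blast
  next
    fix x assume "x \<in> \<Union>\<U>"
    then obtain A where A: "A \<in> \<U>" "x \<in> A" by blast
    then obtain y where y: "y \<in> topspace X" "A = r `` {y}"
      using U by (auto simp: quotient_def)
    then have "(y, x) \<in> r" using A by blast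
    then have "r `` {y} = r `` {x}" "x \<in> topspace X"
      using equiv_class_eq[OF r] equiv_class_eq_iff[OF r] by blast+
    then show "x \<in> {x \<in> topspace X. r `` {x} \<in> \<U>}" using A y by simp
  qed
  then show "openin X {x \<in> topspace X. r `` {x} \<in> \<U>} = openin (quotient_topology X r) \<U>"
    using U by (simp add: openin_quotient_topology[OF r])
qed


section \<open>The torus and the Klein bottle\<close>

text \<open>Both surfaces are orbit spaces of the plane. The torus is the quotient by the integer
  translations, the Klein bottle the quotient by the group generated by
  $(x,y) \mapsto (x+1,y)$ and $(x,y) \mapsto (-x,y+1)$.\<close>

definition torus_rel :: "((real \<times> real) \<times> (real \<times> real)) set" where
  "torus_rel = {((x, y), (x', y')). \<exists>j k :: int. x' = x + of_int j \<and> y' = y + of_int k}"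

definition torus :: "(real \<times> real) set topology" where
  "torus = quotient_topology euclidean torus_rel"

definition klein_rel :: "((real \<times> real) \<times> (real \<times> real)) set" where
  "klein_rel = {((x, y), (x', y')). \<exists>j k :: int.
     x' = (if even k then x else - x) + of_int j \<and> y' = y + of_int k}"

definition klein_bottle :: "(real \<times> real) set topology" where
  "klein_bottle = quotient_topology euclidean klein_rel"

lemma equiv_torus_rel: "equiv UNIV torus_rel"
proof (rule equivI)
  show "torus_rel \<subseteq> UNIV \<times> UNIV" by simp
  show "refl torus_rel"
    by (auto simp: refl_on_def torus_rel_def intro!: exI[of _ "0::int"])
  show "sym torus_rel"
  proof (rule symI, clarify)
    fix x y x' y' assume "((x, y), (x', y')) \<in> torus_rel"
    then obtain j k :: int where "x' = x + of_int j" "y' = y + of_int k"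
      by (auto simp: torus_rel_def)
    then have "x = x' + of_int (- j)" "y = y' + of_int (- k)" by auto
    then show "((x', y'), (x, y)) \<in> torus_rel" unfolding torus_rel_def by blast
  qed
  show "trans torus_rel"
  proof (rule transI, clarify)
    fix x y x' y' x'' y''
    assume "((x, y), (x', y')) \<in> torus_rel" "((x', y'), (x'', y'')) \<in> torus_rel"
    then obtain j k j' k' :: int where "x' = x + of_int j" "y' = y + of_int k"
      "x'' = x' + of_int j'" "y'' = y' + of_int k'"
      by (auto simp: torus_rel_def)
    then have "x'' = x + of_int (j + j')" "y'' = y + of_int (k + k')" by auto
    then show "((x, y), (x'', y'')) \<in> torus_rel" unfolding torus_rel_def by blast
  qed
qed

lemma equiv_klein_rel: "equiv UNIV klein_rel"
proof (rule equivI)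
  show "klein_rel \<subseteq> UNIV \<times> UNIV" by simp
  show "refl klein_rel"
    by (auto simp: refl_on_def klein_rel_def intro!: exI[of _ "0::int"])
  show "sym klein_rel"
  proof (rule symI, clarify)
    fix x y x' y' assume "((x, y), (x', y')) \<in> klein_rel"
    then obtain j k :: int where
      "x' = (if even k then x else - x) + of_int j" "y' = y + of_int k"
      by (auto simp: klein_rel_def)
    then have "x = (if even (- k) then x' else - x') + of_int (if even k then - j else j)"
      "y = y' + of_int (- k)" by auto
    then show "((x', y'), (x, y)) \<in> klein_rel" unfolding klein_rel_def by blast
  qed
  show "trans klein_rel"
  proof (rule transI, clarify)
    fix x y x' y' x'' y''
    assume "((x, y), (x', y')) \<in> klein_rel" "((x', y'), (x'', y'')) \<in> klein_rel"
    then obtain j k j' k' :: int where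
      "x' = (if even k then x else - x) + of_int j" "y' = y + of_int k"
      "x'' = (if even k' then x' else - x') + of_int j'" "y'' = y' + of_int k'"
      by (auto simp: klein_rel_def)
    then have "x'' = (if even (k + k') then x else - x) + of_int ((if even k' then j else - j) + j')"
      "y'' = y + of_int (k + k')" by auto
    then show "((x, y), (x'', y'')) \<in> klein_rel" unfolding klein_rel_def by blast
  qed
qed


section \<open>Configuration spaces\<close>

text \<open>Points of $M^n$ are functions on \<open>{..<n}\<close>, taking the value \<open>undefined\<close> elsewhere.
  Since a permutation of \<open>{..<n}\<close> fixes all other indices, \<open>x \<circ> \<sigma>\<close> is again such a function.\<close>

definition configuration_space :: "'a topology \<Rightarrow> nat \<Rightarrow> (nat \<Rightarrow> 'a) topology" where
  "configuration_space M n =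
     subtopology (product_topology (\<lambda>_. M) {..<n}) {x. inj_on x {..<n}}"

definition permutation_rel :: "'a topology \<Rightarrow> nat \<Rightarrow> ((nat \<Rightarrow> 'a) \<times> (nat \<Rightarrow> 'a)) set" where
  "permutation_rel M n =
     {(x, y). x \<in> topspace (configuration_space M n) \<and> (\<exists>\<sigma>. \<sigma> permutes {..<n} \<and> y = x \<circ> \<sigma>)}"

definition unordered_configuration_space :: "'a topology \<Rightarrow> nat \<Rightarrow> (nat \<Rightarrow> 'a) set topology" where
  "unordered_configuration_space M n =
     quotient_topology (configuration_space M n) (permutation_rel M n)"

lemma configuration_space_permute:
  assumes x: "x \<in> topspace (configuration_space M n)" and p: "\<sigma> permutes {..<n}"
  shows "x \<circ> \<sigma> \<in> topspace (configuration_space M n)"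
proof -
  have "x \<in> {..<n} \<rightarrow>\<^sub>E topspace M" and inj: "inj_on x {..<n}"
    using x by (auto simp: configuration_space_def)
  then have "x \<circ> \<sigma> \<in> {..<n} \<rightarrow>\<^sub>E topspace M"
    using permutes_in_image[OF p] permutes_not_in[OF p]
    by (auto simp: PiE_iff extensional_def)
  moreover have "inj_on (x \<circ> \<sigma>) {..<n}"
    using inj p by (simp add: comp_inj_on permutes_inj_on permutes_image)
  ultimately show ?thesis by (simp add: configuration_space_def)
qed

lemma equiv_permutation_rel:
  "equiv (topspace (configuration_space M n)) (permutation_rel M n)"
proof (rule equivI)
  show "permutation_rel M n
      \<subseteq> topspace (configuration_space M n) \<times> topspace (configuration_space M n)"
    using configuration_space_permute by (fastforce simp: permutation_rel_def)
  show "refl_on (topspace (configuration_space M n)) (permutation_rel M n)"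
    by (auto simp: refl_on_def permutation_rel_def intro: exI[of _ id] permutes_id)
  show "sym (permutation_rel M n)"
  proof (rule symI)
    fix x y assume "(x, y) \<in> permutation_rel M n"
    then obtain \<sigma> where x: "x \<in> topspace (configuration_space M n)"
      and p: "\<sigma> permutes {..<n}" and y: "y = x \<circ> \<sigma>"
      by (auto simp: permutation_rel_def)
    have "x = y \<circ> inv_into UNIV \<sigma>" by (simp add: y comp_assoc permutes_inv_o(1)[OF p])
    then show "(y, x) \<in> permutation_rel M n"
      using configuration_space_permute[OF x p] permutes_inv[OF p] y
      by (auto simp: permutation_rel_def)
  qed
  show "trans (permutation_rel M n)"
  proof (rule transI)
    fix x y z assume "(x, y) \<in> permutation_rel M n" "(y, z) \<in> permutation_rel M n"
    then obtain \<sigma> \<tau> where x: "x \<in> topspace (configuration_space M n)"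
      and p: "\<sigma> permutes {..<n}" "\<tau> permutes {..<n}" and z: "z = x \<circ> (\<sigma> \<circ> \<tau>)"
      by (auto simp: permutation_rel_def comp_assoc)
    then show "(x, z) \<in> permutation_rel M n"
      using permutes_compose[OF p(2) p(1)] by (auto simp: permutation_rel_def)
  qed
qed


section \<open>Fundamental groups and braid groups\<close>

definition loops :: "'a topology \<Rightarrow> 'a \<Rightarrow> (real \<Rightarrow> 'a) set" where
  "loops X b = {p. pathin X p \<and> p 0 = b \<and> p 1 = b}"

definition loop_homotopy_rel :: "'a topology \<Rightarrow> 'a \<Rightarrow> ((real \<Rightarrow> 'a) \<times> (real \<Rightarrow> 'a)) set" where
  "loop_homotopy_rel X b =
     {(p, q). homotopic_with (\<lambda>f. f 0 = b \<and> f 1 = b) (top_of_set {0..1}) X p q}"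

text \<open>The library's \<open>joinpaths\<close> is restricted to types of class \<open>topological_space\<close>.\<close>

definition concat_paths :: "(real \<Rightarrow> 'a) \<Rightarrow> (real \<Rightarrow> 'a) \<Rightarrow> real \<Rightarrow> 'a" where
  "concat_paths p q = (\<lambda>t. if t \<le> 1/2 then p (2 * t) else q (2 * t - 1))"

definition fundamental_group :: "'a topology \<Rightarrow> 'a \<Rightarrow> (real \<Rightarrow> 'a) set monoid" where
  "fundamental_group X b =
     \<lparr>carrier = loops X b // loop_homotopy_rel X b,
      monoid.mult = (\<lambda>P Q. loop_homotopy_rel X b `` {concat_paths p q | p q. p \<in> P \<and> q \<in> Q}),
      one = loop_homotopy_rel X b `` {\<lambda>_. b}\<rparr>"

lemma equiv_loop_homotopy_rel: "equiv (loops X b) (loop_homotopy_rel X b)"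
proof (rule equivI)
  show "loop_homotopy_rel X b \<subseteq> loops X b \<times> loops X b"
    by (auto simp: loop_homotopy_rel_def loops_def pathin_def
        dest: homotopic_with_imp_continuous_maps homotopic_with_imp_property)
  show "refl_on (loops X b) (loop_homotopy_rel X b)"
    by (auto simp: refl_on_def loop_homotopy_rel_def loops_def pathin_def)
  show "sym (loop_homotopy_rel X b)"
    by (auto simp: loop_homotopy_rel_def intro!: symI dest: homotopic_with_symD)
  show "trans (loop_homotopy_rel X b)"
    by (auto simp: loop_homotopy_rel_def intro!: transI intro: homotopic_with_trans)
qed

definition braid_group ::
    "'a topology \<Rightarrow> nat \<Rightarrow> (nat \<Rightarrow> 'a) set \<Rightarrow> (real \<Rightarrow> (nat \<Rightarrow> 'a) set) set monoid" where
  "braid_group M n b = fundamental_group (unordered_configuration_space M n) b"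


section \<open>The character sphere\<close>

definition real_group :: "real monoid" where
  "real_group = \<lparr>carrier = UNIV, monoid.mult = (+), one = 0\<rparr>"

definition characters :: "('g, 'm) monoid_scheme \<Rightarrow> ('g \<Rightarrow> real) set" where
  "characters G = hom G real_group \<inter> extensional (carrier G)"

definition nonzero_characters :: "('g, 'm) monoid_scheme \<Rightarrow> ('g \<Rightarrow> real) set" where
  "nonzero_characters G = characters G - {\<lambda>g\<in>carrier G. 0}"

definition ray_rel :: "('g, 'm) monoid_scheme \<Rightarrow> (('g \<Rightarrow> real) \<times> ('g \<Rightarrow> real)) set" where
  "ray_rel G = {(\<xi>, \<xi>'). \<xi> \<in> nonzero_characters G \<and> \<xi>' \<in> nonzero_characters G \<and>
     (\<exists>r>0. \<xi>' = (\<lambda>g\<in>carrier G. r * \<xi> g))}"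

definition character_sphere :: "('g, 'm) monoid_scheme \<Rightarrow> ('g \<Rightarrow> real) set set" where
  "character_sphere G = nonzero_characters G // ray_rel G"

text \<open>The group of characters carries the topology of pointwise convergence; for finitely
  generated \<open>G\<close> this is the topology of a finite-dimensional real vector space.\<close>

definition character_sphere_topology :: "('g, 'm) monoid_scheme \<Rightarrow> ('g \<Rightarrow> real) set topology" where
  "character_sphere_topology G = quotient_topology
     (subtopology (product_topology (\<lambda>_. euclideanreal) (carrier G)) (nonzero_characters G))
     (ray_rel G)"

lemma equiv_ray_rel: "equiv (nonzero_characters G) (ray_rel G)"
proof (rule equivI)
  show "ray_rel G \<subseteq> nonzero_characters G \<times> nonzero_characters G"
    by (auto simp: ray_rel_def)
  have "\<xi> = (\<lambda>g\<in>carrier G. 1 * \<xi> g)" if "\<xi> \<in> nonzero_characters G" for \<xi>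
    using that by (simp add: nonzero_characters_def characters_def extensional_restrict)
  then show "refl_on (nonzero_characters G) (ray_rel G)"
    unfolding refl_on_def ray_rel_def using zero_less_one by blast
  show "sym (ray_rel G)"
  proof (rule symI)
    fix \<xi> \<psi> assume "(\<xi>, \<psi>) \<in> ray_rel G"
    then obtain r where r: "r > 0" "\<psi> = (\<lambda>g\<in>carrier G. r * \<xi> g)"
      and c: "\<xi> \<in> nonzero_characters G" "\<psi> \<in> nonzero_characters G"
      by (auto simp: ray_rel_def)
    have "\<xi> = (\<lambda>g\<in>carrier G. inverse r * \<psi> g)"
      using r c(1) by (auto simp: nonzero_characters_def characters_def
          extensional_def fun_eq_iff)
    moreover have "inverse r > 0" using r by simp
    ultimately show "(\<psi>, \<xi>) \<in> ray_rel G"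
      unfolding ray_rel_def using c by blast
  qed
  show "trans (ray_rel G)"
  proof (rule transI)
    fix \<xi> \<psi> \<phi> assume "(\<xi>, \<psi>) \<in> ray_rel G" "(\<psi>, \<phi>) \<in> ray_rel G"
    then obtain r s where r: "r > 0" "\<psi> = (\<lambda>g\<in>carrier G. r * \<xi> g)"
      and s: "s > 0" "\<phi> = (\<lambda>g\<in>carrier G. s * \<psi> g)"
      and c: "\<xi> \<in> nonzero_characters G" "\<phi> \<in> nonzero_characters G"
      by (auto simp: ray_rel_def)
    have "\<phi> = (\<lambda>g\<in>carrier G. (s * r) * \<xi> g)" using r s by auto
    moreover have "s * r > 0" using r s by simp
    ultimately show "(\<xi>, \<phi>) \<in> ray_rel G"
      unfolding ray_rel_def using c by blast
  qed
qed

lemma topspace_character_sphere_topology: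
  "topspace (character_sphere_topology G) = character_sphere G"
proof -
  have "topspace (subtopology (product_topology (\<lambda>_. euclideanreal) (carrier G))
      (nonzero_characters G)) = nonzero_characters G"
    by (auto simp: nonzero_characters_def characters_def PiE_def)
  then show ?thesis
    unfolding character_sphere_topology_def character_sphere_def
    by (simp add: topspace_quotient_topology equiv_ray_rel)
qed


section \<open>The Bieri-Neumann-Strebel invariant\<close>

definition finite_generating_set :: "('g, 'm) monoid_scheme \<Rightarrow> 'g set \<Rightarrow> bool" where
  "finite_generating_set G X \<longleftrightarrow> finite X \<and> X \<subseteq> carrier G \<and> generate G X = carrier G"

definition finitely_generated_group :: "('g, 'm) monoid_scheme \<Rightarrow> bool" where
  "finitely_generated_group G \<longleftrightarrow> group G \<and> (\<exists>X. finite_generating_set G X)"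

definition cayley_graph :: "('g, 'm) monoid_scheme \<Rightarrow> 'g set \<Rightarrow> 'g pair_pre_digraph" where
  "cayley_graph G X =
     \<lparr>pverts = carrier G,
      parcs = {(g, g \<otimes>\<^bsub>G\<^esub> z) | g z. g \<in> carrier G \<and> z \<in> X \<union> (\<lambda>x. inv\<^bsub>G\<^esub> x) ` X}\<rparr>"

definition nonneg_subgraph ::
    "('g, 'm) monoid_scheme \<Rightarrow> 'g set \<Rightarrow> ('g \<Rightarrow> real) \<Rightarrow> ('g, 'g \<times> 'g) pre_digraph" where
  "nonneg_subgraph G X \<xi> =
     induce_subgraph (with_proj (cayley_graph G X)) {g \<in> carrier G. \<xi> g \<ge> 0}"

text \<open>$\Sigma^1(G)$ does not depend on the finite generating set \<open>X\<close>; this is not built into the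
  definition, so statements about it should quantify over all such \<open>X\<close>.\<close>

definition BNS_Sigma1 :: "('g, 'm) monoid_scheme \<Rightarrow> 'g set \<Rightarrow> ('g \<Rightarrow> real) set set" where
  "BNS_Sigma1 G X = {ray_rel G `` {\<xi>} | \<xi>.
     \<xi> \<in> nonzero_characters G \<and> Digraph_Component.connected (nonneg_subgraph G X \<xi>)}"

end

theory Submission
  imports Defs "HOL-Complex_Analysis.Winding_Numbers"
begin

text \<open>A character that does not vanish on some central element lies in $\Sigma^1$, because every element
  can be pushed far up by a central element before one walks along a word. Flowing all points along the
  translations of the torus, or along the vertical translations of the Klein bottle, gives central
  elements, so it suffices to show that a character is determined by its values on these.

  The surface is $\mathbb R^2/\Gamma$, and configurations lift to the complement \<open>Y\<close> of a family of
  codimension two subspaces of $(\mathbb R^2)^n$. The wreath product of $\Gamma$ with the symmetric group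
  has a fundamental domain on which all coordinates lie in $(0,1)$ and the heights are increasing.
  A generic path in \<open>Y\<close> crosses only the faces of its translates. These faces fall into the finitely
  many classes \<open>tau i\<close> (point \<open>i\<close> moves once around horizontally), \<open>sig i\<close> (points \<open>i\<close> and \<open>i + 1\<close>
  exchange their heights) and \<open>om\<close> (the highest point leaves through the top), which therefore
  generate the braid group. The loops around codimension two strata give the relations that force
  every character to vanish on \<open>sig i\<close>, to agree on all \<open>tau i\<close>, and to vanish on \<open>tau i\<close> for the
  Klein bottle. Conversely, winding numbers of $\exp(2\pi i\sum_j y_j)$, and for the torus also of
  $\exp(2\pi i\sum_j x_j)$, are characters.\<close>

section \<open>Central elements and the BNS invariant\<close>

text \<open>No presentation of the braid group is computed, and the central loops are never written
  as words in the generators. Two bounds meet instead. From above, a character is fixed by its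
  values on \<open>om\<close> and \<open>tau 0\<close> (on \<open>om\<close> alone for the Klein
  bottle), so the space of characters has dimension at most two (one). From below, the displacement
  characters form, up to scaling, a dual basis on the flow loops themselves. Hence these loops also
  separate characters, as the criterion for Sigma^1 needs. For the Klein bottle the flow runs for
  time 2, because a unit vertical translation agrees with a deck transformation only up to the
  reflection x -> -x. The main obstacle is generation: a path of configurations may meet the faces
  infinitely often or in their intersections. It is cut into pieces lying in small boxes, and every
  piece is replaced by moves of one coordinate of one point at a time, between configurations whose
  heights at different indices lie in distinct cosets of the rationals. Such moves cross finitely
  many faces, one at a time.\<close>

context group
begin

text \<open>The bound \<open>c\<close> is a parameter because walks to arbitrary elements may dip
  below zero; such walks are afterwards lifted into the half space by left translation. Edges are
  taken in both directions, so reachability is symmetric.\<close>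

definition level_edges :: "'a set \<Rightarrow> ('a \<Rightarrow> real) \<Rightarrow> real \<Rightarrow> ('a \<times> 'a) set" where
  "level_edges X \<xi> c = {(u, v). u \<in> carrier G \<and> v \<in> carrier G \<and> c \<le> \<xi> u \<and> c \<le> \<xi> v \<and>
     (\<exists>x\<in>X. v = u \<otimes> x \<or> u = v \<otimes> x)}"

lemma level_edges_mono: "c' \<le> c \<Longrightarrow> (level_edges X \<xi> c)\<^sup>* \<subseteq> (level_edges X \<xi> c')\<^sup>*"
  by (rule rtrancl_mono) (auto simp: level_edges_def)

lemma sym_level_edges: "(u, v) \<in> (level_edges X \<xi> c)\<^sup>* \<Longrightarrow> (v, u) \<in> (level_edges X \<xi> c)\<^sup>*"
proof -
  have "sym (level_edges X \<xi> c)" by (auto simp: level_edges_def sym_def)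
  then show "(u, v) \<in> (level_edges X \<xi> c)\<^sup>* \<Longrightarrow> ?thesis" by (meson sym_rtrancl symD)
qed

lemma character_mult:
  assumes "\<xi> \<in> characters G" "u \<in> carrier G" "v \<in> carrier G"
  shows "\<xi> (u \<otimes> v) = \<xi> u + \<xi> v"
  using assms by (auto simp: characters_def hom_def real_group_def)

lemma character_one: "\<xi> \<in> characters G \<Longrightarrow> \<xi> \<one> = 0"
  using character_mult[of \<xi> \<one> \<one>] by simp

lemma character_inv:
  assumes "\<xi> \<in> characters G" "u \<in> carrier G"
  shows "\<xi> (inv u) = - \<xi> u"
  using character_mult[OF assms(1), of u "inv u"] assms character_one[OF assms(1)] by simp

lemma character_pow:
  assumes "\<xi> \<in> characters G" "u \<in> carrier G"
  shows "\<xi> (u [^] (k::nat)) = real k * \<xi> u"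
  using assms by (induction k) (auto simp: character_one character_mult algebra_simps)

text \<open>Left multiplication by \<open>k\<close> is an automorphism of the Cayley graph and
  raises \<xi> by \<open>\<xi> k\<close>.\<close>

lemma level_edges_translate:
  assumes "X \<subseteq> carrier G" "\<xi> \<in> characters G" "k \<in> carrier G" "(u, v) \<in> (level_edges X \<xi> c)\<^sup>*"
    and c': "c' \<le> c + \<xi> k"
  shows "(k \<otimes> u, k \<otimes> v) \<in> (level_edges X \<xi> c')\<^sup>*"
  using assms(4)
proof (induction rule: rtrancl_induct)
  case (step v w)
  then obtain x where vw: "v \<in> carrier G" "w \<in> carrier G" "c \<le> \<xi> v" "c \<le> \<xi> w"
     and x: "x \<in> X" "w = v \<otimes> x \<or> v = w \<otimes> x" by (auto simp: level_edges_def)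
  then have "(k \<otimes> v, k \<otimes> w) \<in> level_edges X \<xi> c'"
    using assms(1-3) c' x(1) by (auto simp: level_edges_def character_mult m_assoc intro!: bexI[of _ x])
  with step.IH show ?case by (rule rtrancl_into_rtrancl)
qed auto

text \<open>A word passes through finitely many vertices, so \<xi> is bounded below along
  it.\<close>

lemma generate_level:
  assumes X: "X \<subseteq> carrier G" and \<xi>: "\<xi> \<in> characters G" and h: "h \<in> generate G X"
  shows "\<exists>c. (\<one>, h) \<in> (level_edges X \<xi> c)\<^sup>*"
  using h
proof (induction rule: generate.induct)
  case (incl h)
  then have "(\<one>, h) \<in> level_edges X \<xi> (min 0 (\<xi> h))"
    using X \<xi> by (auto simp: level_edges_def character_one intro!: bexI[of _ h])
  then show ?case by blast
next
  case (inv h)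
  then have "(\<one>, inv h) \<in> level_edges X \<xi> (min 0 (\<xi> (inv h)))"
    using X \<xi> by (auto simp: level_edges_def character_one intro!: bexI[of _ h])
  then show ?case by blast
next
  case (eng h1 h2)
  then obtain c1 c2 where c: "(\<one>, h1) \<in> (level_edges X \<xi> c1)\<^sup>*" "(\<one>, h2) \<in> (level_edges X \<xi> c2)\<^sup>*"
    by auto
  have h: "h1 \<in> carrier G" "h2 \<in> carrier G" using eng X generate_in_carrier by auto
  let ?c = "min c1 (c2 + \<xi> h1)"
  have "(\<one>, h1) \<in> (level_edges X \<xi> ?c)\<^sup>*" using c(1) level_edges_mono[of ?c c1] by auto
  moreover have "(h1 \<otimes> \<one>, h1 \<otimes> h2) \<in> (level_edges X \<xi> ?c)\<^sup>*"
    by (rule level_edges_translate[OF X \<xi> _ c(2)]) (use h in auto)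
  ultimately show ?case using h by (metis r_one rtrancl_trans)
qed auto

text \<open>Powers of the central \<open>z\<close> are reached by climbing to
  \<open>s [^] k\<close>, following translates of a fixed walk for \<open>z\<close>, and descending
  by the walk for \<open>s [^] k\<close> translated by \<open>z [^] m\<close>, which is possible
  since the two commute. Then \<open>g\<close> is reached along the route \<open>\<one>\<close>,
  \<open>z [^] m\<close>, \<open>z [^] m \<otimes> g = g \<otimes> z [^] m\<close>,
  \<open>g\<close>: its last leg is the walk to \<open>z [^] m\<close> translated by
  \<open>g\<close> and reversed.\<close>

lemma level_reachable_central:
  assumes X: "X \<subseteq> carrier G" "generate G X = carrier G" and \<xi>: "\<xi> \<in> characters G"
    and z: "z \<in> carrier G" "\<And>g. g \<in> carrier G \<Longrightarrow> z \<otimes> g = g \<otimes> z" "\<xi> z > 0"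
    and g: "g \<in> carrier G" "\<xi> g \<ge> 0"
  shows "(\<one>, g) \<in> (level_edges X \<xi> 0)\<^sup>*"
proof -
  note tr = level_edges_translate[OF X(1) \<xi>]
  have "\<exists>x\<in>X. \<xi> x \<noteq> 0"
  proof (rule ccontr)
    assume *: "\<not> ?thesis"
    have "\<xi> h = 0" if "h \<in> generate G X" for h
      using that
    proof (induction rule: generate.induct)
      case (eng h1 h2)
      then show ?case using X generate_in_carrier character_mult[OF \<xi>] by auto
    qed (use * X(1) \<xi> in \<open>auto simp: character_one character_inv subset_iff\<close>)
    then show False using X z by auto
  qed
  then obtain x where x: "x \<in> X" "\<xi> x \<noteq> 0" by blast
  \<comment> \<open>A generator or its inverse, oriented uphill, so that the walk along its powers
    never goes below zero.\<close>
  define s where "s = (if \<xi> x > 0 then x else inv x)"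
  have s: "s \<in> carrier G" "\<xi> s > 0" "(\<one>, s) \<in> (level_edges X \<xi> 0)\<^sup>*"
    using x X(1) \<xi> by (auto simp: s_def character_inv character_one level_edges_def
        intro!: r_into_rtrancl bexI[of _ x])
  have spow: "(\<one>, s [^] k) \<in> (level_edges X \<xi> 0)\<^sup>*" for k :: nat
  proof (induction k)
    case (Suc k)
    have "(s [^] k \<otimes> \<one>, s [^] k \<otimes> s) \<in> (level_edges X \<xi> 0)\<^sup>*"
      by (rule tr[OF _ s(3)]) (use s \<xi> in \<open>auto simp: character_pow\<close>)
    with Suc show ?case using s by simp
  qed auto
  obtain c where c: "(\<one>, z) \<in> (level_edges X \<xi> c)\<^sup>*" using generate_level[OF X(1) \<xi>] X z by blast
  \<comment> \<open>The height of \<open>s [^] k\<close> compensates the lower bound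
    \<open>c\<close> of the walk for \<open>z\<close>; further powers of \<open>z\<close> only add
    height.\<close>
  obtain k :: nat where k: "real k * \<xi> s \<ge> - c" using ex_less_of_nat_mult[OF s(2)] less_imp_le by metis
  have "(s [^] k, s [^] k \<otimes> z [^] m) \<in> (level_edges X \<xi> 0)\<^sup>*" for m :: nat
  proof (induction m)
    case (Suc m)
    have "0 \<le> real m * \<xi> z" using z by simp
    then have "0 \<le> c + (real k * \<xi> s + real m * \<xi> z)" using k by linarith
    then have "((s [^] k \<otimes> z [^] m) \<otimes> \<one>, (s [^] k \<otimes> z [^] m) \<otimes> z) \<in> (level_edges X \<xi> 0)\<^sup>*"
      using s z by (intro tr[OF _ c]) (auto simp: character_pow[OF \<xi>] character_mult[OF \<xi>])
    with Suc show ?case using s z by (simp add: m_assoc)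
  qed (use s in auto)
  moreover have zpow: "z [^] m \<otimes> h = h \<otimes> z [^] m" if "h \<in> carrier G" for h and m :: nat
    by (induction m) (use that z in \<open>auto simp: m_assoc, metis m_assoc nat_pow_closed\<close>)
  moreover have "(z [^] m \<otimes> \<one>, z [^] m \<otimes> s [^] k) \<in> (level_edges X \<xi> 0)\<^sup>*" for m :: nat
    by (rule tr[OF _ spow]) (use z in \<open>auto simp: character_pow[OF \<xi>]\<close>)
  ultimately have zz: "(\<one>, z [^] m) \<in> (level_edges X \<xi> 0)\<^sup>*" for m :: nat
    using spow[of k] s z by (metis (no_types, lifting) nat_pow_closed r_one rtrancl_trans sym_level_edges)
  obtain c' where c': "(\<one>, g) \<in> (level_edges X \<xi> c')\<^sup>*" using generate_level[OF X(1) \<xi>] X g by blast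
  obtain m :: nat where m: "real m * \<xi> z \<ge> - c'" using ex_less_of_nat_mult[OF z(3)] less_imp_le by metis
  have "(z [^] m \<otimes> \<one>, z [^] m \<otimes> g) \<in> (level_edges X \<xi> 0)\<^sup>*"
    by (rule tr[OF _ c']) (use z m in \<open>auto simp: character_pow[OF \<xi>]\<close>)
  moreover have "(g \<otimes> \<one>, g \<otimes> z [^] m) \<in> (level_edges X \<xi> 0)\<^sup>*"
    by (rule tr[OF _ zz]) (use g in auto)
  ultimately show ?thesis
    using zz[of m] zpow g z by (metis nat_pow_closed r_one rtrancl_trans sym_level_edges)
qed

lemma level_edges_reachable:
  assumes "(u, v) \<in> (level_edges X \<xi> 0)\<^sup>*" "u \<in> carrier G" "\<xi> u \<ge> 0"
  shows "u \<rightarrow>\<^sup>*\<^bsub>with_proj (mk_symmetric (nonneg_subgraph G X \<xi>))\<^esub> v"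
  using assms(1)
proof (induction rule: rtrancl_induct)
  case base
  then show ?case using assms(2,3)
    by (auto simp: reachable_def nonneg_subgraph_def)
next
  case (step v w)
  then have "(v, w) \<in> parcs (mk_symmetric (nonneg_subgraph G X \<xi>))" "w \<in> pverts (mk_symmetric (nonneg_subgraph G X \<xi>))"
    by (auto simp: level_edges_def parcs_mk_symmetric nonneg_subgraph_def cayley_graph_def induce_subgraph_def arcs_ends_conv)
  with step.IH show ?case unfolding reachable_def
    by (auto intro: rtrancl_on_into_rtrancl_on simp: arcs_ends_conv)
qed

lemma connected_nonneg_subgraph:
  assumes X: "X \<subseteq> carrier G" "generate G X = carrier G" and \<xi>: "\<xi> \<in> characters G"
    and z: "z \<in> carrier G" "\<And>g. g \<in> carrier G \<Longrightarrow> z \<otimes> g = g \<otimes> z" "\<xi> z \<noteq> 0"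
  shows "Digraph_Component.connected (nonneg_subgraph G X \<xi>)"
proof -
  define y where "y = (if \<xi> z > 0 then z else inv z)"
  have y: "y \<in> carrier G" "\<And>g. g \<in> carrier G \<Longrightarrow> y \<otimes> g = g \<otimes> y" "\<xi> y > 0"
    using z \<xi> by (auto simp: y_def character_inv) (metis inv_closed inv_solve_left inv_solve_right m_closed)+
  note r = level_reachable_central[OF X \<xi> y]
  show ?thesis unfolding Digraph_Component.connected_def
  proof (rule strongly_connectedI)
    have "\<one> \<in> verts (with_proj (mk_symmetric (nonneg_subgraph G X \<xi>)))"
      using \<xi> by (simp add: nonneg_subgraph_def character_one)
    then show "verts (with_proj (mk_symmetric (nonneg_subgraph G X \<xi>))) \<noteq> {}" by blast
    fix u v
    assume "u \<in> verts (with_proj (mk_symmetric (nonneg_subgraph G X \<xi>)))"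
      "v \<in> verts (with_proj (mk_symmetric (nonneg_subgraph G X \<xi>)))"
    then have uv: "u \<in> carrier G" "\<xi> u \<ge> 0" "v \<in> carrier G" "\<xi> v \<ge> 0"
      by (auto simp: nonneg_subgraph_def)
    then have "(u, v) \<in> (level_edges X \<xi> 0)\<^sup>*"
      using r sym_level_edges by (meson rtrancl_trans)
    then show "u \<rightarrow>\<^sup>*\<^bsub>with_proj (mk_symmetric (nonneg_subgraph G X \<xi>))\<^esub> v"
      using level_edges_reachable uv by blast
  qed
qed

end

text \<open>The dual system identifies characters with vectors of length \<open>d + 1\<close>:
  \<open>f\<close> reads off the coordinates at the \<open>z i\<close> and normalises them,
  \<open>s\<close> forms the corresponding combination of the \<open>\<phi> i\<close>. Both are
  continuous for pointwise convergence because each component involves finitely many evaluations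
  only.\<close>

lemma character_sphere_homeomorphic_nsphere:
  fixes G :: "('g, 'm) monoid_scheme" and d :: nat
  assumes z: "\<And>i. i \<le> d \<Longrightarrow> z i \<in> carrier G"
    and \<phi>: "\<And>i. i \<le> d \<Longrightarrow> \<phi> i \<in> characters G"
    and dual: "\<And>i j. i \<le> d \<Longrightarrow> j \<le> d \<Longrightarrow> \<phi> i (z j) = (if i = j then 1 else 0)"
    and span: "\<And>\<xi> g. \<xi> \<in> characters G \<Longrightarrow> g \<in> carrier G \<Longrightarrow> \<xi> g = (\<Sum>i\<le>d. \<xi> (z i) * \<phi> i g)"
    and G: "group G"
  shows "character_sphere_topology G homeomorphic_space nsphere d"
proof -
  interpret group G by (rule G)
  define V where "V = subtopology (product_topology (\<lambda>_. euclideanreal) (carrier G)) (nonzero_characters G)"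
  have tV: "topspace V = nonzero_characters G"
    by (auto simp: V_def nonzero_characters_def characters_def PiE_def)
  define N where "N \<xi> = sqrt (\<Sum>i\<le>d. (\<xi> (z i))\<^sup>2)" for \<xi> :: "'g \<Rightarrow> real"
  define f where "f \<xi> = (\<lambda>i. if i \<le> d then \<xi> (z i) / N \<xi> else 0)" for \<xi>
  define s where "s v = (\<lambda>g\<in>carrier G. \<Sum>i\<le>d. v i * \<phi> i g)" for v :: "nat \<Rightarrow> real"
  have Npos: "N \<xi> > 0" if "\<xi> \<in> nonzero_characters G" for \<xi>
  proof -
    have "\<exists>i\<le>d. \<xi> (z i) \<noteq> 0"
    proof (rule ccontr)
      assume *: "\<not> ?thesis"
      have "\<xi> \<in> characters G" using that by (simp add: nonzero_characters_def)
      then have "\<xi> = (\<lambda>g\<in>carrier G. 0)"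
        using span * by (force simp: characters_def extensional_def fun_eq_iff)
      then show False using that by (simp add: nonzero_characters_def)
    qed
    then obtain i where "i \<le> d" "\<xi> (z i) \<noteq> 0" by blast
    then have "0 < (\<Sum>i\<le>d. (\<xi> (z i))\<^sup>2)"
      by (intro sum_pos2[of _ i]) auto
    then show ?thesis by (simp add: N_def)
  qed
  have N2: "(N \<xi>)\<^sup>2 = (\<Sum>i\<le>d. (\<xi> (z i))\<^sup>2)" for \<xi> by (simp add: N_def sum_nonneg)
  have V_proj: "continuous_map V euclideanreal (\<lambda>\<xi>. \<xi> (z i))" if "i \<le> d" for i
    unfolding V_def using z[OF that] by (intro continuous_map_from_subtopology continuous_map_product_projection)
  have tS: "topspace (nsphere d) = {x. (\<Sum>i\<le>d. x i ^ 2) = 1 \<and> (\<forall>i>d. x i = 0)}"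
    by (simp add: nsphere)
  have f_cont: "continuous_map V (nsphere d) f"
    unfolding nsphere continuous_map_in_subtopology
  proof (intro conjI)
    show "continuous_map V (powertop_real UNIV) f"
      unfolding continuous_map_componentwise_UNIV
    proof
      fix k
      have "continuous_map V euclideanreal N"
        unfolding N_def by (intro continuous_intros) (use V_proj in auto)
      then have "continuous_map V euclideanreal (\<lambda>\<xi>. \<xi> (z k) / N \<xi>)" if "k \<le> d"
        using V_proj[OF that] tV Npos
        by (intro continuous_map_real_divide) (auto simp: less_imp_neq[THEN not_sym])
      then show "continuous_map V euclideanreal (\<lambda>x. f x k)"
        by (cases "k \<le> d") (auto simp: f_def)
    qed
    show "f \<in> topspace V \<rightarrow> {x. (\<Sum>i\<le>d. x i ^ 2) = 1 \<and> (\<forall>i>d. x i = 0)}"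
    proof
      fix \<xi> assume "\<xi> \<in> topspace V"
      then have "N \<xi> > 0" using Npos tV by simp
      then have "(N \<xi>)\<^sup>2 \<noteq> 0" by simp
      then show "f \<xi> \<in> {x. (\<Sum>i\<le>d. x i ^ 2) = 1 \<and> (\<forall>i>d. x i = 0)}"
        by (simp add: f_def power_divide N2 flip: sum_divide_distrib)
    qed
  qed
  have sz: "s v (z j) = v j" if "j \<le> d" for v j
    using that z dual by (simp add: s_def if_distrib[of "\<lambda>x. _ * x"] cong: if_cong)
  have s_mem: "s v \<in> nonzero_characters G" if v: "v \<in> topspace (nsphere d)" for v
  proof -
    have "s v \<in> characters G"
      using \<phi> by (auto simp: s_def characters_def hom_def real_group_def sum.distrib algebra_simps)
    moreover have "s v \<noteq> (\<lambda>g\<in>carrier G. 0)"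
    proof
      assume "s v = (\<lambda>g\<in>carrier G. 0)"
      then have "v j = 0" if "j \<le> d" for j using sz[OF that, of v] z[OF that] by simp
      then show False using v by (simp add: tS)
    qed
    ultimately show ?thesis by (simp add: nonzero_characters_def)
  qed
  have s_cont: "continuous_map (nsphere d) V s"
    unfolding V_def continuous_map_in_subtopology continuous_map_componentwise
    using s_mem by (auto simp: s_def intro!: continuous_intros continuous_map_nsphere_projection)
  have fs: "f (s v) = v" if v: "v \<in> topspace (nsphere d)" for v
  proof -
    have "N (s v) = 1" using v sz by (simp add: N_def tS)
    then show ?thesis using v sz by (force simp: f_def tS fun_eq_iff)
  qed
  have sf: "(\<xi>, s (f \<xi>)) \<in> ray_rel G" if \<xi>: "\<xi> \<in> nonzero_characters G" for \<xi>
  proof -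
    have "s (f \<xi>) = (\<lambda>g\<in>carrier G. inverse (N \<xi>) * \<xi> g)"
    proof
      fix g
      show "s (f \<xi>) g = (\<lambda>g\<in>carrier G. inverse (N \<xi>) * \<xi> g) g"
      proof (cases "g \<in> carrier G")
        case True
        have "\<xi> g = (\<Sum>i\<le>d. \<xi> (z i) * \<phi> i g)" using span[OF _ True] \<xi> by (simp add: nonzero_characters_def)
        then show ?thesis using True
          by (simp add: s_def f_def sum_distrib_left divide_inverse ac_simps)
      qed (simp add: s_def)
    qed
    moreover have "s (f \<xi>) \<in> nonzero_characters G"
      using \<xi> f_cont tV by (intro s_mem) (auto simp: continuous_map_def)
    moreover have "inverse (N \<xi>) > 0" using Npos[OF \<xi>] by simp
    ultimately show ?thesis unfolding ray_rel_def using \<xi> by blast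
  qed
  have ff: "f \<xi> = f \<psi>" if r: "(\<xi>, \<psi>) \<in> ray_rel G" for \<xi> \<psi>
  proof -
    obtain r where r: "r > 0" "\<psi> = (\<lambda>g\<in>carrier G. r * \<xi> g)" using r by (auto simp: ray_rel_def)
    have "\<psi> (z i) = r * \<xi> (z i)" if "i \<le> d" for i using r z[OF that] by simp
    moreover from this have "N \<psi> = r * N \<xi>"
      using r by (simp add: N_def power_mult_distrib real_sqrt_mult flip: sum_distrib_left)
    ultimately show ?thesis using r by (auto simp: f_def)
  qed
  define \<pi> where "\<pi> \<xi> = ray_rel G `` {\<xi>}" for \<xi>
  have eq: "equiv (topspace V) (ray_rel G)" using equiv_ray_rel tV by metis
  have Q: "quotient_map V (character_sphere_topology G) \<pi>"
    using quotient_map_quotient_topology[OF eq] unfolding character_sphere_topology_def V_def \<pi>_def .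
  have "f \<xi> = f \<psi>" if "\<xi> \<in> topspace V" "\<psi> \<in> topspace V" "\<pi> \<xi> = \<pi> \<psi>" for \<xi> \<psi>
    using ff eq_equiv_class[OF _ eq] that by (simp add: \<pi>_def)
  then obtain h where h: "continuous_map (character_sphere_topology G) (nsphere d) h"
      "\<And>x. x \<in> topspace V \<Longrightarrow> h (\<pi> x) = f x"
    using quotient_map_lift_exists[OF Q f_cont] by metis
  have c: "continuous_map (nsphere d) (character_sphere_topology G) (\<pi> \<circ> s)"
    using s_cont Q by (meson continuous_map_compose quotient_imp_continuous_map)
  have "homeomorphic_maps (character_sphere_topology G) (nsphere d) h (\<pi> \<circ> s)"
    unfolding homeomorphic_maps_def
  proof (intro conjI ballI h c)
    fix x assume "x \<in> topspace (character_sphere_topology G)"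
    then obtain \<xi> where "\<xi> \<in> topspace V" "x = \<pi> \<xi>"
      using quotient_imp_surjective_map[OF Q] by blast
    then show "(\<pi> \<circ> s) (h x) = x"
      using sf[of \<xi>] tV h(2) equiv_class_eq[OF eq sf] by (simp add: \<pi>_def)
  next
    fix y assume "y \<in> topspace (nsphere d)"
    then show "h ((\<pi> \<circ> s) y) = y" using s_mem tV h(2) fs by simp
  qed
  then show ?thesis by (auto simp: homeomorphic_space_def)
qed

lemma BNS_Sigma1_full:
  fixes G :: "('g, 'm) monoid_scheme"
  assumes G: "group G" and X: "finite_generating_set G X"
    and central: "\<And>\<xi>. \<xi> \<in> nonzero_characters G \<Longrightarrow>
      \<exists>z\<in>carrier G. (\<forall>g\<in>carrier G. z \<otimes>\<^bsub>G\<^esub> g = g \<otimes>\<^bsub>G\<^esub> z) \<and> \<xi> z \<noteq> 0"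
  shows "BNS_Sigma1 G X = character_sphere G"
proof -
  interpret group G by (rule G)
  have "Digraph_Component.connected (nonneg_subgraph G X \<xi>)" if "\<xi> \<in> nonzero_characters G" for \<xi>
    using central[OF that] X that
    by (auto intro: connected_nonneg_subgraph simp: finite_generating_set_def nonzero_characters_def)
  then show ?thesis by (auto simp: BNS_Sigma1_def character_sphere_def quotient_def)
qed

section \<open>Homotopy of paths\<close>

definition path_homotopic :: "'a topology \<Rightarrow> (real \<Rightarrow> 'a) \<Rightarrow> (real \<Rightarrow> 'a) \<Rightarrow> bool" where
  "path_homotopic X p q \<longleftrightarrow>
     homotopic_with (\<lambda>f. f 0 = p 0 \<and> f 1 = p 1) (top_of_set {0..1}) X p q"

definition reverse_path :: "(real \<Rightarrow> 'a) \<Rightarrow> real \<Rightarrow> 'a" where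
  "reverse_path p = (\<lambda>t. p (1 - t))"

definition segment_of_path :: "(real \<Rightarrow> 'a) \<Rightarrow> real \<Rightarrow> real \<Rightarrow> real \<Rightarrow> 'a" where
  "segment_of_path p a c = (\<lambda>t. p (a + t * (c - a)))"

lemma path_homotopic_iff:
  "path_homotopic X p q \<longleftrightarrow>
     (\<exists>h :: real \<times> real \<Rightarrow> 'a. continuous_map (top_of_set ({0..1} \<times> {0..1})) X h \<and>
       (\<forall>t\<in>{0..1}. h (0, t) = p t) \<and> (\<forall>t\<in>{0..1}. h (1, t) = q t) \<and>
       (\<forall>s\<in>{0..1}. h (s, 0) = p 0 \<and> h (s, 1) = p 1))"
proof -
  have *: "prod_topology (top_of_set {0..1::real}) (top_of_set {0..1::real})
      = top_of_set ({0..1} \<times> {0..1})"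
    by simp
  show ?thesis
    unfolding path_homotopic_def
    by (subst homotopic_with) (auto simp: *)
qed

lemma path_homotopicD:
  assumes "path_homotopic X p q"
  shows "pathin X p" "pathin X q" "q 0 = p 0" "q 1 = p 1"
  using homotopic_with_imp_continuous_maps[OF assms[unfolded path_homotopic_def]]
    homotopic_with_imp_property[OF assms[unfolded path_homotopic_def]]
  by (auto simp: pathin_def)

lemma path_homotopic_refl: "path_homotopic X p p \<longleftrightarrow> pathin X p"
  by (simp add: path_homotopic_def pathin_def)

lemma path_homotopic_sym: "path_homotopic X p q \<Longrightarrow> path_homotopic X q p"
  using path_homotopicD(3,4)[of X p q] by (simp add: path_homotopic_def homotopic_with_sym)

lemma path_homotopic_trans [trans]:
  "path_homotopic X p q \<Longrightarrow> path_homotopic X q r \<Longrightarrow> path_homotopic X p r"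
  using path_homotopicD(3,4)[of X p q] unfolding path_homotopic_def
  by (auto intro: homotopic_with_trans)

text \<open>Straight-line homotopy in the convex parameter set, pushed forward by \<open>F\<close>.
  The groupoid laws and the commuting square below are instances.\<close>

lemma path_homotopic_convex:
  fixes S :: "'v::real_normed_vector set"
  assumes F: "continuous_map (top_of_set S) X F" and S: "convex S"
    and \<alpha>: "continuous_on {0..1} \<alpha>" "\<And>t. t \<in> {0..1} \<Longrightarrow> \<alpha> t \<in> S"
    and \<beta>: "continuous_on {0..1} \<beta>" "\<And>t. t \<in> {0..1} \<Longrightarrow> \<beta> t \<in> S"
    and e: "\<alpha> 0 = \<beta> 0" "\<alpha> 1 = \<beta> 1"
    and p: "\<And>t. t \<in> {0..1} \<Longrightarrow> p t = F (\<alpha> t)" and q: "\<And>t. t \<in> {0..1} \<Longrightarrow> q t = F (\<beta> t)"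
  shows "path_homotopic X p q"
  unfolding path_homotopic_iff
proof (intro exI conjI)
  let ?h = "\<lambda>z. (1 - fst z) *\<^sub>R \<alpha> (snd z) + fst z *\<^sub>R \<beta> (snd z)"
  have "continuous_on ({0..1} \<times> {0..1}) ?h"
    by (intro continuous_intros continuous_on_compose2[OF \<alpha>(1)] continuous_on_compose2[OF \<beta>(1)]) auto
  moreover have "?h z \<in> S" if "z \<in> {0..1} \<times> {0..1}" for z
    using that by (intro convexD[OF S]) (auto simp: \<alpha> \<beta>)
  ultimately have "continuous_map (top_of_set ({0..1} \<times> {0..1})) (top_of_set S) ?h"
    by (auto simp: continuous_map_in_subtopology)
  then show "continuous_map (top_of_set ({0..1} \<times> {0..1})) X (F \<circ> ?h)"
    using F by (rule continuous_map_compose)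
qed (use e in \<open>auto simp: p q simp flip: scaleR_left_distrib\<close>)

text \<open>Reduces each groupoid law to exhibiting two parameter functions with the same
  ends.\<close>

lemma path_homotopic_reparam:
  assumes "pathin X F"
    and "continuous_on {0..1} \<alpha>" "\<And>t. t \<in> {0..1} \<Longrightarrow> \<alpha> t \<in> {0..1::real}"
    and "continuous_on {0..1} \<beta>" "\<And>t. t \<in> {0..1} \<Longrightarrow> \<beta> t \<in> {0..1}"
    and "\<alpha> 0 = \<beta> 0" "\<alpha> 1 = \<beta> 1"
    and "\<And>t. t \<in> {0..1} \<Longrightarrow> p t = F (\<alpha> t)" "\<And>t. t \<in> {0..1} \<Longrightarrow> q t = F (\<beta> t)"
  shows "path_homotopic X p q"
  by (rule path_homotopic_convex[of "{0..1}" X F \<alpha> \<beta>]) (use assms in \<open>auto simp: pathin_def\<close>)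

lemma concat_paths_ends [simp]: "concat_paths p q 0 = p 0" "concat_paths p q 1 = q 1"
  by (auto simp: concat_paths_def)

lemma reverse_path_ends [simp]: "reverse_path p 0 = p 1" "reverse_path p 1 = p 0"
  by (auto simp: reverse_path_def)

lemma segment_of_path_ends [simp]: "segment_of_path p a c 0 = p a" "segment_of_path p a c 1 = p c"
  by (auto simp: segment_of_path_def)

lemma path_homotopic_concat:
  assumes p: "path_homotopic X p p'" and q: "path_homotopic X q q'" and e: "p 1 = q 0"
  shows "path_homotopic X (concat_paths p q) (concat_paths p' q')"
proof -
  let ?I = "top_of_set ({0..1} \<times> {0..1}) :: (real \<times> real) topology"
  obtain h where h: "continuous_map ?I X h"
      "\<And>t. t \<in> {0..1} \<Longrightarrow> h (0, t) = p t" "\<And>t. t \<in> {0..1} \<Longrightarrow> h (1, t) = p' t"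
      "\<And>s. s \<in> {0..1} \<Longrightarrow> h (s, 0) = p 0 \<and> h (s, 1) = p 1"
    using p unfolding path_homotopic_iff by blast
  obtain k where k: "continuous_map ?I X k"
      "\<And>t. t \<in> {0..1} \<Longrightarrow> k (0, t) = q t" "\<And>t. t \<in> {0..1} \<Longrightarrow> k (1, t) = q' t"
      "\<And>s. s \<in> {0..1} \<Longrightarrow> k (s, 0) = q 0 \<and> k (s, 1) = q 1"
    using q unfolding path_homotopic_iff by blast
  define g where "g z = (if snd z \<le> 1/2 then (h \<circ> (\<lambda>z. (fst z, 2 * snd z))) z
      else (k \<circ> (\<lambda>z. (fst z, 2 * snd z - 1))) z)" for z :: "real \<times> real"
  have "continuous_map ?I X g"
    unfolding g_def
  proof (rule continuous_map_cases_le)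
    show "continuous_map (subtopology ?I {x \<in> topspace ?I. snd x \<le> 1/2}) X (h \<circ> (\<lambda>z. (fst z, 2 * snd z)))"
      by (rule continuous_map_compose[OF _ h(1)])
        (auto simp: continuous_map_in_subtopology subtopology_subtopology intro!: continuous_intros)
    show "continuous_map (subtopology ?I {x \<in> topspace ?I. 1/2 \<le> snd x}) X (k \<circ> (\<lambda>z. (fst z, 2 * snd z - 1)))"
      by (rule continuous_map_compose[OF _ k(1)])
        (auto simp: continuous_map_in_subtopology subtopology_subtopology intro!: continuous_intros)
    show "(h \<circ> (\<lambda>z. (fst z, 2 * snd z))) x = (k \<circ> (\<lambda>z. (fst z, 2 * snd z - 1))) x"
      if "x \<in> topspace ?I" "snd x = 1/2" for x
    proof -
      obtain a c where "x = (a, c)" by (cases x)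
      then have "x = (a, 1/2)" "a \<in> {0..1}" using that by auto
      then show ?thesis using h(4)[of a] k(4)[of a] e by simp
    qed
  qed (auto intro!: continuous_intros)
  then show ?thesis
    unfolding path_homotopic_iff
    by (intro exI[of _ g]) (auto simp: g_def concat_paths_def h k)
qed

lemma pathin_concat:
  assumes "pathin X p" "pathin X q" "p 1 = q 0"
  shows "pathin X (concat_paths p q)"
  using path_homotopic_concat[of X p p q q] assms by (simp add: path_homotopic_refl)

lemma pathin_reparam:
  assumes "pathin X p" "continuous_on {0..1} \<alpha>" "\<And>t. t \<in> {0..1} \<Longrightarrow> \<alpha> t \<in> {0..1::real}"
  shows "pathin X (\<lambda>t. p (\<alpha> t))"
  using path_homotopic_reparam[of X p \<alpha> \<alpha>] assms by (simp flip: path_homotopic_refl)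

lemma pathin_reverse: "pathin X p \<Longrightarrow> pathin X (reverse_path p)"
  unfolding reverse_path_def by (rule pathin_reparam) (auto intro!: continuous_intros)

lemma segment_param_bounds:
  fixes a c t :: real
  assumes "0 \<le> a" "a \<le> c" "c \<le> 1" "0 \<le> t" "t \<le> 1"
  shows "a \<le> a + t * (c - a)" "a + t * (c - a) \<le> c"
proof -
  have "t * (c - a) \<le> 1 * (c - a)" using assms by (intro mult_right_mono) auto
  then show "a + t * (c - a) \<le> c" by simp
qed (use assms in auto)

lemma pathin_segment:
  assumes "pathin X p" "0 \<le> a" "a \<le> c" "c \<le> 1"
  shows "pathin X (segment_of_path p a c)"
  unfolding segment_of_path_def
  by (rule pathin_reparam[OF assms(1)])
    (use assms segment_param_bounds[of a c] in \<open>auto intro!: continuous_intros intro: order_trans\<close>)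

text \<open>Parameter functions are written with \<open>min\<close> and \<open>max\<close> so that
  continuity is immediate; these equations recover the case split at 1/2 made by
  \<open>concat_paths\<close>.\<close>

lemma half_splits:
  fixes t :: real
  shows "max 0 (2 * t - 1) = (if t \<le> 1/2 then 0 else 2 * t - 1)"
    "min 1 (2 * t) = (if t \<le> 1/2 then 2 * t else 1)"
    "min (2 * t) 1 = (if t \<le> 1/2 then 2 * t else 1)"
    "min (2 * t) (2 - 2 * t) = (if t \<le> 1/2 then 2 * t else 2 - 2 * t)"
  by auto

lemma path_homotopic_assoc:
  assumes "pathin X p" "pathin X q" "pathin X r" "p 1 = q 0" "q 1 = r 0"
  shows "path_homotopic X (concat_paths (concat_paths p q) r) (concat_paths p (concat_paths q r))"
\<comment> \<open>The concave piecewise linear map with slopes 2, 1, 1/2 that sends the breakpoints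
  1/4, 1/2 of the left bracketing to the breakpoints 1/2, 3/4 of the right one.\<close>
proof (rule path_homotopic_reparam[where \<alpha> = "\<lambda>t. min (2 * t) (min (t + 1/4) ((t + 1)/2))" and \<beta> = id])
  show "pathin X (concat_paths p (concat_paths q r))"
    using assms by (intro pathin_concat) auto
qed (auto intro!: continuous_intros simp: id_def, auto simp: concat_paths_def min_def intro!: arg_cong[of _ _ q] arg_cong[of _ _ r])

lemma path_homotopic_const_left:
  assumes "pathin X p" "p 0 = u"
  shows "path_homotopic X (concat_paths (\<lambda>_. u) p) p"
  using assms
  by (intro path_homotopic_reparam[of X p "\<lambda>t. max 0 (2 * t - 1)" id])
    (auto intro!: continuous_intros simp: id_def, auto simp: concat_paths_def half_splits)

lemma path_homotopic_const_right:
  assumes "pathin X p" "p 1 = u"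
  shows "path_homotopic X (concat_paths p (\<lambda>_. u)) p"
  using assms
  by (intro path_homotopic_reparam[of X p "\<lambda>t. min 1 (2 * t)" id])
    (auto intro!: continuous_intros simp: id_def, auto simp: concat_paths_def half_splits)

lemma path_homotopic_reverse_right:
  assumes "pathin X p"
  shows "path_homotopic X (concat_paths p (reverse_path p)) (\<lambda>_. p 0)"
  using assms
  by (intro path_homotopic_reparam[of X p "\<lambda>t. min (2 * t) (2 - 2 * t)" "\<lambda>_. 0"])
    (auto intro!: continuous_intros, auto simp: concat_paths_def half_splits reverse_path_def algebra_simps)

lemma path_homotopic_reverse_left:
  assumes "pathin X p"
  shows "path_homotopic X (concat_paths (reverse_path p) p) (\<lambda>_. p 1)"
  using path_homotopic_reverse_right[OF pathin_reverse[OF assms]]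
  by (simp add: reverse_path_def)

lemma path_homotopic_segments:
  assumes p: "pathin X p" and abc: "0 \<le> a" "a \<le> b" "b \<le> c" "c \<le> 1"
  shows "path_homotopic X (concat_paths (segment_of_path p a b) (segment_of_path p b c)) (segment_of_path p a c)"
proof (rule path_homotopic_reparam[OF p, where \<alpha> = "\<lambda>t. a + min (2 * t) 1 * (b - a) + max 0 (2 * t - 1) * (c - b)"
      and \<beta> = "\<lambda>t. a + t * (c - a)"])
  fix t :: real assume t: "t \<in> {0..1}"
  show "a + t * (c - a) \<in> {0..1}" using segment_param_bounds[of a c t] abc t by auto
  show "a + min (2 * t) 1 * (b - a) + max 0 (2 * t - 1) * (c - b) \<in> {0..1}"
    using segment_param_bounds[of a b "2 * t"] segment_param_bounds[of b c "2 * t - 1"] abc t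
    by (auto simp: half_splits)
next
  show "continuous_on {0..1} (\<lambda>t. a + min (2 * t) 1 * (b - a) + max 0 (2 * t - 1) * (c - b))"
    "continuous_on {0..1} (\<lambda>t. a + t * (c - a))" by (intro continuous_intros)+
qed (auto simp: concat_paths_def segment_of_path_def half_splits)

lemma path_homotopic_square:
  assumes h: "continuous_map (top_of_set ({0..1} \<times> {0..1})) X h"
  shows "path_homotopic X (concat_paths (\<lambda>s. h (s, 0)) (\<lambda>t. h (1, t)))
           (concat_paths (\<lambda>t. h (0, t)) (\<lambda>s. h (s, 1)))"
  by (rule path_homotopic_convex[OF h, where \<alpha> = "\<lambda>t. (min 1 (2 * t), max 0 (2 * t - 1))"
        and \<beta> = "\<lambda>t. (max 0 (2 * t - 1), min 1 (2 * t))"])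
    (auto intro!: continuous_intros convex_Times, auto simp: concat_paths_def half_splits)

section \<open>The fundamental group\<close>

lemma loop_homotopy_rel_iff:
  "(p, q) \<in> loop_homotopy_rel X b \<longleftrightarrow> p \<in> loops X b \<and> path_homotopic X p q"
proof
  assume L: "(p, q) \<in> loop_homotopy_rel X b"
  then have "p 0 = b \<and> p 1 = b"
    unfolding loop_homotopy_rel_def by (auto dest: homotopic_with_imp_property)
  then show "p \<in> loops X b \<and> path_homotopic X p q"
    using L equiv_loop_homotopy_rel[of X b]
    by (auto simp: loop_homotopy_rel_def path_homotopic_def equiv_def loops_def pathin_def
        dest: homotopic_with_imp_continuous_maps)
next
  assume "p \<in> loops X b \<and> path_homotopic X p q"
  then show "(p, q) \<in> loop_homotopy_rel X b"
    by (auto simp: loop_homotopy_rel_def path_homotopic_def loops_def)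
qed

definition loop_class :: "'a topology \<Rightarrow> 'a \<Rightarrow> (real \<Rightarrow> 'a) \<Rightarrow> (real \<Rightarrow> 'a) set" where
  "loop_class X b p = loop_homotopy_rel X b `` {p}"

lemma mem_loop_class: "q \<in> loop_class X b p \<longleftrightarrow> p \<in> loops X b \<and> path_homotopic X p q"
  by (simp add: loop_class_def loop_homotopy_rel_iff)

lemma loop_class_eqI: "path_homotopic X p q \<Longrightarrow> p \<in> loops X b \<Longrightarrow> loop_class X b p = loop_class X b q"
  unfolding loop_class_def
  by (rule equiv_class_eq[OF equiv_loop_homotopy_rel]) (simp add: loop_homotopy_rel_iff)

lemma carrier_fundamental_group: "carrier (fundamental_group X b) = loop_class X b ` loops X b"
  by (auto simp: fundamental_group_def quotient_def loop_class_def)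

lemma one_fundamental_group: "\<one>\<^bsub>fundamental_group X b\<^esub> = loop_class X b (\<lambda>_. b)"
  by (simp add: fundamental_group_def loop_class_def)

lemma loops_concat: "p \<in> loops X b \<Longrightarrow> q \<in> loops X b \<Longrightarrow> concat_paths p q \<in> loops X b"
  by (auto simp: loops_def intro!: pathin_concat)

text \<open>The product in \<open>fundamental_group\<close> is formed from all concatenations of
  representatives, so the content is that they all lie in one class.\<close>

lemma mult_loop_class:
  assumes p: "p \<in> loops X b" and q: "q \<in> loops X b"
  shows "loop_class X b p \<otimes>\<^bsub>fundamental_group X b\<^esub> loop_class X b q = loop_class X b (concat_paths p q)"
proof -
  have e: "p 1 = q 0" using p q by (simp add: loops_def)
  have "r \<in> loop_class X b (concat_paths p q)"
    if "(concat_paths p' q', r) \<in> loop_homotopy_rel X b" "p' \<in> loop_class X b p" "q' \<in> loop_class X b q" for p' q' r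
    using that path_homotopic_concat[of X p p' q q'] e loops_concat[OF p q]
    by (auto simp: mem_loop_class loop_homotopy_rel_iff intro: path_homotopic_trans)
  moreover have "p \<in> loop_class X b p" "q \<in> loop_class X b q"
    using p q by (auto simp: mem_loop_class path_homotopic_refl loops_def)
  ultimately show ?thesis
    unfolding fundamental_group_def by (auto simp: loop_class_def)
qed

lemma group_fundamental_group:
  assumes b: "b \<in> topspace X"
  shows "group (fundamental_group X b)"
proof (rule groupI)
  have const: "(\<lambda>_. b) \<in> loops X b" using b by (simp add: loops_def)
  show "\<one>\<^bsub>fundamental_group X b\<^esub> \<in> carrier (fundamental_group X b)"
    using const by (simp add: one_fundamental_group carrier_fundamental_group)
  fix x assume "x \<in> carrier (fundamental_group X b)"
  then obtain p where p: "p \<in> loops X b" "x = loop_class X b p" by (auto simp: carrier_fundamental_group)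
  have p': "pathin X p" "p 0 = b" "p 1 = b" using p by (auto simp: loops_def)
  show "\<one>\<^bsub>fundamental_group X b\<^esub> \<otimes>\<^bsub>fundamental_group X b\<^esub> x = x"
    using path_homotopic_const_left[OF p'(1,2)] loops_concat[OF const p(1)]
    by (simp add: p one_fundamental_group mult_loop_class const loop_class_eqI)
  have r: "reverse_path p \<in> loops X b" using p' by (simp add: loops_def pathin_reverse)
  have "loop_class X b (reverse_path p) \<otimes>\<^bsub>fundamental_group X b\<^esub> x = \<one>\<^bsub>fundamental_group X b\<^esub>"
    using path_homotopic_reverse_left[OF p'(1)] loops_concat[OF r p(1)] p'(3)
    by (simp add: p one_fundamental_group mult_loop_class r loop_class_eqI)
  then show "\<exists>y\<in>carrier (fundamental_group X b). y \<otimes>\<^bsub>fundamental_group X b\<^esub> x = \<one>\<^bsub>fundamental_group X b\<^esub>"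
    using r by (auto simp: carrier_fundamental_group)
  fix y assume "y \<in> carrier (fundamental_group X b)"
  then obtain q where q: "q \<in> loops X b" "y = loop_class X b q" by (auto simp: carrier_fundamental_group)
  show "x \<otimes>\<^bsub>fundamental_group X b\<^esub> y \<in> carrier (fundamental_group X b)"
    by (simp add: p q mult_loop_class loops_concat carrier_fundamental_group)
  fix z assume "z \<in> carrier (fundamental_group X b)"
  then obtain r where r: "r \<in> loops X b" "z = loop_class X b r" by (auto simp: carrier_fundamental_group)
  show "x \<otimes>\<^bsub>fundamental_group X b\<^esub> y \<otimes>\<^bsub>fundamental_group X b\<^esub> z
      = x \<otimes>\<^bsub>fundamental_group X b\<^esub> (y \<otimes>\<^bsub>fundamental_group X b\<^esub> z)"
    using p(1) q(1) r(1) unfolding p(2) q(2) r(2)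
    by (simp add: mult_loop_class loops_concat, intro loop_class_eqI path_homotopic_assoc loops_concat)
      (auto simp: loops_def)
qed

text \<open>A map of the square whose opposite sides agree is a map of the torus, and the square
  itself is the homotopy between the two orders.\<close>

lemma loop_class_commute:
  assumes h: "continuous_map (top_of_set ({0..1} \<times> {0..1})) X h"
    and p: "\<And>s. s \<in> {0..1} \<Longrightarrow> h (s, 0) = p s" "\<And>s. s \<in> {0..1} \<Longrightarrow> h (s, 1) = p s"
    and z: "\<And>t. t \<in> {0..1} \<Longrightarrow> h (0, t) = z t" "\<And>t. t \<in> {0..1} \<Longrightarrow> h (1, t) = z t"
    and l: "p \<in> loops X b" "z \<in> loops X b"
  shows "loop_class X b p \<otimes>\<^bsub>fundamental_group X b\<^esub> loop_class X b z
       = loop_class X b z \<otimes>\<^bsub>fundamental_group X b\<^esub> loop_class X b p"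
proof -
  have *: "path_homotopic X f g \<Longrightarrow> path_homotopic X f' g'"
    if "\<And>t. t \<in> {0..1} \<Longrightarrow> f t = f' t" "\<And>t. t \<in> {0..1} \<Longrightarrow> g t = g' t" for f g f' g'
    using that by (simp add: path_homotopic_iff)
  have "path_homotopic X (concat_paths p z) (concat_paths z p)"
    by (rule *[OF _ _ path_homotopic_square[OF h]]) (auto simp: concat_paths_def p z)
  then show ?thesis using l by (simp add: mult_loop_class loops_concat loop_class_eqI)
qed

text \<open>A choice of a path \<open>\<kappa> u\<close> from the base point to every point \<open>u\<close> turns paths into elements of the
  fundamental group: \<open>transport\<close> is a functor from the fundamental groupoid.\<close>

locale framed_space =
  fixes X :: "'a topology" and b :: 'a and \<kappa> :: "'a \<Rightarrow> real \<Rightarrow> 'a"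
  assumes base: "b \<in> topspace X"
    and frame: "\<And>u. u \<in> topspace X \<Longrightarrow> pathin X (\<kappa> u) \<and> \<kappa> u 0 = b \<and> \<kappa> u 1 = u"
begin

abbreviation "FG \<equiv> fundamental_group X b"

abbreviation FG_mult (infixl "\<cdot>" 70) where "g \<cdot> h \<equiv> g \<otimes>\<^bsub>FG\<^esub> h"

sublocale group FG by (rule group_fundamental_group[OF base])

definition based_loop :: "(real \<Rightarrow> 'a) \<Rightarrow> real \<Rightarrow> 'a" where
  "based_loop p = concat_paths (\<kappa> (p 0)) (concat_paths p (reverse_path (\<kappa> (p 1))))"

definition transport :: "(real \<Rightarrow> 'a) \<Rightarrow> (real \<Rightarrow> 'a) set" where
  "transport p = loop_class X b (based_loop p)"

lemma pathin_ends: "pathin X p \<Longrightarrow> p 0 \<in> topspace X" "pathin X p \<Longrightarrow> p 1 \<in> topspace X"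
  using path_start_in_topspace path_finish_in_topspace by auto

lemmas frame_simps = frame[THEN conjunct1] frame[THEN conjunct2, THEN conjunct1] frame[THEN conjunct2, THEN conjunct2]

lemma based_loop: "pathin X p \<Longrightarrow> based_loop p \<in> loops X b"
  unfolding based_loop_def loops_def
  using pathin_ends[of p] by (auto simp: frame_simps intro!: pathin_concat pathin_reverse)

lemma transport_closed [simp]: "pathin X p \<Longrightarrow> transport p \<in> carrier FG"
  by (simp add: transport_def carrier_fundamental_group based_loop)

lemma transport_homotopic:
  assumes pq: "path_homotopic X p q"
  shows "transport p = transport q"
proof -
  note D = path_homotopicD[OF pq]
  have "path_homotopic X (based_loop p) (based_loop q)"
    unfolding based_loop_def D(3,4)
    using D(1,2) pathin_ends[of p]
    by (intro path_homotopic_concat pq) (auto simp: path_homotopic_refl frame_simps pathin_reverse D(3,4))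
  then show ?thesis using D(1) by (simp add: transport_def loop_class_eqI based_loop)
qed

lemma transport_concat:
  assumes p: "pathin X p" and q: "pathin X q" and e: "p 1 = q 0"
  shows "transport (concat_paths p q) = transport p \<cdot> transport q"
proof -
  let ?a = "\<kappa> (p 0)" and ?c = "\<kappa> (q 0)" and ?d = "reverse_path (\<kappa> (q 1))"
  let ?c' = "reverse_path ?c"
  note K = pathin_concat pathin_reverse frame_simps pathin_ends
  have in_top: "p 0 \<in> topspace X" "q 0 \<in> topspace X" "q 1 \<in> topspace X"
    using p q by (auto simp: pathin_ends)
  have qd: "pathin X (concat_paths q ?d)" using q in_top by (intro K) (auto simp: K)
  have c: "pathin X ?c" "?c 1 = q 0" "?c 0 = b" using in_top by (auto simp: K)
  have a: "pathin X ?a" "?a 1 = p 0" using in_top by (auto simp: K)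
  have d: "pathin X ?d" "?d 0 = q 1" using in_top by (auto simp: K)
  have c': "pathin X ?c'" using c by (simp add: K)
  have "path_homotopic X (concat_paths ?c' (concat_paths ?c (concat_paths q ?d)))
      (concat_paths (concat_paths ?c' ?c) (concat_paths q ?d))"
    by (rule path_homotopic_sym, rule path_homotopic_assoc) (use c c' qd in auto)
  also have "path_homotopic X \<dots> (concat_paths (\<lambda>_. q 0) (concat_paths q ?d))"
    by (rule path_homotopic_concat) (use path_homotopic_reverse_left[OF c(1)] qd c in \<open>auto simp: path_homotopic_refl\<close>)
  also have "path_homotopic X \<dots> (concat_paths q ?d)"
    by (rule path_homotopic_const_left) (use qd in auto)
  finally have 1: "path_homotopic X (concat_paths ?c' (concat_paths ?c (concat_paths q ?d))) (concat_paths q ?d)" .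
  have "path_homotopic X (concat_paths (concat_paths p ?c') (concat_paths ?c (concat_paths q ?d)))
      (concat_paths p (concat_paths ?c' (concat_paths ?c (concat_paths q ?d))))"
    by (rule path_homotopic_assoc) (use p c c' qd e in \<open>auto intro!: K\<close>)
  also have "path_homotopic X \<dots> (concat_paths p (concat_paths q ?d))"
    by (rule path_homotopic_concat) (use 1 p e c in \<open>auto simp: path_homotopic_refl\<close>)
  also have "path_homotopic X \<dots> (concat_paths (concat_paths p q) ?d)"
    by (rule path_homotopic_sym, rule path_homotopic_assoc) (use p q d e in auto)
  finally have 2: "path_homotopic X (concat_paths (concat_paths p ?c') (concat_paths ?c (concat_paths q ?d)))
      (concat_paths (concat_paths p q) ?d)" .
  have "path_homotopic X (concat_paths (concat_paths ?a (concat_paths p ?c')) (concat_paths ?c (concat_paths q ?d)))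
      (concat_paths ?a (concat_paths (concat_paths p ?c') (concat_paths ?c (concat_paths q ?d))))"
    by (rule path_homotopic_assoc) (use a p c c' qd e in \<open>auto intro!: K\<close>)
  also have "path_homotopic X \<dots> (concat_paths ?a (concat_paths (concat_paths p q) ?d))"
    by (rule path_homotopic_concat) (use 2 a in \<open>auto simp: path_homotopic_refl\<close>)
  finally have "path_homotopic X (concat_paths (based_loop p) (based_loop q)) (based_loop (concat_paths p q))"
    by (simp add: based_loop_def e)
  then show ?thesis
    using p q by (simp add: transport_def mult_loop_class based_loop loop_class_eqI loops_concat)
qed

text \<open>The constant path is homotopic to its concatenation with itself, and one is the only
  idempotent of a group.\<close>

lemma transport_const: "u \<in> topspace X \<Longrightarrow> transport (\<lambda>_. u) = \<one>\<^bsub>FG\<^esub>"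
  using transport_concat[of "\<lambda>_. u" "\<lambda>_. u"] path_homotopic_const_left[of X "\<lambda>_. u" u] transport_homotopic
  by (metis l_cancel_one' pathin_const transport_closed)

lemma transport_segments:
  assumes p: "pathin X p" and abc: "0 \<le> a" "a \<le> c" "c \<le> d" "d \<le> 1"
  shows "transport (segment_of_path p a d)
       = transport (segment_of_path p a c) \<cdot> transport (segment_of_path p c d)"
  using transport_homotopic[OF path_homotopic_segments[OF p abc]] pathin_segment[OF p] abc
  by (simp add: transport_concat)

text \<open>Conjugation by the frame path at \<open>u\<close> is undone by
  \<open>based_loop\<close>. Thus every element can be studied at a convenient point, later the
  configuration \<open>v0\<close>, instead of the given base point.\<close>

lemma transport_surj:
  assumes u: "u \<in> topspace X" and g: "g \<in> carrier FG"
  shows "\<exists>p. pathin X p \<and> p 0 = u \<and> p 1 = u \<and> transport p = g"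
proof -
  obtain r where r: "pathin X r" "r 0 = b" "r 1 = b" "g = loop_class X b r" "r \<in> loops X b"
    using g by (auto simp: carrier_fundamental_group loops_def)
  let ?a = "\<kappa> u" let ?a' = "reverse_path ?a"
  note K = pathin_concat pathin_reverse
  have a: "pathin X ?a" "?a 0 = b" "?a 1 = u" using frame[OF u] by auto
  have a': "pathin X ?a'" using a by (simp add: K)
  let ?p = "concat_paths (concat_paths ?a' r) ?a"
  have p: "pathin X ?p" "?p 0 = u" "?p 1 = u" using a a' r by (auto intro!: K)
  have 0: "path_homotopic X ?a ?a" "path_homotopic X ?a' ?a'" "path_homotopic X r r"
    using a a' r by (auto simp: path_homotopic_refl)
  have "path_homotopic X (concat_paths ?p ?a') (concat_paths (concat_paths ?a' r) (concat_paths ?a ?a'))"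
    by (rule path_homotopic_assoc) (use a a' r in \<open>auto intro!: K\<close>)
  also have "path_homotopic X \<dots> (concat_paths (concat_paths ?a' r) (\<lambda>_. b))"
    by (rule path_homotopic_concat) (use path_homotopic_reverse_right[OF a(1)] a a' r in \<open>auto simp: path_homotopic_refl intro!: K\<close>)
  also have "path_homotopic X \<dots> (concat_paths ?a' r)"
    by (rule path_homotopic_const_right) (use a a' r in \<open>auto intro!: K\<close>)
  finally have "path_homotopic X (concat_paths ?a (concat_paths ?p ?a')) (concat_paths ?a (concat_paths ?a' r))"
    by - (rule path_homotopic_concat, use 0 a r in \<open>auto\<close>)
  also have "path_homotopic X \<dots> (concat_paths (concat_paths ?a ?a') r)"
    by (rule path_homotopic_sym, rule path_homotopic_assoc) (use a a' r in auto)
  also have "path_homotopic X \<dots> (concat_paths (\<lambda>_. b) r)"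
    by (rule path_homotopic_concat) (use path_homotopic_reverse_right[OF a(1)] a a' r 0 in \<open>auto\<close>)
  also have "path_homotopic X \<dots> r"
    by (rule path_homotopic_const_left) (use r in auto)
  finally have "path_homotopic X (based_loop ?p) r" by (simp add: based_loop_def a)
  then have "transport ?p = g"
    using p r by (simp add: transport_def loop_class_eqI based_loop)
  then show ?thesis using p by blast
qed

end

section \<open>Winding number characters\<close>

text \<open>An element is a set of loops, so a representative has to be picked; homotopy invariance
  makes the value independent of it. The winding number of a loop is an integer, and
  \<open>Re\<close> only changes its type.\<close>

definition winding_character :: "'a topology \<Rightarrow> 'a \<Rightarrow> ('a \<Rightarrow> complex) \<Rightarrow> (real \<Rightarrow> 'a) set \<Rightarrow> real" where
  "winding_character X b f =
     (\<lambda>P\<in>carrier (fundamental_group X b). Re (winding_number (f \<circ> (SOME p. p \<in> P)) 0))"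

lemma winding_character_loop_class:
  assumes f: "continuous_map X (top_of_set (- {0})) f" and p: "p \<in> loops X b"
  shows "winding_character X b f (loop_class X b p) = Re (winding_number (f \<circ> p) 0)"
proof -
  let ?q = "SOME q. q \<in> loop_class X b p"
  have "p \<in> loop_class X b p" using p by (auto simp: mem_loop_class path_homotopic_refl loops_def)
  then have "?q \<in> loop_class X b p" by (rule someI[of "\<lambda>q. q \<in> loop_class X b p"])
  then have "path_homotopic X p ?q" unfolding mem_loop_class by blast
  then have "homotopic_with (\<lambda>r. r 0 = f (p 0) \<and> r 1 = f (p 1)) (top_of_set {0..1}) (top_of_set (- {0})) (f \<circ> p) (f \<circ> ?q)"
    unfolding path_homotopic_def by (rule homotopic_with_compose_continuous_map_left) (use f in auto)
  then have "homotopic_paths (- {0}) (f \<circ> p) (f \<circ> ?q)"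
    by (simp add: homotopic_paths_def pathstart_def pathfinish_def)
  then show ?thesis
    using p by (simp add: winding_character_def carrier_fundamental_group winding_number_homotopic_paths)
qed

lemma winding_character_in_characters:
  assumes f: "continuous_map X (top_of_set (- {0})) f"
  shows "winding_character X b f \<in> characters (fundamental_group X b)"
proof -
  have "winding_character X b f (P \<otimes>\<^bsub>fundamental_group X b\<^esub> Q) = winding_character X b f P + winding_character X b f Q"
    if PQ: "P \<in> carrier (fundamental_group X b)" "Q \<in> carrier (fundamental_group X b)" for P Q
  proof -
    obtain p q where p: "p \<in> loops X b" "P = loop_class X b p" and q: "q \<in> loops X b" "Q = loop_class X b q"
      using PQ by (auto simp: carrier_fundamental_group)
    have *: "path (f \<circ> r)" "0 \<notin> path_image (f \<circ> r)" if "r \<in> loops X b" for r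
    proof -
      have "pathin (top_of_set (- {0})) (f \<circ> r)"
        using that f by (intro pathin_compose) (auto simp: loops_def)
      then show "path (f \<circ> r)" "0 \<notin> path_image (f \<circ> r)"
        by (auto simp: pathin_canon_iff path_image_def)
    qed
    have "f \<circ> concat_paths p q = (f \<circ> p) +++ (f \<circ> q)"
      by (auto simp: concat_paths_def joinpaths_def)
    moreover have "pathfinish (f \<circ> p) = pathstart (f \<circ> q)"
      using p q by (simp add: pathfinish_def pathstart_def loops_def)
    ultimately have "winding_number (f \<circ> concat_paths p q) 0 = winding_number (f \<circ> p) 0 + winding_number (f \<circ> q) 0"
      using p(1) q(1) * by (simp add: winding_number_join)
    then show ?thesis
      using p q by (simp add: mult_loop_class winding_character_loop_class[OF f] loops_concat)
  qed
  then show ?thesis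
    by (auto simp: characters_def hom_def real_group_def winding_character_def)
qed

text \<open>The lift \<theta> through the exponential covering of the punctured plane is measured in
  full turns, so the winding number is its increment.\<close>

lemma winding_character_lift:
  assumes f: "continuous_map X (top_of_set (- {0})) f" and p: "p \<in> loops X b"
    and \<theta>: "continuous_on {0..1} \<theta>" "\<And>t. t \<in> {0..1} \<Longrightarrow> f (p t) = exp (2 * of_real pi * \<i> * of_real (\<theta> t))"
  shows "winding_character X b f (loop_class X b p) = \<theta> 1 - \<theta> 0"
proof -
  let ?q = "\<lambda>t. 2 * of_real pi * \<i> * of_real (\<theta> t)"
  have "path ?q" unfolding path_def by (intro continuous_intros \<theta>)
  then have "winding_number (exp \<circ> ?q) 0 = of_real (\<theta> 1 - \<theta> 0)"
    by (subst winding_number_compose_exp) (auto simp: pathfinish_def pathstart_def field_simps)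
  moreover have "winding_number (f \<circ> p) 0 = winding_number (exp \<circ> ?q) 0"
    by (rule winding_number_cong) (use \<theta> in auto)
  ultimately show ?thesis by (simp add: winding_character_loop_class[OF f p])
qed

section \<open>Configurations in the plane\<close>

type_synonym points = "nat \<Rightarrow> real \<times> real"

type_synonym configuration = "(nat \<Rightarrow> (real \<times> real) set) set"

text \<open>The flag \<open>tw\<close> is false for the torus and true for the Klein bottle.\<close>

definition surface_act :: "bool \<Rightarrow> int \<Rightarrow> int \<Rightarrow> real \<times> real \<Rightarrow> real \<times> real" where
  "surface_act tw j k p = ((if tw \<longrightarrow> even k then fst p else - fst p) + of_int j, snd p + of_int k)"

definition surface_rel :: "bool \<Rightarrow> ((real \<times> real) \<times> (real \<times> real)) set" where
  "surface_rel tw = {(p, p'). \<exists>j k. p' = surface_act tw j k p}"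

lemma surface_rel_torus: "surface_rel False = torus_rel"
  by (auto simp: surface_rel_def torus_rel_def surface_act_def)

lemma surface_rel_klein: "surface_rel True = klein_rel"
  by (auto simp: surface_rel_def klein_rel_def surface_act_def split del: if_split cong: if_cong)

lemma equiv_surface_rel: "equiv UNIV (surface_rel tw)"
  by (cases tw) (simp_all add: surface_rel_torus surface_rel_klein equiv_torus_rel equiv_klein_rel)

definition surface :: "bool \<Rightarrow> (real \<times> real) set topology" where
  "surface tw = quotient_topology euclidean (surface_rel tw)"

lemma continuous_surface_act [continuous_intros]:
  "continuous_on S f \<Longrightarrow> continuous_on S (\<lambda>x. surface_act tw j k (f x))"
  unfolding surface_act_def by (cases "tw \<longrightarrow> even k") (auto intro!: continuous_intros)

lemma surface_rel_refl [simp]: "(p, p) \<in> surface_rel tw"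
  using equiv_surface_rel[of tw] by (meson UNIV_I equivE refl_onD)

lemma surface_rel_sym: "(p, p') \<in> surface_rel tw \<Longrightarrow> (p', p) \<in> surface_rel tw"
  using equiv_surface_rel[of tw] by (meson equivE symD)

lemma surface_rel_trans: "(p, p') \<in> surface_rel tw \<Longrightarrow> (p', p'') \<in> surface_rel tw \<Longrightarrow> (p, p'') \<in> surface_rel tw"
  using equiv_surface_rel[of tw] by (meson equivE transD)

lemma surface_rel_class_eq: "surface_rel tw `` {p} = surface_rel tw `` {p'} \<longleftrightarrow> (p, p') \<in> surface_rel tw"
  using eq_equiv_class_iff[OF equiv_surface_rel, of p p' tw] by simp

lemma surface_rel_act: "(p, surface_act tw j k p) \<in> surface_rel tw"
  by (auto simp: surface_rel_def)

text \<open>This is the Hausdorff property of the surface; its use is that a compact set of pairs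
  avoiding the relation keeps a positive distance from it.\<close>

lemma closed_surface_rel: "closed (surface_rel tw)"
proof -
  have 1: "surface_rel tw = {z. snd (snd z) - snd (fst z) \<in> \<int> \<and> fst (snd z) - fst (fst z) \<in> \<int>}" if "\<not> tw"
  proof (intro equalityI subsetI)
    fix z :: "(real \<times> real) \<times> (real \<times> real)" assume "z \<in> {z. snd (snd z) - snd (fst z) \<in> \<int> \<and> fst (snd z) - fst (fst z) \<in> \<int>}"
    then obtain j k where "snd (snd z) - snd (fst z) = of_int k" "fst (snd z) - fst (fst z) = of_int j"
      by (auto elim!: Ints_cases)
    then have "snd z = surface_act tw j k (fst z)" using that by (auto simp: surface_act_def prod_eq_iff)
    then show "z \<in> surface_rel tw" by (cases z) (auto simp: surface_rel_def)
  qed (use that in \<open>auto simp: surface_rel_def surface_act_def\<close>)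
  \<comment> \<open>Halving the height difference encodes the parity of \<open>k\<close> as an
    integrality condition: the first set collects the even, the second the odd
    \<open>k\<close>.\<close>
  have 2: "surface_rel tw = {z. (snd (snd z) - snd (fst z)) / 2 \<in> \<int> \<and> fst (snd z) - fst (fst z) \<in> \<int>}
      \<union> {z. (snd (snd z) - snd (fst z) - 1) / 2 \<in> \<int> \<and> fst (snd z) + fst (fst z) \<in> \<int>}" (is "_ = ?A \<union> ?B") if tw
  proof (intro equalityI subsetI)
    fix z :: "(real \<times> real) \<times> (real \<times> real)" assume "z \<in> surface_rel tw"
    then obtain j k where z: "snd z = surface_act tw j k (fst z)" by (auto simp: surface_rel_def)
    show "z \<in> ?A \<union> ?B"
    proof (cases "even k")
      case True
      then obtain m where "k = 2 * m" by blast
      then have "z \<in> ?A" using z by (simp add: surface_act_def)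
      then show ?thesis ..
    next
      case False
      then obtain m where "k = 2 * m + 1" by (elim oddE)
      then have "z \<in> ?B" using z that by (simp add: surface_act_def)
      then show ?thesis ..
    qed
  next
    fix z :: "(real \<times> real) \<times> (real \<times> real)" assume "z \<in> ?A \<union> ?B"
    then show "z \<in> surface_rel tw"
    proof
      assume "z \<in> ?A"
      then obtain m j where "(snd (snd z) - snd (fst z)) / 2 = of_int m" "fst (snd z) - fst (fst z) = of_int j"
        by (auto elim!: Ints_cases)
      then have "snd z = surface_act tw j (2 * m) (fst z)" by (auto simp: surface_act_def prod_eq_iff field_simps)
      then show ?thesis by (cases z) (auto simp: surface_rel_def)
    next
      assume "z \<in> ?B"
      then obtain m j where "(snd (snd z) - snd (fst z) - 1) / 2 = of_int m" "fst (snd z) + fst (fst z) = of_int j"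
        by (auto elim!: Ints_cases)
      then have "snd z = surface_act tw j (2 * m + 1) (fst z)" using that by (auto simp: surface_act_def prod_eq_iff field_simps)
      then show ?thesis by (cases z) (auto simp: surface_rel_def)
    qed
  qed
  have vim: "closed {z. f z \<in> \<int>}" if "continuous_on UNIV f" for f :: "(real \<times> real) \<times> (real \<times> real) \<Rightarrow> real"
    using closed_vimage[OF closed_Ints that] by (simp add: vimage_def)
  show ?thesis
  proof (cases tw)
    case True
    then show ?thesis unfolding 2[OF True]
      by (intro closed_Un closed_Collect_conj vim continuous_intros) auto
  next
    case False
    then show ?thesis unfolding 1[OF False]
      by (intro closed_Collect_conj vim continuous_intros)
  qed
qed

lemma quotient_map_surface: "quotient_map euclidean (surface tw) (\<lambda>p. surface_rel tw `` {p})"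
  using quotient_map_quotient_topology[of euclidean "surface_rel tw"] equiv_surface_rel
  by (simp add: surface_def)

lemma topspace_surface: "topspace (surface tw) = range (\<lambda>p. surface_rel tw `` {p})"
  using quotient_imp_surjective_map[OF quotient_map_surface] by simp

text \<open>The saturation of \<open>W\<close> is the union of its preimages under the deck
  transformations.\<close>

lemma openin_surface_image:
  assumes "open W"
  shows "openin (surface tw) ((\<lambda>p. surface_rel tw `` {p}) ` W)"
proof -
  have "\<Union>((\<lambda>p. surface_rel tw `` {p}) ` W) = (\<Union>j k. {p. surface_act tw j k p \<in> W})"
  proof -
    have "\<Union>((\<lambda>p. surface_rel tw `` {p}) ` W) = {p. \<exists>w\<in>W. (w, p) \<in> surface_rel tw}" by auto
    also have "\<dots> = {p. \<exists>w\<in>W. (p, w) \<in> surface_rel tw}" using surface_rel_sym by blast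
    also have "\<dots> = (\<Union>j k. {p. surface_act tw j k p \<in> W})" unfolding surface_rel_def by blast
    finally show ?thesis .
  qed
  moreover have "open {p. surface_act tw j k p \<in> W}" for j k
    using open_vimage[OF assms continuous_surface_act[OF continuous_on_id]] by (simp add: vimage_def)
  ultimately show ?thesis
    using openin_quotient_topology[of euclidean "surface_rel tw"] equiv_surface_rel
    by (auto simp: surface_def quotient_def intro!: open_UN)
qed

text \<open>A height difference below 1 forces \<open>k = 0\<close>, which also excludes the
  reflection, so both surfaces can be treated alike.\<close>

lemma surface_rel_close:
  assumes r: "(p, p') \<in> surface_rel tw" and y: "\<bar>snd p' - snd p\<bar> < 1"
  shows "snd p' = snd p \<and> fst p' - fst p \<in> \<int>"
proof -
  obtain j k where p': "p' = surface_act tw j k p" using r by (auto simp: surface_rel_def)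
  with y have "\<bar>real_of_int k\<bar> < 1" by (simp add: surface_act_def)
  then have "k = 0" by linarith
  then show ?thesis using p' by (simp add: surface_act_def)
qed

section \<open>Lifting configurations and paths from the surface to the plane\<close>

locale surface_configurations =
  fixes tw :: bool and n :: nat
begin

abbreviation "M \<equiv> surface tw"
abbreviation "R \<equiv> surface_rel tw"
abbreviation "UC \<equiv> unordered_configuration_space M n"

text \<open>\<open>Y\<close> is the preimage of the configuration space in $(\mathbb R^2)^n$, and \<open>q\<close> its projection
  to the unordered configuration space. Values of a configuration at indices \<open>\<ge> n\<close> are irrelevant.\<close>

definition Y :: "points set" where
  "Y = {v. \<forall>i<n. \<forall>j<n. i \<noteq> j \<longrightarrow> (v i, v j) \<notin> R}"

definition ordered :: "points \<Rightarrow> nat \<Rightarrow> (real \<times> real) set" where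
  "ordered v = (\<lambda>i\<in>{..<n}. R `` {v i})"

definition q :: "points \<Rightarrow> configuration" where
  "q v = permutation_rel M n `` {ordered v}"

lemma ordered_in_topspace: "ordered v \<in> topspace (configuration_space M n) \<longleftrightarrow> v \<in> Y"
  by (auto simp: configuration_space_def ordered_def Y_def inj_on_def topspace_surface surface_rel_class_eq)

lemma topspace_configuration_space: "topspace (configuration_space M n) = ordered ` Y"
proof (intro equalityI subsetI)
  fix x assume x: "x \<in> topspace (configuration_space M n)"
  then have "\<forall>i\<in>{..<n}. \<exists>p. x i = R `` {p}" and ext: "x \<in> extensional {..<n}"
    by (auto simp: configuration_space_def topspace_surface PiE_iff image_iff simp del: split_paired_Ex)
  then obtain v where "\<forall>i\<in>{..<n}. x i = R `` {v i}" by metis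
  then have "x = ordered v" using ext by (auto simp: ordered_def extensional_def fun_eq_iff)
  then show "x \<in> ordered ` Y" using x ordered_in_topspace by auto
qed (use ordered_in_topspace in auto)

lemma quotient_map_UC: "quotient_map (configuration_space M n) UC (\<lambda>x. permutation_rel M n `` {x})"
  unfolding unordered_configuration_space_def
  by (rule quotient_map_quotient_topology[OF equiv_permutation_rel])

lemma topspace_UC: "topspace UC = q ` Y"
  using quotient_imp_surjective_map[OF quotient_map_UC]
  by (auto simp: topspace_configuration_space q_def)

lemma q_in_topspace: "v \<in> Y \<Longrightarrow> q v \<in> topspace UC"
  by (simp add: topspace_UC)

lemma q_cong: "(\<And>i. i < n \<Longrightarrow> v i = w i) \<Longrightarrow> q v = q w"
  by (simp add: q_def ordered_def cong: restrict_cong)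

lemma ordered_comp:
  assumes "\<sigma> permutes {..<n}"
  shows "ordered w = ordered v \<circ> \<sigma> \<longleftrightarrow> (\<forall>i<n. (v (\<sigma> i), w i) \<in> R)"
proof -
  have "\<sigma> i < n \<longleftrightarrow> i < n" for i using permutes_in_image[OF assms, of i] by simp
  then show ?thesis
    by (auto simp: ordered_def fun_eq_iff restrict_def surface_rel_class_eq intro: surface_rel_sym)
qed

lemma q_eq_iff:
  assumes "v \<in> Y" "w \<in> Y"
  shows "q v = q w \<longleftrightarrow> (\<exists>\<sigma>. \<sigma> permutes {..<n} \<and> (\<forall>i<n. (v (\<sigma> i), w i) \<in> R))"
proof -
  have "q v = q w \<longleftrightarrow> (ordered v, ordered w) \<in> permutation_rel M n"
    unfolding q_def using eq_equiv_class_iff[OF equiv_permutation_rel] assms ordered_in_topspace by metis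
  then show ?thesis using assms ordered_in_topspace ordered_comp by (auto simp: permutation_rel_def)
qed

lemma act_in_Y:
  assumes v: "v \<in> Y" and \<sigma>: "\<sigma> permutes {..<n}" and w: "\<And>i. i < n \<Longrightarrow> (v (\<sigma> i), w i) \<in> R"
  shows "w \<in> Y"
  unfolding Y_def
proof (intro CollectI allI impI)
  fix i j assume ij: "i < n" "j < n" "i \<noteq> j"
  then have "\<sigma> i < n" "\<sigma> j < n" "\<sigma> i \<noteq> \<sigma> j"
    using permutes_in_image[OF \<sigma>] permutes_inj[OF \<sigma>] by (auto simp: inj_eq)
  then have "(v (\<sigma> i), v (\<sigma> j)) \<notin> R" using v by (simp add: Y_def)
  then show "(w i, w j) \<notin> R"
    using w[OF ij(1)] w[OF ij(2)] surface_rel_sym surface_rel_trans by meson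
qed

lemma q_act:
  assumes v: "v \<in> Y" and \<sigma>: "\<sigma> permutes {..<n}" and w: "\<And>i. i < n \<Longrightarrow> (v (\<sigma> i), w i) \<in> R"
  shows "q v = q w"
  using q_eq_iff[OF v act_in_Y[OF v \<sigma> w]] \<sigma> w by blast

lemma continuous_map_q:
  assumes P: "\<And>i. i < n \<Longrightarrow> continuous_map T euclidean (\<lambda>t. P t i)"
    and PY: "\<And>t. t \<in> topspace T \<Longrightarrow> P t \<in> Y"
  shows "continuous_map T UC (\<lambda>t. q (P t))"
proof -
  have "continuous_map T (configuration_space M n) (\<lambda>t. ordered (P t))"
    unfolding configuration_space_def continuous_map_in_subtopology continuous_map_componentwise
  proof (intro conjI ballI)
    show "(\<lambda>t. ordered (P t)) ` topspace T \<subseteq> extensional {..<n}" by (auto simp: ordered_def)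
    fix i assume "i \<in> {..<n}"
    then show "continuous_map T M (\<lambda>t. ordered (P t) i)"
      using continuous_map_compose[OF P quotient_imp_continuous_map[OF quotient_map_surface]]
      by (simp add: ordered_def o_def)
    next
    show "(\<lambda>t. ordered (P t)) \<in> topspace T \<rightarrow> {x. inj_on x {..<n}}"
      using ordered_in_topspace PY by (auto simp: configuration_space_def)
  qed
  then show ?thesis
    using continuous_map_compose[OF _ quotient_imp_continuous_map[OF quotient_map_UC]]
    by (simp add: q_def o_def)
qed

text \<open>Each curve of pairs \<open>(P t i, P t j)\<close> is compact and misses the closed set
  \<open>R\<close>; half its distance from \<open>R\<close> serves both points, and the finitely
  many pairs have a common bound.\<close>

lemma Y_margin:
  assumes P: "\<And>i. i < n \<Longrightarrow> continuous_on {0..1::real} (\<lambda>t. P t i)"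
    and PY: "\<And>t. t \<in> {0..1} \<Longrightarrow> P t \<in> Y"
  obtains e where "e > 0" "\<And>t v w i j. t \<in> {0..1} \<Longrightarrow> i < n \<Longrightarrow> j < n \<Longrightarrow> i \<noteq> j \<Longrightarrow>
     dist v (P t i) < e \<Longrightarrow> dist w (P t j) < e \<Longrightarrow> (v, w) \<notin> R"
proof -
  have "\<exists>e>0. \<forall>t\<in>{0..1}. \<forall>v w. dist v (P t i) < e \<longrightarrow> dist w (P t j) < e \<longrightarrow> (v, w) \<notin> R"
    if ij: "i < n" "j < n" "i \<noteq> j" for i j
  proof -
    let ?S = "(\<lambda>t. (P t i, P t j)) ` {0..1}"
    have "compact ?S" using P ij by (intro compact_continuous_image continuous_intros) auto
    moreover have "?S \<inter> R = {}" using PY ij by (auto simp: Y_def)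
    ultimately obtain d where d: "d > 0" "\<And>x y. x \<in> ?S \<Longrightarrow> y \<in> R \<Longrightarrow> d \<le> dist x y"
      using separate_compact_closed[OF _ closed_surface_rel] by metis
    show ?thesis
    proof (intro exI[of _ "d/2"] conjI ballI allI impI notI)
      fix t v w assume t: "t \<in> {0..1::real}" "dist v (P t i) < d/2" "dist w (P t j) < d/2" "(v, w) \<in> R"
      have "dist (P t i, P t j) (v, w) \<le> dist (P t i) v + dist (P t j) w"
        unfolding dist_Pair_Pair by (rule sqrt_sum_squares_le_sum) auto
      also have "\<dots> < d" using t by (simp add: dist_commute)
      finally show False using d(2)[OF imageI[OF t(1)] t(4)] by simp
    qed (use d in auto)
  qed
  then obtain e where e: "\<And>i j. i < n \<Longrightarrow> j < n \<Longrightarrow> i \<noteq> j \<Longrightarrow> e i j > 0 \<and>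
      (\<forall>t\<in>{0..1}. \<forall>v w. dist v (P t i) < e i j \<longrightarrow> dist w (P t j) < e i j \<longrightarrow> (v, w) \<notin> R)" by metis
  \<comment> \<open>The extra 1 keeps the set nonempty when there are no pairs.\<close>
  let ?E = "insert 1 {e i j |i j. i < n \<and> j < n \<and> i \<noteq> j}"
  have fin: "finite ?E"
  proof (rule finite.insertI, rule finite_subset)
    show "{e i j |i j. i < n \<and> j < n \<and> i \<noteq> j} \<subseteq> (\<lambda>(i, j). e i j) ` ({..<n} \<times> {..<n})" by auto
  qed auto
  show ?thesis
  proof
    show "Min ?E > 0" using fin e by (subst Min_gr_iff) auto
    fix t v w i j assume A: "t \<in> {0..1}" "i < n" "j < n" "i \<noteq> j" "dist v (P t i) < Min ?E" "dist w (P t j) < Min ?E"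
    then have "Min ?E \<le> e i j" using fin by (intro Min_le) auto
    then show "(v, w) \<notin> R" using e[of i j] A by (meson less_le_trans)
  qed
qed

text \<open>The saturation of the box is the union, over all permutations, of the permuted products
  of open sets.\<close>

lemma openin_q_box:
  assumes W: "\<And>i. i < n \<Longrightarrow> open (W i)" and WY: "{w. \<forall>i<n. w i \<in> W i} \<subseteq> Y"
  shows "openin UC (q ` {w. \<forall>i<n. w i \<in> W i})"
proof -
  let ?V = "{w. \<forall>i<n. w i \<in> W i}" and ?p = "\<lambda>p. R `` {p}"
  let ?O = "\<lambda>\<sigma>. topspace (configuration_space M n) \<inter> (\<Pi>\<^sub>E i\<in>{..<n}. ?p ` W (\<sigma> i))"
  have eq: "\<Union>(q ` ?V) = (\<Union>\<sigma>\<in>{\<sigma>. \<sigma> permutes {..<n}}. ?O \<sigma>)"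
  proof (intro equalityI subsetI)
    fix x assume "x \<in> \<Union>(q ` ?V)"
    then obtain w \<sigma> where w: "w \<in> ?V" and \<sigma>: "\<sigma> permutes {..<n}" and x: "x = ordered w \<circ> \<sigma>"
      by (auto simp: q_def permutation_rel_def)
    have \<sigma>n: "\<sigma> i < n \<longleftrightarrow> i < n" for i using permutes_in_image[OF \<sigma>, of i] by simp
    have "x \<in> topspace (configuration_space M n)"
      unfolding x using w WY by (intro configuration_space_permute \<sigma>) (auto simp: ordered_in_topspace)
    moreover have "x \<in> (\<Pi>\<^sub>E i\<in>{..<n}. ?p ` W (\<sigma> i))"
      using w \<sigma>n unfolding x by (auto simp: ordered_def PiE_iff extensional_def)
    ultimately show "x \<in> (\<Union>\<sigma>\<in>{\<sigma>. \<sigma> permutes {..<n}}. ?O \<sigma>)" using \<sigma> by blast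
  next
    fix x assume "x \<in> (\<Union>\<sigma>\<in>{\<sigma>. \<sigma> permutes {..<n}}. ?O \<sigma>)"
    then obtain \<sigma> where \<sigma>: "\<sigma> permutes {..<n}" and x: "x \<in> topspace (configuration_space M n)"
       "x \<in> (\<Pi>\<^sub>E i\<in>{..<n}. ?p ` W (\<sigma> i))" by auto
    then have "\<forall>i\<in>{..<n}. \<exists>w\<in>W (\<sigma> i). x i = ?p w" by (auto simp: PiE_iff)
    then obtain w where w: "\<And>i. i < n \<Longrightarrow> w i \<in> W (\<sigma> i) \<and> x i = ?p (w i)" by (metis lessThan_iff)
    define w' where "w' = w \<circ> inv_into UNIV \<sigma>"
    have \<sigma>n: "\<sigma> i < n \<longleftrightarrow> i < n" "inv_into UNIV \<sigma> i < n \<longleftrightarrow> i < n" for i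
      using permutes_in_image[OF \<sigma>, of i] permutes_in_image[OF permutes_inv[OF \<sigma>], of i] by simp_all
    have inv: "inv_into UNIV \<sigma> (\<sigma> i) = i" "\<sigma> (inv_into UNIV \<sigma> i) = i" for i
      using permutes_inverses[OF \<sigma>] by auto
    have w'V: "w' \<in> ?V" using w \<sigma>n inv by (auto simp: w'_def) (metis inv(2) \<sigma>n(2))
    have "x = ordered w' \<circ> \<sigma>"
    proof
      fix i show "x i = (ordered w' \<circ> \<sigma>) i"
        using w[of i] x(2) \<sigma>n inv by (cases "i < n") (auto simp: ordered_def w'_def PiE_iff extensional_def)
    qed
    moreover have "ordered w' \<in> topspace (configuration_space M n)" using w'V WY ordered_in_topspace by blast
    ultimately have "x \<in> q w'" using \<sigma> by (auto simp: q_def permutation_rel_def)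
    then show "x \<in> \<Union>(q ` ?V)" using w'V by blast
  qed
  have "openin (configuration_space M n) (?O \<sigma>)" if \<sigma>: "\<sigma> permutes {..<n}" for \<sigma>
  proof -
    have "\<sigma> i < n \<longleftrightarrow> i < n" for i using permutes_in_image[OF \<sigma>, of i] by simp
    then have "openin (product_topology (\<lambda>_. M) {..<n}) (\<Pi>\<^sub>E i\<in>{..<n}. ?p ` W (\<sigma> i))"
      using W by (subst openin_PiE) (auto intro!: openin_surface_image)
    note * = this openin_subset[OF this]
    then show ?thesis unfolding configuration_space_def openin_subtopology topspace_subtopology
      by (intro exI[of _ "\<Pi>\<^sub>E i\<in>{..<n}. ?p ` W (\<sigma> i)"] conjI) blast+
  qed
  then have "openin (configuration_space M n) (\<Union>(q ` ?V))" unfolding eq by blast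
  moreover have "q ` ?V \<subseteq> topspace (configuration_space M n) // permutation_rel M n"
    using WY topspace_UC topspace_quotient_topology[OF equiv_permutation_rel, of M n]
    by (auto simp: unordered_configuration_space_def)
  ultimately show ?thesis
    unfolding unordered_configuration_space_def
    by (simp add: openin_quotient_topology[OF equiv_permutation_rel])
qed

text \<open>On a small box the projection is injective up to the irrelevant indices, and it maps
  smaller boxes to open sets, so its inverse is continuous.\<close>

lemma local_section:
  assumes v0: "v0 \<in> Y"
  obtains U s where "openin UC U" "q v0 \<in> U" "\<And>u. u \<in> U \<Longrightarrow> s u \<in> Y \<and> q (s u) = u"
    "\<And>i. i < n \<Longrightarrow> continuous_map (subtopology UC U) euclidean (\<lambda>u. s u i)"
proof -
  obtain e0 where e0: "e0 > 0" "\<And>v w i j. i < n \<Longrightarrow> j < n \<Longrightarrow> i \<noteq> j \<Longrightarrow>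
     dist v (v0 i) < e0 \<Longrightarrow> dist w (v0 j) < e0 \<Longrightarrow> (v, w) \<notin> R"
  proof -
    obtain e where e: "e > 0" "\<And>t v w i j. t \<in> {0..1::real} \<Longrightarrow> i < n \<Longrightarrow> j < n \<Longrightarrow> i \<noteq> j \<Longrightarrow>
       dist v (v0 i) < e \<Longrightarrow> dist w (v0 j) < e \<Longrightarrow> (v, w) \<notin> R"
      using Y_margin[of "\<lambda>_. v0"] v0 by (metis continuous_on_const)
    show thesis by (rule that[of e]) (use e(1) e(2)[of 0] in auto)
  qed
  \<comment> \<open>The bound \<open>e0\<close> keeps balls of different indices unrelated, so only
    the identity permutation remains; 1/4 makes each ball so small that two of its points are
    related only if they are equal.\<close>
  define e where "e = min e0 (1/4)"
  define B where "B i = ball (v0 i) e" for i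
  define V where "V = {w. \<forall>i<n. w i \<in> B i}"
  have sep: "(v, w) \<notin> R" if "i < n" "j < n" "i \<noteq> j" "v \<in> B i" "w \<in> B j" for v w i j
    using that e0(2)[of i j v w] by (auto simp: B_def e_def dist_commute)
  have VY: "V \<subseteq> Y" by (auto simp: V_def Y_def dest: sep)
  have inj: "v i = w i" if vw: "v \<in> V" "w \<in> V" "q v = q w" and i: "i < n" for v w i
  proof -
    obtain \<sigma> where \<sigma>: "\<sigma> permutes {..<n}" "\<And>i. i < n \<Longrightarrow> (v (\<sigma> i), w i) \<in> R"
      using q_eq_iff[of v w] vw VY by blast
    have "\<sigma> i < n" using permutes_in_image[OF \<sigma>(1), of i] i by simp
    then have "\<sigma> i = i" using sep[of "\<sigma> i" i "v (\<sigma> i)" "w i"] \<sigma>(2)[OF i] vw i by (auto simp: V_def)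
    then have r: "(v i, w i) \<in> R" using \<sigma>(2)[OF i] by simp
    have "dist (v i) (w i) < 1"
      using vw(1,2) i dist_triangle_less_add[of "v i" "v0 i" e "w i" e]
      by (auto simp: V_def B_def e_def dist_commute)
    then have d: "\<bar>fst (w i) - fst (v i)\<bar> < 1" "\<bar>snd (w i) - snd (v i)\<bar> < 1"
      using dist_fst_le[of "v i" "w i"] dist_snd_le[of "v i" "w i"] by (auto simp: dist_real_def)
    have "snd (w i) = snd (v i)" "fst (w i) - fst (v i) \<in> \<int>" using surface_rel_close[OF r d(2)] by auto
    moreover obtain z where z: "fst (w i) - fst (v i) = of_int z" using calculation(2) by (elim Ints_cases)
    moreover from z have "z = 0" using d(1) by linarith
    ultimately show ?thesis by (simp add: prod_eq_iff)
  qed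
  define s where "s u = (SOME w. w \<in> V \<and> q w = u)" for u
  have s: "s u \<in> V \<and> q (s u) = u" if "u \<in> q ` V" for u
  proof -
    from that obtain w where "w \<in> V \<and> q w = u" by blast
    then show ?thesis unfolding s_def by (rule someI[of "\<lambda>w. w \<in> V \<and> q w = u"])
  qed
  show ?thesis
  proof
    show "openin UC (q ` V)" using openin_q_box[of B] VY by (simp add: V_def B_def)
    show "q v0 \<in> q ` V" using e0(1) by (intro imageI) (auto simp: V_def B_def e_def)
    show "s u \<in> Y \<and> q (s u) = u" if "u \<in> q ` V" for u using s[OF that] VY by blast
    fix i assume i: "i < n"
    have "openin (subtopology UC (q ` V)) {u \<in> q ` V. s u i \<in> W}" if W: "open W" for W
    proof -
      let ?B = "\<lambda>j. if j = i then B i \<inter> W else B j"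
      have eq: "{u \<in> q ` V. s u i \<in> W} = q ` {w. \<forall>j<n. w j \<in> ?B j}"
      proof (intro equalityI subsetI)
        fix u assume "u \<in> {u \<in> q ` V. s u i \<in> W}"
        then have "s u \<in> {w. \<forall>j<n. w j \<in> ?B j}" "u = q (s u)" using s[of u] i by (auto simp: V_def)
        then show "u \<in> q ` {w. \<forall>j<n. w j \<in> ?B j}" by blast
      next
        fix u assume "u \<in> q ` {w. \<forall>j<n. w j \<in> ?B j}"
        then obtain w where w: "u = q w" "\<forall>j<n. w j \<in> ?B j" by blast
        then have wV: "w \<in> V" by (auto simp: V_def split: if_splits)
        then have "s u i = w i" using s[of u] w inj i by (metis imageI)
        then show "u \<in> {u \<in> q ` V. s u i \<in> W}" using w wV i by auto
      qed
      have sub: "{w. \<forall>j<n. w j \<in> ?B j} \<subseteq> V" by (auto simp: V_def split: if_splits)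
      have "openin UC (q ` {w. \<forall>j<n. w j \<in> ?B j})"
        using sub VY W by (intro openin_q_box) (auto simp: B_def)
      moreover have "q ` {w. \<forall>j<n. w j \<in> ?B j} = q ` {w. \<forall>j<n. w j \<in> ?B j} \<inter> q ` V"
        using image_mono[OF sub, of q] by (rule Int_absorb2[symmetric])
      ultimately show ?thesis unfolding eq openin_subtopology by blast
    qed
    moreover have "topspace (subtopology UC (q ` V)) = q ` V"
      using VY by (auto simp: topspace_UC)
    ultimately show "continuous_map (subtopology UC (q ` V)) euclidean (\<lambda>u. s u i)"
      unfolding continuous_map_def by auto
  qed
qed

text \<open>An interval property that is additive under concatenation and true for short intervals,
  as the \<open>Bolzano\<close> induction needs. The bounds 0 and 1 are premises because the
  induction ranges over intervals that need not lie in the unit interval.\<close>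

lemma path_lifting_segment:
  assumes p: "pathin UC p" and ac: "a \<le> c"
  shows "0 \<le> a \<longrightarrow> c \<le> 1 \<longrightarrow> (\<forall>v\<in>Y. q v = p a \<longrightarrow> (\<exists>P. P a = v \<and>
     (\<forall>i<n. continuous_on {a..c} (\<lambda>t. P t i)) \<and> (\<forall>t\<in>{a..c}. P t \<in> Y \<and> q (P t) = p t)))"
  using ac
proof (induction rule: Bolzano)
  case (trans a d c)
  show ?case
  proof (intro impI ballI)
    fix v assume v: "0 \<le> a" "c \<le> 1" "v \<in> Y" "q v = p a"
    then obtain P where P: "P a = v" "\<And>i. i < n \<Longrightarrow> continuous_on {a..d} (\<lambda>t. P t i)"
       "\<And>t. t \<in> {a..d} \<Longrightarrow> P t \<in> Y \<and> q (P t) = p t" using trans by force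
    have "P d \<in> Y" "q (P d) = p d" using P(3)[of d] trans(3) by auto
    then obtain P' where P': "P' d = P d" "\<And>i. i < n \<Longrightarrow> continuous_on {d..c} (\<lambda>t. P' t i)"
       "\<And>t. t \<in> {d..c} \<Longrightarrow> P' t \<in> Y \<and> q (P' t) = p t" using trans v by force
    have "continuous_on ({a..d} \<union> {d..c}) (\<lambda>t. if t \<le> d then P t i else P' t i)" if "i < n" for i
      by (rule continuous_on_If) (use P P' that in auto)
    moreover have "{a..d} \<union> {d..c} = {a..c}" using trans(3,4) by auto
    moreover define Q where "Q t i = (if t \<le> d then P t i else P' t i)" for t i
    moreover from this have "Q t = P t" if "t \<le> d" for t using that by (simp add: fun_eq_iff)
    moreover from calculation have "Q t = P' t" if "\<not> t \<le> d" for t using that by (simp add: fun_eq_iff)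
    ultimately show "\<exists>P. P a = v \<and> (\<forall>i<n. continuous_on {a..c} (\<lambda>t. P t i)) \<and> (\<forall>t\<in>{a..c}. P t \<in> Y \<and> q (P t) = p t)"
      using P(1,3) P'(3) trans(3,4)
      by (intro exI[of _ Q] conjI allI impI ballI) (simp, simp, metis atLeastAtMost_iff linear, metis atLeastAtMost_iff linear)
  qed
next
  case (local x)
  show ?case
  proof (cases "x \<in> {0..1}")
    case False
    then show ?thesis
      by (intro exI[of _ "if x < 0 then - x else x - 1"]) auto
  next
    case True
    then obtain v0 where v0: "v0 \<in> Y" "p x = q v0"
      using path_image_subset_topspace[OF p] topspace_UC by blast
    obtain U s where U: "openin UC U" "q v0 \<in> U" "\<And>u. u \<in> U \<Longrightarrow> s u \<in> Y \<and> q (s u) = u"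
      "\<And>i. i < n \<Longrightarrow> continuous_map (subtopology UC U) euclidean (\<lambda>u. s u i)"
      using local_section[OF v0(1)] by metis
    have "openin (top_of_set {0..1}) {t \<in> {0..1}. p t \<in> U}"
      using p U(1) by (auto simp: pathin_def continuous_map_def)
    moreover have "x \<in> {t \<in> {0..1}. p t \<in> U}" using True v0 U(2) by simp
    ultimately obtain d where d: "d > 0" "\<And>t. t \<in> {0..1} \<Longrightarrow> dist t x < d \<Longrightarrow> p t \<in> U"
      unfolding openin_euclidean_subtopology_iff by blast
    show ?thesis
    proof (intro exI[of _ d] conjI allI impI ballI)
      fix a c v
      assume ac: "a \<le> x \<and> x \<le> c \<and> c - a < d" "0 \<le> a" "c \<le> 1" and v: "v \<in> Y" "q v = p a"
      have pU: "p t \<in> U" if "t \<in> {a..c}" for t using that ac by (intro d(2)) (auto simp: dist_real_def)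
      have a: "a \<in> {a..c}" using ac by auto
      obtain \<sigma> where \<sigma>: "\<sigma> permutes {..<n}" "\<And>i. i < n \<Longrightarrow> (s (p a) (\<sigma> i), v i) \<in> R"
        using q_eq_iff[of "s (p a)" v] U(3)[OF pU[OF a]] v by auto
      then have "\<forall>i. \<exists>j k. i < n \<longrightarrow> v i = surface_act tw j k (s (p a) (\<sigma> i))" by (auto simp: surface_rel_def)
      then obtain j k where jk: "\<And>i. i < n \<Longrightarrow> v i = surface_act tw (j i) (k i) (s (p a) (\<sigma> i))" by metis
      \<comment> \<open>The local section is moved by the permutation and the deck transformations
        that take its value at \<open>p a\<close> to \<open>v\<close>. The first case makes
        \<open>P a = v\<close> hold at the irrelevant indices too.\<close>
      define P where "P t = (\<lambda>i. if t = a \<and> n \<le> i then v i else surface_act tw (j i) (k i) (s (p t) (\<sigma> i)))" for t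
      have "P a = v" using jk by (auto simp: P_def)
      moreover have "continuous_on {a..c} (\<lambda>t. P t i)" if i: "i < n" for i
      proof -
        have \<sigma>i: "\<sigma> i < n" using permutes_in_image[OF \<sigma>(1), of i] i by simp
        have "continuous_map (top_of_set {a..c}) UC p"
          using p ac continuous_map_from_subtopology_mono[of euclideanreal "{0..1}" UC p "{a..c}"]
          by (auto simp: pathin_def)
        then have "continuous_map (top_of_set {a..c}) (subtopology UC U) p"
          using pU by (auto simp: continuous_map_in_subtopology)
        from continuous_map_compose[OF this U(4)[OF \<sigma>i]]
        have "continuous_on {a..c} (\<lambda>t. s (p t) (\<sigma> i))" by (simp add: o_def)
        then show ?thesis using i by (auto simp: P_def intro!: continuous_intros)
      qed
      moreover have "P t \<in> Y \<and> q (P t) = p t" if t: "t \<in> {a..c}" for t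
      proof -
        have r: "(s (p t) (\<sigma> i), P t i) \<in> R" if "i < n" for i
          using that surface_rel_act by (simp add: P_def)
        show ?thesis using act_in_Y[of "s (p t)" \<sigma> "P t"] q_act[of "s (p t)" \<sigma> "P t"] \<sigma>(1) r U(3)[OF pU[OF t]] by auto
      qed
      ultimately show "\<exists>P. P a = v \<and> (\<forall>i<n. continuous_on {a..c} (\<lambda>t. P t i)) \<and> (\<forall>t\<in>{a..c}. P t \<in> Y \<and> q (P t) = p t)"
        by blast
    qed (use d in auto)
  qed
qed

lemma path_lifting:
  assumes p: "pathin UC p" and v: "v \<in> Y" "q v = p 0"
  obtains P where "P 0 = v" "\<And>i. i < n \<Longrightarrow> continuous_on {0..1} (\<lambda>t. P t i)"
    "\<And>t. t \<in> {0..1} \<Longrightarrow> P t \<in> Y" "\<And>t. t \<in> {0..1} \<Longrightarrow> q (P t) = p t"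
  using path_lifting_segment[OF p, of 0 1] v by auto

section \<open>Translations and central loops\<close>

definition shift :: "real \<times> real \<Rightarrow> points \<Rightarrow> nat \<Rightarrow> real \<times> real" where
  "shift e v = (\<lambda>i. v i + e)"

text \<open>A twisted deck transformation may reverse the horizontal direction, so only vertical
  translations commute with all of them.\<close>

lemma surface_rel_shift:
  assumes "tw \<Longrightarrow> fst e = 0"
  shows "(p + e, p' + e) \<in> R \<longleftrightarrow> (p, p') \<in> R"
  using assms by (cases tw) (auto simp: surface_rel_def surface_act_def prod_eq_iff)

lemma shift_in_Y: "(tw \<Longrightarrow> fst e = 0) \<Longrightarrow> v \<in> Y \<Longrightarrow> shift e v \<in> Y"
  by (simp add: Y_def shift_def surface_rel_shift)

lemma q_shift_cong:
  assumes "tw \<Longrightarrow> fst e = 0" "v \<in> Y" "w \<in> Y" "q v = q w"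
  shows "q (shift e v) = q (shift e w)"
  using assms by (simp add: q_eq_iff shift_in_Y) (simp add: shift_def surface_rel_shift)

text \<open>For odd \<open>k\<close> a twisted deck transformation differs from the translation by a
  reflection, hence the parity condition.\<close>

lemma q_shift_integral:
  assumes "v \<in> Y" "e = (of_int j, of_int k)" "tw \<Longrightarrow> even k"
  shows "q (shift e v) = q v"
proof -
  have "(v (id i), shift e v i) \<in> R" for i
    using surface_rel_act[of "v i" tw j k] assms by (auto simp: shift_def surface_act_def prod_eq_iff add.commute plus_prod_def)
  then show ?thesis using q_act[OF assms(1) permutes_id] by metis
qed

definition flow_loop :: "real \<times> real \<Rightarrow> points \<Rightarrow> real \<Rightarrow> configuration" where
  "flow_loop e v = (\<lambda>t. q (shift (t *\<^sub>R e) v))"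

lemma flow_loop_in_loops:
  assumes v: "v \<in> Y" and e: "tw \<Longrightarrow> fst e = 0" "e = (of_int j, of_int k)" "tw \<Longrightarrow> even k"
  shows "flow_loop e v \<in> loops UC (q v)"
proof -
  have "pathin UC (flow_loop e v)"
    unfolding pathin_def flow_loop_def
    using v e(1) by (intro continuous_map_q) (auto simp: shift_def[abs_def] intro!: continuous_intros shift_in_Y[unfolded shift_def])
  then show ?thesis
    using q_shift_integral[OF v e(2,3)] by (auto simp: loops_def flow_loop_def shift_def)
qed

text \<open>Flowing a lift of the loop gives a map of the square whose opposite sides agree.\<close>

lemma flow_loop_central:
  assumes v: "v \<in> Y" and e: "tw \<Longrightarrow> fst e = 0" "e = (of_int j, of_int k)" "tw \<Longrightarrow> even k"
    and g: "g \<in> carrier (fundamental_group UC (q v))"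
  shows "loop_class UC (q v) (flow_loop e v) \<otimes>\<^bsub>fundamental_group UC (q v)\<^esub> g
       = g \<otimes>\<^bsub>fundamental_group UC (q v)\<^esub> loop_class UC (q v) (flow_loop e v)"
proof -
  obtain p where p: "p \<in> loops UC (q v)" "g = loop_class UC (q v) p"
    using g by (auto simp: carrier_fundamental_group)
  then have p': "pathin UC p" "p 0 = q v" "p 1 = q v" by (auto simp: loops_def)
  obtain P where P: "P 0 = v" "\<And>i. i < n \<Longrightarrow> continuous_on {0..1} (\<lambda>t. P t i)"
    "\<And>t. t \<in> {0..1} \<Longrightarrow> P t \<in> Y" "\<And>t. t \<in> {0..1} \<Longrightarrow> q (P t) = p t"
    using path_lifting[OF p'(1) v] p'(2) by metis
  define h where "h z = q (shift (snd z *\<^sub>R e) (P (fst z)))" for z :: "real \<times> real"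
  have "continuous_map (top_of_set ({0..1} \<times> {0..1})) UC h"
    unfolding h_def
  proof (rule continuous_map_q)
    fix i assume "i < n"
    then show "continuous_map (top_of_set ({0..1} \<times> {0..1})) euclidean (\<lambda>t. shift (snd t *\<^sub>R e) (P (fst t)) i)"
      unfolding shift_def by (auto intro!: continuous_intros continuous_on_compose2[OF P(2)])
  next
    fix t :: "real \<times> real" assume "t \<in> topspace (top_of_set ({0..1} \<times> {0..1}))"
    then show "shift (snd t *\<^sub>R e) (P (fst t)) \<in> Y" using P(3) e(1) by (intro shift_in_Y) auto
  qed
  moreover have "h (s, 0) = p s" "h (s, 1) = p s" if "s \<in> {0..1}" for s
    using P(4)[OF that] q_shift_integral[OF P(3)[OF that] e(2,3)] by (auto simp: h_def shift_def)
  moreover have "h (0, t) = flow_loop e v t" for t by (simp add: h_def flow_loop_def P(1))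
  \<comment> \<open>The end of the lift is a deck translate of \<open>v\<close> up to a permutation,
    and the flow commutes with both.\<close>
  moreover have "h (1, t) = flow_loop e v t" for t
    using q_shift_cong[of "t *\<^sub>R e" "P 1" v] e(1) P(3)[of 1] P(4)[of 1] v p'(3)
    by (simp add: h_def flow_loop_def)
  ultimately have "g \<otimes>\<^bsub>fundamental_group UC (q v)\<^esub> loop_class UC (q v) (flow_loop e v)
     = loop_class UC (q v) (flow_loop e v) \<otimes>\<^bsub>fundamental_group UC (q v)\<^esub> g"
    unfolding p(2) using flow_loop_in_loops[OF v e] p(1)
    by (intro loop_class_commute[of UC h]) auto
  then show ?thesis by simp
qed

section \<open>Characters from invariant functions on the plane\<close>

lemma continuous_map_prod_complex:
  fixes f :: "'a \<Rightarrow> 'i \<Rightarrow> complex"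
  assumes "\<And>i. i \<in> I \<Longrightarrow> continuous_map X euclidean (\<lambda>x. f x i)"
  shows "continuous_map X euclidean (\<lambda>x. \<Prod>i\<in>I. f x i)"
  using assms by (simp add: continuous_map_atin tendsto_prod)

text \<open>The product over all points is symmetric, so it descends from ordered to unordered
  configurations.\<close>

lemma invariant_product:
  fixes g :: "real \<times> real \<Rightarrow> complex"
  assumes g: "continuous_on UNIV g" "\<And>p. g p \<noteq> 0" "\<And>p p'. (p, p') \<in> R \<Longrightarrow> g p = g p'"
  obtains f where "continuous_map UC (top_of_set (- {0})) f" "\<And>v. v \<in> Y \<Longrightarrow> f (q v) = (\<Prod>i<n. g (v i))"
proof -
  have gR: "g x = g y" if "R `` {x} = R `` {y}" for x y using that g(3) surface_rel_class_eq by blast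
  have "continuous_map euclidean euclidean g" using g(1) by simp
  then obtain k where k: "continuous_map M euclidean k" "\<And>p. p \<in> topspace euclidean \<Longrightarrow> k (R `` {p}) = g p"
    using gR quotient_map_lift_exists[OF quotient_map_surface] by metis
  define F where "F x = (\<Prod>i<n. k (x i))" for x
  have Fv: "F (ordered v) = (\<Prod>i<n. g (v i))" for v by (simp add: F_def ordered_def k)
  have "continuous_map (configuration_space M n) euclidean F"
    unfolding F_def configuration_space_def
  proof (intro continuous_map_from_subtopology continuous_map_prod_complex)
    fix i assume "i \<in> {..<n}"
    then show "continuous_map (product_topology (\<lambda>_. M) {..<n}) euclidean (\<lambda>x. k (x i))"
      using continuous_map_compose[OF continuous_map_product_projection[of i "{..<n}" "\<lambda>_. M"] k(1)]
      by (simp add: o_def)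
  qed
  moreover have "F ` topspace (configuration_space M n) \<subseteq> - {0}"
  proof clarify
    fix x assume "x \<in> topspace (configuration_space M n)"
    then obtain v where "x = ordered v" by (auto simp: topspace_configuration_space)
    then have "F x \<noteq> 0" using g(2) by (simp add: Fv del: split_paired_All)
    moreover assume "F x = 0"
    ultimately show False by simp
  qed
  ultimately have cF: "continuous_map (configuration_space M n) (top_of_set (- {0})) F"
    by (auto simp: continuous_map_in_subtopology)
  have "F x = F y" if "x \<in> topspace (configuration_space M n)" "y \<in> topspace (configuration_space M n)"
     "permutation_rel M n `` {x} = permutation_rel M n `` {y}" for x y
  proof -
    have "(x, y) \<in> permutation_rel M n" using eq_equiv_class_iff[OF equiv_permutation_rel] that by metis
    then obtain \<sigma> where \<sigma>: "\<sigma> permutes {..<n}" "y = x \<circ> \<sigma>" by (auto simp: permutation_rel_def)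
    then show ?thesis unfolding F_def using prod.permute[OF \<sigma>(1), of "\<lambda>i. k (x i)"] by (simp add: o_def)
  qed
  then obtain f where "continuous_map UC (top_of_set (- {0})) f"
     "\<And>x. x \<in> topspace (configuration_space M n) \<Longrightarrow> f (permutation_rel M n `` {x}) = F x"
    using quotient_map_lift_exists[OF quotient_map_UC cF] by metis
  then show ?thesis using that Fv ordered_in_topspace by (simp add: q_def)
qed

text \<open>The total displacement of the points of a loop in the direction \<open>L\<close>.\<close>

lemma displacement_character:
  assumes L: "L = snd \<or> (L = fst \<and> \<not> tw)" and v: "v \<in> Y"
  obtains \<phi> where "\<phi> \<in> characters (fundamental_group UC (q v))"
    "\<And>(e :: real \<times> real) j k. e = (of_int j, of_int k) \<Longrightarrow> (tw \<Longrightarrow> fst e = 0 \<and> even k) \<Longrightarrow>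
       \<phi> (loop_class UC (q v) (flow_loop e v)) = real n * L e"
proof -
  define g where "g p = exp (2 * of_real pi * \<i> * of_real (L p))" for p :: "real \<times> real"
  have gc: "continuous_on UNIV g" using L unfolding g_def by (auto intro!: continuous_intros)
  have gi: "g p = g p'" if "(p, p') \<in> R" for p p'
  proof -
    have "(p, p') \<in> R" by fact
    then obtain m :: int where "L p' = L p + of_int m"
    proof -
      from \<open>(p, p') \<in> R\<close> obtain j k where "p' = surface_act tw j k p" by (auto simp: surface_rel_def)
      then show thesis using L that[of j] that[of k] by (auto simp: surface_act_def)
    qed
    then have "2 * of_real pi * \<i> * of_real (L p') = 2 * of_real pi * \<i> * of_real (L p) + of_real (2 * of_int m * pi) * \<i>"
      by (simp add: algebra_simps)
    moreover have "exp (of_real (2 * of_int m * pi) * \<i>) = 1" by (rule exp_integer_2pi) simp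
    ultimately show ?thesis by (simp add: g_def exp_add)
  qed
  obtain f where f: "continuous_map UC (top_of_set (- {0})) f" "\<And>v. v \<in> Y \<Longrightarrow> f (q v) = (\<Prod>i<n. g (v i))"
    by (rule invariant_product[OF gc _ gi]) (auto simp: g_def)
  show ?thesis
  proof
    show "winding_character UC (q v) f \<in> characters (fundamental_group UC (q v))"
      by (rule winding_character_in_characters[OF f(1)])
    fix e :: "real \<times> real" and j k :: int assume e: "e = (of_int j, of_int k)" "tw \<Longrightarrow> fst e = 0 \<and> even k"
    have Lsum: "L (p + t *\<^sub>R e) = L p + t * L e" for p t using L by auto
    \<comment> \<open>All \<open>n\<close> points move with velocity \<open>e\<close>, so the lifted
      angle is affine with slope \<open>real n * L e\<close>.\<close>
    let ?\<theta> = "\<lambda>t. (\<Sum>i<n. L (v i)) + t * (real n * L e)"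
    have l: "flow_loop e v \<in> loops UC (q v)" using e by (intro flow_loop_in_loops[OF v]) auto
    have "winding_character UC (q v) f (loop_class UC (q v) (flow_loop e v)) = ?\<theta> 1 - ?\<theta> 0"
    proof (rule winding_character_lift[OF f(1) l])
      fix t :: real
      have "f (flow_loop e v t) = (\<Prod>i<n. g (shift (t *\<^sub>R e) v i))"
        unfolding flow_loop_def using e by (intro f(2) shift_in_Y v) auto
      also have "\<dots> = exp (\<Sum>i<n. 2 * of_real pi * \<i> * of_real (L (v i) + t * L e))"
        by (simp add: g_def shift_def Lsum exp_sum)
      also have "(\<Sum>i<n. 2 * of_real pi * \<i> * of_real (L (v i) + t * L e)) = 2 * of_real pi * \<i> * of_real (?\<theta> t)"
        by (simp add: sum.distrib algebra_simps sum_distrib_left)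
      finally show "f (flow_loop e v t) = exp (2 * of_real pi * \<i> * of_real (?\<theta> t))" .
    qed (intro continuous_intros)
    then show "winding_character UC (q v) f (loop_class UC (q v) (flow_loop e v)) = real n * L e" by simp
  qed
qed

end

section \<open>Straight paths between configurations\<close>

definition seg :: "points \<Rightarrow> points \<Rightarrow> real \<Rightarrow> nat \<Rightarrow> real \<times> real" where
  "seg v w t = (\<lambda>i. (1 - t) *\<^sub>R v i + t *\<^sub>R w i)"

text \<open>Plays the role of convexity for configurations, which are functions on all
  indices.\<close>

definition seg_closed :: "points set \<Rightarrow> bool" where
  "seg_closed K \<longleftrightarrow> (\<forall>v\<in>K. \<forall>w\<in>K. \<forall>t\<in>{0..1}. seg v w t \<in> K)"

lemma fst_seg [simp]: "fst (seg v w t i) = (1 - t) * fst (v i) + t * fst (w i)"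
  by (simp add: seg_def)

lemma snd_seg [simp]: "snd (seg v w t i) = (1 - t) * snd (v i) + t * snd (w i)"
  by (simp add: seg_def)

lemma seg_ends [simp]: "seg v w 0 = v" "seg v w 1 = w" "seg v v t = v"
  by (auto simp: seg_def simp flip: scaleR_left_distrib)

lemma convex_less:
  fixes x :: real
  assumes "x < y" "x' < y'" "0 \<le> t" "t \<le> 1"
  shows "(1 - t) * x + t * x' < (1 - t) * y + t * y'"
proof (cases "t = 0")
  case False
  have "(1 - t) * x \<le> (1 - t) * y" using assms by (intro mult_left_mono) auto
  moreover have "t * x' < t * y'" using False assms by simp
  ultimately show ?thesis by linarith
qed (use assms in simp)

lemma ex_sorting_permutation:
  fixes h :: "nat \<Rightarrow> 'a::linorder"
  assumes "inj_on h {..<n}"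
  obtains \<sigma> where "\<sigma> permutes {..<n}" "\<And>i j. i < j \<Longrightarrow> j < n \<Longrightarrow> h (\<sigma> i) < h (\<sigma> j)"
proof -
  define xs where "xs = sort_key h [0..<n]"
  have xs: "length xs = n" "set xs = {..<n}" "distinct xs" "sorted (map h xs)"
    by (simp_all add: xs_def atLeast0LessThan)
  define \<sigma> where "\<sigma> i = (if i < n then xs ! i else i)" for i
  have "bij_betw ((!) xs) {..<n} {..<n}"
    by (rule bij_betw_nth[OF xs(3)]) (simp_all only: xs(1,2))
  then have "bij_betw \<sigma> {..<n} {..<n}"
    by (rule bij_betw_cong[THEN iffD1, rotated]) (simp add: \<sigma>_def)
  then have "\<sigma> permutes {..<n}"
    by (rule bij_imp_permutes) (simp add: \<sigma>_def)
  moreover have "h (\<sigma> i) < h (\<sigma> j)" if "i < j" "j < n" for i j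
  proof -
    have "h (xs ! i) \<le> h (xs ! j)" using sorted_nth_mono[OF xs(4), of i j] that xs(1) by simp
    moreover have "xs ! i \<noteq> xs ! j" using xs(1,3) that by (simp add: nth_eq_iff_index_eq)
    moreover have "xs ! i \<in> {..<n}" "xs ! j \<in> {..<n}" using xs(1,2) that nth_mem[of i xs] nth_mem[of j xs] by auto
    ultimately have "h (xs ! i) < h (xs ! j)" using assms by (metis inj_onD le_neq_trans)
    then show ?thesis using that by (simp add: \<sigma>_def)
  qed
  ultimately show ?thesis using that by blast
qed

lemma increasing_permutation_id:
  assumes \<sigma>: "\<sigma> permutes {..<n}" and mono: "\<And>i j. i < j \<Longrightarrow> j < n \<Longrightarrow> \<sigma> i < \<sigma> j" and i: "i < n"
  shows "\<sigma> i = (i::nat)"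
proof -
  have \<sigma>n: "\<sigma> i < n" if "i < n" for i using permutes_in_image[OF \<sigma>, of i] that by simp
  have ge: "i \<le> \<sigma> i" if "i < n" for i
    using that
  proof (induction i)
    case (Suc i)
    then show ?case using mono[of i "Suc i"] by auto
  qed auto
  have "n - 1 - k \<ge> \<sigma> (n - 1 - k)" if "k < n" for k
    using that
  proof (induction k)
    case 0
    then show ?case using \<sigma>n[of "n - 1"] by auto
  next
    case (Suc k)
    then have "n - 1 - k = Suc (n - 1 - Suc k)" "n - 1 - Suc k < n - 1 - k" "n - 1 - k < n" by simp_all
    then show ?case using mono[of "n - 1 - Suc k" "n - 1 - k"] Suc by linarith
  qed
  from this[of "n - 1 - i"] show ?thesis using ge[OF i] i by auto
qed

text \<open>Induction on the number of bad values in the interval: two distinct ones leave room for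
  a good cut point between them, and each half then contains fewer.\<close>

lemma split_at_bad_values:
  fixes B :: "real set" and P :: "real \<Rightarrow> real \<Rightarrow> bool"
  assumes fin: "finite (B \<inter> {a..a'})" and aa: "a < a'" "a \<notin> B" "a' \<notin> B"
    and base: "\<And>c d. a \<le> c \<Longrightarrow> c < d \<Longrightarrow> d \<le> a' \<Longrightarrow> c \<notin> B \<Longrightarrow> d \<notin> B \<Longrightarrow>
       (\<And>\<beta> \<beta>'. \<beta> \<in> B \<Longrightarrow> \<beta>' \<in> B \<Longrightarrow> c \<le> \<beta> \<Longrightarrow> \<beta> \<le> d \<Longrightarrow> c \<le> \<beta>' \<Longrightarrow> \<beta>' \<le> d \<Longrightarrow> \<beta> = \<beta>') \<Longrightarrow> P c d"
    and trans: "\<And>c d e. a \<le> c \<Longrightarrow> c < d \<Longrightarrow> d < e \<Longrightarrow> e \<le> a' \<Longrightarrow> d \<notin> B \<Longrightarrow> P c d \<Longrightarrow> P d e \<Longrightarrow> P c e"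
  shows "P a a'"
proof -
  have "\<forall>c d. a \<le> c \<and> c < d \<and> d \<le> a' \<and> c \<notin> B \<and> d \<notin> B \<and> card (B \<inter> {c..d}) = k \<longrightarrow> P c d" for k
  proof (induction k rule: less_induct)
    case (less k)
    show ?case
    proof (intro allI impI)
      fix c d assume c: "a \<le> c \<and> c < d \<and> d \<le> a' \<and> c \<notin> B \<and> d \<notin> B \<and> card (B \<inter> {c..d}) = k"
      have finc: "finite (B \<inter> {c..d})" by (rule finite_subset[OF _ fin]) (use c in auto)
      show "P c d"
      proof (cases "\<exists>\<beta> \<beta>'. \<beta> \<in> B \<inter> {c..d} \<and> \<beta>' \<in> B \<inter> {c..d} \<and> \<beta> < \<beta>'")
        case False
        have "\<beta> = \<beta>'" if "\<beta> \<in> B" "\<beta>' \<in> B" "c \<le> \<beta>" "\<beta> \<le> d" "c \<le> \<beta>'" "\<beta>' \<le> d" for \<beta> \<beta>'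
        proof -
          have "\<beta> \<in> B \<inter> {c..d}" "\<beta>' \<in> B \<inter> {c..d}" using that by auto
          then have "\<not> \<beta> < \<beta>'" "\<not> \<beta>' < \<beta>" using False by blast+
          then show ?thesis by simp
        qed
        then show ?thesis using c by (intro base) auto
      next
        case True
        then obtain \<beta> \<beta>' where \<beta>: "\<beta> \<in> B \<inter> {c..d}" "\<beta>' \<in> B \<inter> {c..d}" "\<beta> < \<beta>'" by blast
        have "infinite ({\<beta><..<\<beta>'} - B \<inter> {c..d})" using infinite_Ioo[OF \<beta>(3)] finc by simp
        then obtain e where "e \<in> {\<beta><..<\<beta>'} - B \<inter> {c..d}" by (metis finite.emptyI ex_in_conv)
        then have e: "\<beta> < e" "e < \<beta>'" "e \<notin> B \<inter> {c..d}" by simp_all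
        have "\<beta>' \<notin> B \<inter> {c..e}" "B \<inter> {c..e} \<subseteq> B \<inter> {c..d}" "\<beta> \<notin> B \<inter> {e..d}" "B \<inter> {e..d} \<subseteq> B \<inter> {c..d}"
          using e \<beta> by auto
        then have "B \<inter> {c..e} \<subset> B \<inter> {c..d}" "B \<inter> {e..d} \<subset> B \<inter> {c..d}" using \<beta> by blast+
        then have k: "card (B \<inter> {c..e}) < k" "card (B \<inter> {e..d}) < k"
          using psubset_card_mono[OF finc] c by auto
        have ce: "c < e" "e < d" "e \<notin> B" using \<beta> e by auto
        have "P c e" by (rule less.IH[OF k(1), rule_format]) (use ce c in auto)
        moreover have "P e d" by (rule less.IH[OF k(2), rule_format]) (use ce c in auto)
        ultimately show ?thesis using ce c trans[of c e d] by simp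
      qed
    qed
  qed
  then show ?thesis using aa by auto
qed

section \<open>Straight segments, chambers and the fundamental domain\<close>

context surface_configurations
begin

definition line :: "points \<Rightarrow> points \<Rightarrow> real \<Rightarrow> configuration" where
  "line v w = (\<lambda>t. q (seg v w t))"

lemma line_ends [simp]: "line v w 0 = q v" "line v w 1 = q w" by (auto simp: line_def)

text \<open>Straight-line homotopy upstairs; the ends need to agree at the relevant indices
  only.\<close>

lemma path_homotopic_lift:
  assumes P: "\<And>i. i < n \<Longrightarrow> continuous_on {0..1} (\<lambda>t. P t i)"
    and P': "\<And>i. i < n \<Longrightarrow> continuous_on {0..1} (\<lambda>t. P' t i)"
    and e: "\<And>i. i < n \<Longrightarrow> P 0 i = P' 0 i" "\<And>i. i < n \<Longrightarrow> P 1 i = P' 1 i"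
    and PY: "\<And>s t. s \<in> {0..1} \<Longrightarrow> t \<in> {0..1} \<Longrightarrow> seg (P t) (P' t) s \<in> Y"
  shows "path_homotopic UC (\<lambda>t. q (P t)) (\<lambda>t. q (P' t))"
  unfolding path_homotopic_iff
proof (intro exI conjI)
  show "continuous_map (top_of_set ({0..1} \<times> {0..1})) UC (\<lambda>z. q (seg (P (snd z)) (P' (snd z)) (fst z)))"
  proof (rule continuous_map_q)
    fix i assume "i < n"
    then show "continuous_map (top_of_set ({0..1} \<times> {0..1})) euclidean (\<lambda>z. seg (P (snd z)) (P' (snd z)) (fst z) i)"
      unfolding seg_def
      by (auto intro!: continuous_intros continuous_on_compose2[OF P] continuous_on_compose2[OF P'])
  qed (use PY in auto)
  show "\<forall>s\<in>{0..1}. q (seg (P (snd (s, 0))) (P' (snd (s, 0))) (fst (s, 0))) = q (P 0) \<and>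
      q (seg (P (snd (s, 1))) (P' (snd (s, 1))) (fst (s, 1))) = q (P 1)"
    using e by (auto intro!: q_cong simp: seg_def simp flip: scaleR_left_distrib)
qed auto

lemma pathin_q:
  assumes "\<And>i. i < n \<Longrightarrow> continuous_on {0..1} (\<lambda>t. P t i)" "\<And>t. t \<in> {0..1} \<Longrightarrow> P t \<in> Y"
  shows "pathin UC (\<lambda>t. q (P t))"
  unfolding pathin_def using assms by (intro continuous_map_q) auto

lemma continuous_seg: "continuous_on S (\<lambda>t. seg v w t i)"
  unfolding seg_def by (intro continuous_intros)

lemma pathin_line:
  assumes "seg_closed K" "K \<subseteq> Y" "v \<in> K" "w \<in> K"
  shows "pathin UC (line v w)"
  unfolding line_def using assms by (intro pathin_q continuous_seg) (auto simp: seg_closed_def)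

lemma path_homotopic_triangle:
  assumes K: "seg_closed K" "K \<subseteq> Y" and uvw: "u \<in> K" "v \<in> K" "w \<in> K"
  shows "path_homotopic UC (concat_paths (line u v) (line v w)) (line u w)"
proof -
  let ?P = "\<lambda>t. if t \<le> 1/2 then seg u v (2 * t) else seg v w (2 * t - 1)"
  have "path_homotopic UC (\<lambda>t. q (?P t)) (\<lambda>t. q (seg u w t))"
  proof (rule path_homotopic_lift)
    fix i
    \<comment> \<open>Clamped parameters turn the broken path into one formula, whose continuity is
      evident.\<close>
    have "?P t i = u i + min 1 (2 * t) *\<^sub>R (v i - u i) + max 0 (2 * t - 1) *\<^sub>R (w i - v i)" for t
      unfolding half_splits by (auto simp: prod_eq_iff algebra_simps)
    then show "continuous_on {0..1} (\<lambda>t. ?P t i)" by (simp only:) (intro continuous_intros)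
  next
    fix s t :: real assume st: "s \<in> {0..1}" "t \<in> {0..1}"
    have "?P t \<in> K" using K uvw st by (auto simp: seg_closed_def)
    moreover have "seg u w t \<in> K" using K uvw st by (auto simp: seg_closed_def)
    ultimately show "seg (?P t) (seg u w t) s \<in> Y" using K st by (auto simp: seg_closed_def)
  qed (auto intro: continuous_seg)
  moreover have "(\<lambda>t. q (?P t)) = concat_paths (line u v) (line v w)"
    by (rule ext) (simp add: concat_paths_def line_def)
  ultimately show ?thesis by (simp add: line_def)
qed

text \<open>\<open>cell\<close> is a fundamental domain, up to boundary, for the action of the wreath product of the
  surface group with the symmetric group.\<close>

definition cell :: "points set" where
  "cell = {v. (\<forall>i<n. 0 < fst (v i) \<and> fst (v i) < 1 \<and> 0 < snd (v i) \<and> snd (v i) < 1) \<and>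
     (\<forall>i j. i < j \<longrightarrow> j < n \<longrightarrow> snd (v i) < snd (v j))}"

text \<open>An alcove of the arrangement of integral height differences. The horizontal coordinates
  are free and, unlike \<open>cell\<close>, it is preserved by vertical translation; so it contains
  the horizontal turns and the passage through the top.\<close>

definition chamber :: "points set" where
  "chamber = {v. \<forall>j k. j < k \<longrightarrow> k < n \<longrightarrow> snd (v j) < snd (v k) \<and> snd (v k) < snd (v j) + 1}"

text \<open>The union of two adjacent chambers, glued along one component of their common wall.\<close>

definition wall :: "nat \<Rightarrow> int \<Rightarrow> points set" where
  "wall i c = {v. (\<forall>j k. j < k \<longrightarrow> k < n \<longrightarrow>
       (snd (v k) < snd (v j) + 1 \<and> (j = i \<and> k = Suc i \<longrightarrow> snd (v j) < snd (v k) + 1) \<and>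
       (\<not> (j = i \<and> k = Suc i) \<longrightarrow> snd (v j) < snd (v k)))) \<and>
     of_int c < fst (v i) - fst (v (Suc i)) \<and> fst (v i) - fst (v (Suc i)) < of_int c + 1}"

lemma in_YI:
  assumes "\<And>i j. i < j \<Longrightarrow> j < n \<Longrightarrow> \<bar>snd (v i) - snd (v j)\<bar> < 1 \<and>
    (snd (v i) \<noteq> snd (v j) \<or> fst (v i) - fst (v j) \<notin> \<int>)"
  shows "v \<in> Y"
proof -
  have *: "(v i, v j) \<notin> R" if "i < j" "j < n" for i j
  proof
    assume "(v i, v j) \<in> R"
    then have "(v j, v i) \<in> R" by (rule surface_rel_sym)
    then show False using surface_rel_close[of "v j" "v i" tw] assms[OF that] by auto
  qed
  show ?thesis unfolding Y_def
  proof (intro CollectI allI impI)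
    fix i j assume "i < n" "j < n" "i \<noteq> j"
    then show "(v i, v j) \<notin> R" using *[of i j] *[of j i] surface_rel_sym by (meson linorder_neqE_nat)
  qed
qed

lemma chamber_Y: "chamber \<subseteq> Y"
proof
  fix v assume "v \<in> chamber"
  then have "snd (v i) < snd (v j) \<and> snd (v j) < snd (v i) + 1" if "i < j" "j < n" for i j
    using that by (auto simp: chamber_def)
  then show "v \<in> Y" by (intro in_YI) force
qed

lemma cell_chamber: "cell \<subseteq> chamber"
  by (auto simp: cell_def chamber_def) (smt (verit) less_trans)

lemma wall_Y: assumes "Suc i < n" shows "wall i c \<subseteq> Y"
proof
  fix v assume v: "v \<in> wall i c"
  show "v \<in> Y"
  proof (rule in_YI)
    fix j k assume jk: "j < k" "k < n"
    show "\<bar>snd (v j) - snd (v k)\<bar> < 1 \<and> (snd (v j) \<noteq> snd (v k) \<or> fst (v j) - fst (v k) \<notin> \<int>)"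
    proof (cases "j = i \<and> k = Suc i")
      case True
      have "of_int c < fst (v i) - fst (v (Suc i))" "fst (v i) - fst (v (Suc i)) < of_int c + 1"
        using v by (auto simp: wall_def)
      then have "fst (v i) - fst (v (Suc i)) \<notin> \<int>" by (auto elim!: Ints_cases)
      moreover have "snd (v k) < snd (v j) + 1 \<and> snd (v j) < snd (v k) + 1"
        using v jk True unfolding wall_def by blast
      ultimately show ?thesis using True by auto
    next
      case False
      then show ?thesis using v jk by (force simp: wall_def)
    qed
  qed
qed

lemma seg_closed_chamber: "seg_closed chamber"
  unfolding seg_closed_def
proof (intro ballI)
  fix v w t assume vw: "v \<in> chamber" "w \<in> chamber" and t: "t \<in> {0..1::real}"
  show "seg v w t \<in> chamber" unfolding chamber_def
  proof (intro CollectI allI impI)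
    fix j k assume "j < k" "k < n"
    then have *: "snd (v j) < snd (v k)" "snd (w j) < snd (w k)"
      "snd (v k) < snd (v j) + 1" "snd (w k) < snd (w j) + 1" using vw by (auto simp: chamber_def)
    show "snd (seg v w t j) < snd (seg v w t k) \<and> snd (seg v w t k) < snd (seg v w t j) + 1"
      using convex_less[OF *(1,2), of t] convex_less[OF *(3,4), of t] t by (auto simp: algebra_simps)
  qed
qed

lemma seg_closed_cell: "seg_closed cell"
  unfolding seg_closed_def
proof (intro ballI)
  fix v w t assume vw: "v \<in> cell" "w \<in> cell" and t: "t \<in> {0..1::real}"
  have t': "0 \<le> t" "t \<le> 1" using t by auto
  have "0 < fst (seg v w t i) \<and> fst (seg v w t i) < 1 \<and> 0 < snd (seg v w t i) \<and> snd (seg v w t i) < 1" if "i < n" for i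
    using convex_less[of 0 "fst (v i)" 0 "fst (w i)" t] convex_less[of "fst (v i)" 1 "fst (w i)" 1 t]
      convex_less[of 0 "snd (v i)" 0 "snd (w i)" t] convex_less[of "snd (v i)" 1 "snd (w i)" 1 t] vw t' that
    by (simp add: cell_def)
  moreover have "snd (seg v w t i) < snd (seg v w t j)" if "i < j" "j < n" for i j
    using convex_less[of "snd (v i)" "snd (v j)" "snd (w i)" "snd (w j)" t] vw t' that by (simp add: cell_def)
  ultimately show "seg v w t \<in> cell" by (simp add: cell_def)
qed

lemma seg_closed_wall: "seg_closed (wall i c)"
  unfolding seg_closed_def
proof (intro ballI)
  fix v w t assume vw: "v \<in> wall i c" "w \<in> wall i c" and t: "t \<in> {0..1::real}"
  have t': "0 \<le> t" "t \<le> 1" using t by auto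
  have a: "snd (seg v w t k) < snd (seg v w t j) + 1 \<and>
       (j = i \<and> k = Suc i \<longrightarrow> snd (seg v w t j) < snd (seg v w t k) + 1) \<and>
       (\<not> (j = i \<and> k = Suc i) \<longrightarrow> snd (seg v w t j) < snd (seg v w t k))" if jk: "j < k" "k < n" for j k
  proof (intro conjI impI)
    have "snd (v k) < snd (v j) + 1" "snd (w k) < snd (w j) + 1" using vw jk by (auto simp: wall_def)
    from convex_less[OF this t'] show "snd (seg v w t k) < snd (seg v w t j) + 1" by (simp add: algebra_simps)
  next
    assume "j = i \<and> k = Suc i"
    then have "snd (v j) < snd (v k) + 1" "snd (w j) < snd (w k) + 1" using vw jk by (auto simp: wall_def)
    from convex_less[OF this t'] show "snd (seg v w t j) < snd (seg v w t k) + 1" by (simp add: algebra_simps)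
  next
    assume "\<not> (j = i \<and> k = Suc i)"
    then have "snd (v j) < snd (v k)" "snd (w j) < snd (w k)" using vw jk unfolding wall_def by blast+
    from convex_less[OF this t'] show "snd (seg v w t j) < snd (seg v w t k)" by simp
  qed
  have b: "of_int c < fst (v i) - fst (v (Suc i))" "of_int c < fst (w i) - fst (w (Suc i))"
     "fst (v i) - fst (v (Suc i)) < of_int c + 1" "fst (w i) - fst (w (Suc i)) < of_int c + 1"
    using vw by (auto simp: wall_def)
  have "of_int c < fst (seg v w t i) - fst (seg v w t (Suc i))"
     "fst (seg v w t i) - fst (seg v w t (Suc i)) < of_int c + 1"
    using convex_less[OF b(1,2) t'] convex_less[OF b(3,4) t'] by (simp_all add: algebra_simps)
  then show "seg v w t \<in> wall i c" using a unfolding wall_def by blast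
qed

text \<open>Points of the open unit square are related only if they are equal, and the increasing
  heights leave no choice for the permutation.\<close>

lemma q_inj_on_cell:
  assumes v: "v \<in> cell" and w: "w \<in> cell" and e: "q v = q w" and i: "i < n"
  shows "v i = w i"
proof -
  have "v \<in> Y" "w \<in> Y" using v w cell_chamber chamber_Y by auto
  then obtain \<sigma> where \<sigma>: "\<sigma> permutes {..<n}" "\<And>i. i < n \<Longrightarrow> (v (\<sigma> i), w i) \<in> R"
    using q_eq_iff e by blast
  have \<sigma>n: "\<sigma> i < n" if "i < n" for i using permutes_in_image[OF \<sigma>(1), of i] that by simp
  have eq: "v (\<sigma> i) = w i" if i: "i < n" for i
  proof -
    have r: "0 < fst (v (\<sigma> i))" "fst (v (\<sigma> i)) < 1" "0 < snd (v (\<sigma> i))" "snd (v (\<sigma> i)) < 1"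
      "0 < fst (w i)" "fst (w i) < 1" "0 < snd (w i)" "snd (w i) < 1"
      using v w i \<sigma>n[OF i] by (auto simp: cell_def)
    then have "\<bar>snd (w i) - snd (v (\<sigma> i))\<bar> < 1" by linarith
    from surface_rel_close[OF \<sigma>(2)[OF i] this]
    have s: "snd (w i) = snd (v (\<sigma> i))" and "fst (w i) - fst (v (\<sigma> i)) \<in> \<int>" by auto
    then obtain z where z: "fst (w i) - fst (v (\<sigma> i)) = of_int z" by (auto elim: Ints_cases)
    then have "z = 0" using r by linarith
    then show ?thesis using s z by (simp add: prod_eq_iff)
  qed
  have "\<sigma> i < \<sigma> j" if "i < j" "j < n" for i j
  proof (rule ccontr)
    assume "\<not> \<sigma> i < \<sigma> j"
    then have "snd (v (\<sigma> j)) \<le> snd (v (\<sigma> i))"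
      using v \<sigma>n[of i] that by (cases "\<sigma> i = \<sigma> j") (auto simp: cell_def less_imp_le)
    then have "snd (w j) \<le> snd (w i)" using eq that by simp
    then show False using w that by (force simp: cell_def)
  qed
  then have "\<sigma> i = i" using increasing_permutation_id[OF \<sigma>(1) _ i] by blast
  then show ?thesis using eq[OF i] by simp
qed

definition generic :: "points \<Rightarrow> bool" where
  "generic v \<longleftrightarrow> (\<forall>i<n. fst (v i) \<notin> \<int> \<and> snd (v i) \<notin> \<int> \<and> (\<forall>j<n. i \<noteq> j \<longrightarrow> snd (v i) - snd (v j) \<notin> \<int>))"

definition act_all :: "(nat \<Rightarrow> nat) \<Rightarrow> (nat \<Rightarrow> int) \<Rightarrow> (nat \<Rightarrow> int) \<Rightarrow> points \<Rightarrow> nat \<Rightarrow> real \<times> real" where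
  "act_all \<sigma> j k v = (\<lambda>i. surface_act tw (j i) (k i) (v (\<sigma> i)))"

text \<open>Sorting the fractional parts of the heights gives the permutation; removing integer
  parts gives the deck transformations.\<close>

lemma generic_normal_form:
  assumes v: "generic v"
  obtains \<sigma> j k where "\<sigma> permutes {..<n}" "act_all \<sigma> j k v \<in> cell"
proof -
  have frac_pos: "0 < frac x" "frac x < 1" if "x \<notin> \<int>" for x :: real
    using that frac_lt_1[of x] frac_ge_0[of x] frac_eq_0_iff[of x] by (auto simp: less_le)
  have "inj_on (\<lambda>i. frac (snd (v i))) {..<n}"
  proof (rule inj_onI, rule ccontr)
    fix i j assume ij: "i \<in> {..<n}" "j \<in> {..<n}" "frac (snd (v i)) = frac (snd (v j))" "i \<noteq> j"
    then have "snd (v i) - snd (v j) = of_int (\<lfloor>snd (v i)\<rfloor> - \<lfloor>snd (v j)\<rfloor>)" by (simp add: frac_def)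
    then have "snd (v i) - snd (v j) \<in> \<int>" by (metis Ints_of_int)
    then show False using v ij by (auto simp: generic_def)
  qed
  then obtain \<sigma> where \<sigma>: "\<sigma> permutes {..<n}" "\<And>i j. i < j \<Longrightarrow> j < n \<Longrightarrow> frac (snd (v (\<sigma> i))) < frac (snd (v (\<sigma> j)))"
    by (rule ex_sorting_permutation) blast
  define k where "k i = - \<lfloor>snd (v (\<sigma> i))\<rfloor>" for i
  \<comment> \<open>The twist is determined by \<open>k\<close>, so the reflection is applied before
    the horizontal integer part is taken.\<close>
  define x where "x i = (if tw \<longrightarrow> even (k i) then fst (v (\<sigma> i)) else - fst (v (\<sigma> i)))" for i
  define j where "j i = - \<lfloor>x i\<rfloor>" for i
  have a: "act_all \<sigma> j k v i = (frac (x i), frac (snd (v (\<sigma> i))))" for i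
    by (simp add: act_all_def surface_act_def x_def[symmetric] j_def frac_def) (simp add: k_def)
  have "x i \<notin> \<int> \<and> snd (v (\<sigma> i)) \<notin> \<int>" if "i < n" for i
    using v permutes_in_image[OF \<sigma>(1), of i] that by (auto simp: generic_def x_def)
  then have "act_all \<sigma> j k v \<in> cell"
    using \<sigma>(2) by (auto simp: cell_def a intro!: frac_pos frac_lt_1)
  then show ?thesis using that \<sigma>(1) by blast
qed

end

section \<open>Generators of the braid group\<close>

definition irrational :: real where "irrational = (SOME x. x \<notin> \<rat>)"

lemma irrational: "irrational \<notin> \<rat>"
proof -
  have "\<exists>x::real. x \<notin> \<rat>" using countable_rat uncountable_UNIV_real by (metis UNIV_eq_I)
  then show ?thesis unfolding irrational_def by (rule someI_ex)
qed

lemma Rats_translate_dense: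
  fixes x c e :: real
  assumes "0 < e"
  obtains y where "y - c \<in> \<rat>" "\<bar>y - x\<bar> < e"
proof -
  obtain r where r: "r \<in> \<rat>" "x - c - e < r" "r < x - c + e"
    using Rats_dense_in_real[of "x - c - e" "x - c + e"] assms by auto
  have "\<bar>(r + c) - x\<bar> < e" using r(2,3) by linarith
  then show ?thesis using that[of "r + c"] r(1) by simp
qed

lemma Ints_imp_Rats: "x \<in> \<int> \<Longrightarrow> x \<in> \<rat>"
  using Ints_subset_Rats by blast

lemma irrational_multiple:
  assumes "x - of_int m * irrational \<in> \<rat>" "m \<noteq> 0"
  shows "x \<notin> \<rat>"
proof
  assume "x \<in> \<rat>"
  then have "(x - (x - of_int m * irrational)) / of_int m \<in> \<rat>"
    using Rats_divide[OF Rats_diff[OF _ assms(1)] Rats_of_int] by blast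
  then show False using irrational assms(2) by simp
qed

lemma finite_translated_Ints: "finite ({\<beta>. \<beta> - c \<in> \<int>} \<inter> {a..a'})" for c :: real
proof (rule finite_subset)
  show "{\<beta>. \<beta> - c \<in> \<int>} \<inter> {a..a'} \<subseteq> (\<lambda>x. x + c) ` {x \<in> \<int>. a - c \<le> x \<and> x \<le> a' - c}"
    by (auto intro!: image_eqI[of _ _ "_ - c"])
qed (intro finite_imageI finite_int_segment)

locale surface_braids = surface_configurations tw n for tw n +
  assumes n2: "2 \<le> n"
begin

text \<open>Rational points on the diagonal: the increasing heights put the configuration into
  \<open>cell\<close>, the increasing horizontal coordinates select the side on which
  \<open>sig\<close> exchanges neighbours, and rational heights are never congruent to those of
  \<open>irr\<close> configurations.\<close>

definition v0 :: points where
  "v0 i = (real (Suc i) / real (Suc n), real (Suc i) / real (Suc n))"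

definition ycell :: "points \<Rightarrow> bool" where
  "ycell v \<longleftrightarrow> (\<forall>i<n. 0 < snd (v i) \<and> snd (v i) < 1) \<and> (\<forall>i j. i < j \<longrightarrow> j < n \<longrightarrow> snd (v i) < snd (v j))"

definition bump :: "nat \<Rightarrow> points \<Rightarrow> nat \<Rightarrow> real \<times> real" where
  "bump i v = v(i := v i + (1, 0))"

definition swap :: "nat \<Rightarrow> points \<Rightarrow> nat \<Rightarrow> real \<times> real" where
  "swap i v = (\<lambda>m. v (Transposition.transpose i (Suc i) m))"

definition cyc :: "nat \<Rightarrow> nat" where
  "cyc m = (if Suc m < n then Suc m else if Suc m = n then 0 else m)"

text \<open>A relabelled deck translate: the lowest point is raised by one period and becomes the
  last. The horizontal shift in the twisted case compensates the reflection and keeps a coordinate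
  between 0 and 1 there.\<close>

definition spin :: "points \<Rightarrow> nat \<Rightarrow> real \<times> real" where
  "spin v = act_all cyc (\<lambda>m. if Suc m = n \<and> tw then 1 else 0) (\<lambda>m. if Suc m = n then 1 else 0) v"

lemma cell_ycell: "v \<in> cell \<Longrightarrow> ycell v"
  by (simp add: cell_def ycell_def)

lemma v0_cell: "v0 \<in> cell"
  by (auto simp: cell_def v0_def divide_strict_right_mono)

lemma cyc_permutes: "cyc permutes {..<n}"
proof (rule bij_imp_permutes)
  have "inj_on cyc {..<n}" by (auto simp: inj_on_def cyc_def split: if_splits)
  moreover have "cyc ` {..<n} \<subseteq> {..<n}" using n2 by (auto simp: cyc_def)
  ultimately show "bij_betw cyc {..<n} {..<n}"
    by (simp add: bij_betw_def endo_inj_surj)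
qed (auto simp: cyc_def)

lemma spin_simps:
  "Suc m < n \<Longrightarrow> spin v m = v (Suc m)"
  "Suc m = n \<Longrightarrow> spin v m = ((if tw then 1 - fst (v 0) else fst (v 0)), snd (v 0) + 1)"
  by (auto simp: spin_def act_all_def surface_act_def cyc_def)

lemma transpose_less:
  "j < k \<Longrightarrow> \<not> (j = i \<and> k = Suc i) \<Longrightarrow> Transposition.transpose i (Suc i) j < Transposition.transpose i (Suc i) k"
  by (auto simp: Transposition.transpose_def)

lemma transpose_bound: "Suc i < n \<Longrightarrow> j < n \<Longrightarrow> Transposition.transpose i (Suc i) j < n"
  by (auto simp: Transposition.transpose_def)

lemma swap_simps [simp]:
  "swap i v i = v (Suc i)" "swap i v (Suc i) = v i" "swap i (swap i v) = v"
  by (auto simp: swap_def)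

lemma swap_other: "m \<noteq> i \<Longrightarrow> m \<noteq> Suc i \<Longrightarrow> swap i v m = v m"
  by (simp add: swap_def transpose_apply_other)

lemma ycell_chamber: "ycell v \<Longrightarrow> v \<in> chamber"
proof -
  assume v: "ycell v"
  have "snd (v k) < snd (v j) + 1" if "j < k" "k < n" for j k
  proof -
    have "snd (v k) < 1" "0 < snd (v j)" using v that by (auto simp: ycell_def)
    then show ?thesis by linarith
  qed
  then show ?thesis using v by (simp add: ycell_def chamber_def)
qed

lemma ycell_wall:
  assumes v: "ycell v" "Suc i < n" "of_int c < fst (v i) - fst (v (Suc i))" "fst (v i) - fst (v (Suc i)) < of_int c + 1"
  shows "v \<in> wall i c"
proof -
  have "snd (v k) < snd (v j) + 1 \<and> snd (v j) < snd (v k)" if "j < k" "k < n" for j k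
    using ycell_chamber[OF v(1)] that by (simp add: chamber_def)
  moreover from this have "snd (v j) < snd (v k) + 1" if "j < k" "k < n" for j k
    using that by (meson add_strict_increasing2 less_trans zero_less_one le_less less_add_one)
  ultimately show ?thesis using v by (simp add: wall_def)
qed

lemma swap_wall:
  assumes v: "ycell v" "Suc i < n" "of_int c < fst (v (Suc i)) - fst (v i)" "fst (v (Suc i)) - fst (v i) < of_int c + 1"
  shows "swap i v \<in> wall i c"
proof -
  have b: "0 < snd (swap i v j)" "snd (swap i v j) < 1" if "j < n" for j
    using v(1) transpose_bound[OF v(2) that] by (auto simp: ycell_def swap_def)
  have "snd (swap i v k) < snd (swap i v j) + 1" if "j < n" "k < n" for j k
    using b(1)[OF that(1)] b(2)[OF that(2)] by linarith
  moreover have "snd (swap i v j) < snd (swap i v k)" if "j < k" "k < n" "\<not> (j = i \<and> k = Suc i)" for j k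
    using v(1) transpose_less[OF that(1,3)] transpose_bound[OF v(2) that(2)] by (simp add: ycell_def swap_def)
  moreover from calculation(1)[of "Suc i" i] have "snd (v (Suc i)) < snd (v i) + 1" using v(2) by simp
  ultimately show ?thesis using v(2-4) unfolding wall_def
    by (intro CollectI conjI allI impI) (simp_all add: less_trans)
qed

lemma bump_ycell: "ycell v \<Longrightarrow> ycell (bump i v)"
  by (simp add: ycell_def bump_def)

lemma spin_chamber:
  assumes "ycell v"
  shows "spin v \<in> chamber"
proof -
  have "snd (spin v j) < snd (spin v k) \<and> snd (spin v k) < snd (spin v j) + 1" if jk: "j < k" "k < n" for j k
  proof (cases "Suc k < n")
    case True
    then show ?thesis using ycell_chamber[OF assms] jk by (simp add: spin_simps chamber_def)
  next
    case False
    then have "Suc k = n" "Suc j < n" using jk by auto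
    moreover have "snd (v 0) < snd (v (Suc j))" "0 < snd (v 0)" "snd (v (Suc j)) < 1"
      using assms calculation by (auto simp: ycell_def)
    ultimately show ?thesis by (simp add: spin_simps)
  qed
  then show ?thesis by (simp add: chamber_def)
qed

lemma snd_generic_Y:
  assumes "\<And>i j. i < n \<Longrightarrow> j < n \<Longrightarrow> i \<noteq> j \<Longrightarrow> snd (v i) - snd (v j) \<notin> \<int>"
  shows "v \<in> Y"
proof -
  have "(v i, v j) \<notin> R" if "i < n" "j < n" "i \<noteq> j" for i j
    using assms[of j i] that by (auto simp: surface_rel_def surface_act_def)
  then show ?thesis by (simp add: Y_def)
qed

end

text \<open>The extra condition contracts \<open>cell\<close> to a single vertex of the groupoid. An
  edge from \<open>cell\<close> into a neighbouring translate then gives a group element that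
  depends only on the face crossed.\<close>

locale framed_braids = surface_braids tw n +
  framed_space "unordered_configuration_space (surface tw) n" b \<kappa> for tw n b \<kappa> +
  assumes cell_trivial: "v \<in> cell \<Longrightarrow> w \<in> cell \<Longrightarrow> transport (line v w) = \<one>\<^bsub>FG\<^esub>"
begin

notation FG_mult (infixl "\<cdot>" 70)

definition el :: "points \<Rightarrow> points \<Rightarrow> (real \<Rightarrow> configuration) set" where
  "el v w = transport (line v w)"

lemma el_cell: "v \<in> cell \<Longrightarrow> w \<in> cell \<Longrightarrow> el v w = \<one>\<^bsub>FG\<^esub>"
  by (simp add: el_def cell_trivial)

lemma el_closed:
  assumes "seg_closed K" "K \<subseteq> Y" "v \<in> K" "w \<in> K"
  shows "el v w \<in> carrier FG"
  unfolding el_def by (intro transport_closed pathin_line[OF assms])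

lemma el_triangle:
  assumes K: "seg_closed K" "K \<subseteq> Y" and uvw: "u \<in> K" "v \<in> K" "w \<in> K"
  shows "el u v \<cdot> el v w = el u w"
  unfolding el_def
  using transport_homotopic[OF path_homotopic_triangle[OF K uvw]] pathin_line[OF K] uvw
  by (simp add: transport_concat)

lemma el_refl: "v \<in> Y \<Longrightarrow> el v v = \<one>\<^bsub>FG\<^esub>"
  using transport_const[OF q_in_topspace] by (simp add: el_def line_def)

lemma el_inv:
  assumes K: "seg_closed K" "K \<subseteq> Y" "v \<in> K" "w \<in> K"
  shows "inv\<^bsub>FG\<^esub> (el w v) = el v w"
  using el_triangle[OF K(1,2) K(3,4,3)] el_refl[of v] K el_closed[OF K(1,2)]
  by (intro inv_equality) auto

lemma el_cong: "(\<And>i. i < n \<Longrightarrow> v i = v' i) \<Longrightarrow> (\<And>i. i < n \<Longrightarrow> w i = w' i) \<Longrightarrow> el v w = el v' w'"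
proof -
  assume "\<And>i. i < n \<Longrightarrow> v i = v' i" "\<And>i. i < n \<Longrightarrow> w i = w' i"
  then have "line v w = line v' w'"
    unfolding line_def by (intro ext q_cong) (simp add: seg_def)
  then show ?thesis by (simp add: el_def)
qed

text \<open>Permutations and deck transformations are affine, hence carry segments to segments with
  the same projection.\<close>

lemma el_act:
  assumes \<sigma>: "\<sigma> permutes {..<n}"
    and v': "\<And>i. i < n \<Longrightarrow> v' i = surface_act tw (j i) (k i) (v (\<sigma> i))"
    and w': "\<And>i. i < n \<Longrightarrow> w' i = surface_act tw (j i) (k i) (w (\<sigma> i))"
    and Y: "\<And>t. t \<in> {0..1} \<Longrightarrow> seg v w t \<in> Y"
  shows "el v' w' = el v w"
proof -
  have eq: "line v w t = line v' w' t" if "t \<in> {0..1}" for t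
    unfolding line_def
  proof (rule q_act[OF Y[OF that] \<sigma>])
    fix i assume i: "i < n"
    have "surface_act tw (j i) (k i) (seg v w t (\<sigma> i)) = seg v' w' t i"
      using v'[OF i] w'[OF i] by (simp add: surface_act_def prod_eq_iff algebra_simps)
    then show "(seg v w t (\<sigma> i), seg v' w' t i) \<in> R" using surface_rel_act by metis
  qed
  have p: "pathin UC (line v w)" unfolding line_def using Y by (intro pathin_q continuous_seg)
  have "path_homotopic UC (line v w) (line v' w')"
    by (rule path_homotopic_reparam[OF p, of id id]) (use eq in auto)
  then show ?thesis by (simp add: el_def transport_homotopic)
qed

lemma el_act_K:
  assumes "seg_closed K" "K \<subseteq> Y" "v \<in> K" "w \<in> K" and "\<sigma> permutes {..<n}"
    and "\<And>i. i < n \<Longrightarrow> v' i = surface_act tw (j i) (k i) (v (\<sigma> i))"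
    and "\<And>i. i < n \<Longrightarrow> w' i = surface_act tw (j i) (k i) (w (\<sigma> i))"
  shows "el v' w' = el v w"
  by (rule el_act[where \<sigma> = \<sigma> and j = j and k = k]) (use assms in \<open>auto simp: seg_closed_def\<close>)

text \<open>Edges inside \<open>cell\<close> and inside its translates are trivial, so triangles in
  \<open>K\<close> allow both end points to be changed. This is why finitely many classes of faces
  suffice.\<close>

lemma el_cross:
  assumes K: "seg_closed K" "K \<subseteq> Y" "u \<in> K" "u' \<in> K" "w \<in> K" "w' \<in> K"
    and u: "u \<in> cell" "u' \<in> cell" and c: "c \<in> cell" "c' \<in> cell" and \<sigma>: "\<sigma> permutes {..<n}"
    and w: "\<And>i. i < n \<Longrightarrow> w i = surface_act tw (j i) (k i) (c (\<sigma> i))"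
    and w': "\<And>i. i < n \<Longrightarrow> w' i = surface_act tw (j i) (k i) (c' (\<sigma> i))"
  shows "el u w = el u' w'"
proof -
  have "el w w' = \<one>\<^bsub>FG\<^esub>"
    using el_act_K[OF seg_closed_cell _ c \<sigma> w w'] cell_chamber chamber_Y el_cell[OF c] by auto
  then have "el u w = el u w'" using el_triangle[OF K(1,2,3,5,6)] el_closed[OF K(1,2)] K by simp
  also have "\<dots> = el u' w'" using el_triangle[OF K(1,2,3,4,6)] el_closed[OF K(1,2)] K el_cell[OF u] by simp
  finally show ?thesis .
qed

lemmas chamber_K = seg_closed_chamber chamber_Y

definition tau :: "nat \<Rightarrow> (real \<Rightarrow> configuration) set" where
  "tau i = el v0 (bump i v0)"

text \<open>The target keeps the horizontal coordinates of \<open>v0\<close> and exchanges the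
  heights of the points \<open>i\<close> and \<open>i + 1\<close>; writing it as \<open>swap\<close>
  of a configuration in \<open>cell\<close> exhibits it as a translate.\<close>

definition sig :: "nat \<Rightarrow> (real \<Rightarrow> configuration) set" where
  "sig i = el v0 (swap i (\<lambda>m. (fst (swap i v0 m), snd (v0 m))))"

definition om :: "(real \<Rightarrow> configuration) set" where
  "om = el v0 (spin v0)"

lemma bump_chamber: "v \<in> cell \<Longrightarrow> bump i v \<in> chamber"
  by (intro ycell_chamber bump_ycell cell_ycell)

lemma tau_eq:
  assumes "u \<in> cell" "c \<in> cell"
  shows "el u (bump i c) = tau i"
  unfolding tau_def
  by (rule el_cross[OF chamber_K, where c = c and c' = v0 and \<sigma> = id and j = "\<lambda>m. if m = i then 1 else 0" and k = "\<lambda>_. 0"])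
    (use assms v0_cell cell_chamber bump_chamber in \<open>auto simp: permutes_id bump_def surface_act_def prod_eq_iff\<close>)

text \<open>The two inequalities put both ends into \<open>wall i (-1)\<close>: the lower point
  starts on the left. With the lower point on the right, reversing and relabelling the crossing
  leads back to this case, so it gives the inverse.\<close>

lemma sig_eq:
  assumes u: "u \<in> cell" "fst (u i) < fst (u (Suc i))" and c: "c \<in> cell" "fst (c (Suc i)) < fst (c i)"
    and i: "Suc i < n"
  shows "el u (swap i c) = sig i"
proof -
  let ?c0 = "\<lambda>m. (fst (swap i v0 m), snd (v0 m))"
  have c0: "?c0 \<in> cell"
    using v0_cell transpose_bound[OF i] by (auto simp: cell_def swap_def)
  have v0x: "fst (v0 i) < fst (v0 (Suc i))" by (simp add: v0_def divide_strict_right_mono)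
  have b: "0 < fst (x m) \<and> fst (x m) < 1" if "x \<in> cell" "m < n" for x m using that by (simp add: cell_def)
  have W: "x \<in> wall i (-1)" if "x \<in> cell" "fst (x i) < fst (x (Suc i))" for x
    using that b[OF that(1), of i] b[OF that(1) i] i by (intro ycell_wall cell_ycell) auto
  have SW: "swap i x \<in> wall i (-1)" if "x \<in> cell" "fst (x (Suc i)) < fst (x i)" for x
    using that b[OF that(1), of i] b[OF that(1) i] i by (intro swap_wall cell_ycell) auto
  show ?thesis
    unfolding sig_def
  proof (rule el_cross[OF seg_closed_wall wall_Y[OF i], where c = c and c' = ?c0
        and \<sigma> = "Transposition.transpose i (Suc i)" and j = "\<lambda>_. 0" and k = "\<lambda>_. 0"])
    show "Transposition.transpose i (Suc i) permutes {..<n}" using i by (intro permutes_swap_id) auto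
    show "swap i ?c0 \<in> wall i (-1)" by (rule SW[OF c0]) (use v0x in simp)
  qed (use u c c0 v0_cell v0x W SW in \<open>auto simp: surface_act_def swap_def\<close>)
qed

lemma om_eq:
  assumes "u \<in> cell" "c \<in> cell"
  shows "el u (spin c) = om"
  unfolding om_def
  by (rule el_cross[OF chamber_K, where c = c and c' = v0 and \<sigma> = cyc
        and j = "\<lambda>m. if Suc m = n \<and> tw then 1 else 0" and k = "\<lambda>m. if Suc m = n then 1 else 0"])
    (use assms v0_cell cell_chamber spin_chamber cell_ycell cyc_permutes in \<open>auto simp: spin_def act_all_def\<close>)

definition gens :: "(real \<Rightarrow> configuration) set set" where
  "gens = insert om (tau ` {..<n} \<union> sig ` {i. Suc i < n})"

abbreviation "H \<equiv> generate FG gens"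

lemma tau_closed: "tau i \<in> carrier FG"
  unfolding tau_def using v0_cell by (intro el_closed[OF chamber_K] bump_chamber) (use cell_chamber in auto)

lemma om_closed: "om \<in> carrier FG"
  unfolding om_def using v0_cell by (intro el_closed[OF chamber_K] spin_chamber cell_ycell) (use cell_chamber in auto)

lemma sig_closed:
  assumes i: "Suc i < n"
  shows "sig i \<in> carrier FG"
proof -
  let ?c0 = "\<lambda>m. (fst (swap i v0 m), snd (v0 m))"
  have v0x: "fst (v0 i) < fst (v0 (Suc i))" by (simp add: v0_def divide_strict_right_mono)
  have b: "0 < fst (v0 m) \<and> fst (v0 m) < 1" if "m < n" for m using that v0_cell by (simp add: cell_def)
  have "v0 \<in> wall i (-1)" using b[of i] b[OF i] i v0x by (intro ycell_wall cell_ycell v0_cell) auto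
  moreover have "swap i ?c0 \<in> wall i (-1)"
    using b[of i] b[OF i] i v0x cell_ycell[OF v0_cell] by (intro swap_wall) (auto simp: ycell_def)
  ultimately show ?thesis
    unfolding sig_def by (intro el_closed[OF seg_closed_wall wall_Y[OF i]])
qed

lemma gens_closed: "gens \<subseteq> carrier FG"
  using tau_closed om_closed sig_closed by (auto simp: gens_def)

lemma finite_gens: "finite gens"
proof -
  have "finite {i. Suc i < n}" by (rule finite_subset[of _ "{..<n}"]) auto
  then show ?thesis by (simp add: gens_def)
qed

lemma H_subgroup: "subgroup H FG"
  by (rule generate_is_subgroup[OF gens_closed])

lemmas H_mult = subgroup.m_closed[OF H_subgroup] and H_inv = subgroup.m_inv_closed[OF H_subgroup]
  and H_one = subgroup.one_closed[OF H_subgroup]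

lemma tau_H: "i < n \<Longrightarrow> tau i \<in> H" by (rule generate.incl) (auto simp: gens_def)
lemma sig_H: "Suc i < n \<Longrightarrow> sig i \<in> H" by (rule generate.incl) (auto simp: gens_def)
lemma om_H: "om \<in> H" by (rule generate.incl) (auto simp: gens_def)

text \<open>The bounds on \<open>x\<close> allow at most one vertical line to be crossed. Crossing 1
  gives \<open>tau i\<close>; crossing 0 gives its inverse after a shift by one period.\<close>

lemma x_move_cell:
  assumes v: "v \<in> cell" and i: "i < n" and x: "x \<notin> \<int>" "-1 < x" "x < 2"
  shows "el v (v(i := (x, snd (v i)))) \<in> H"
proof -
  let ?w = "v(i := (x, snd (v i)))"
  have x01: "x \<noteq> 0" "x \<noteq> 1" using x(1) by auto
  consider "0 < x" "x < 1" | "1 < x" | "x < 0" using x01 by linarith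
  then show ?thesis
  proof cases
    case 1
    then have "?w \<in> cell" using v by (auto simp: cell_def)
    then show ?thesis using el_cell[OF v] H_one by simp
  next
    case 2
    let ?c = "v(i := (x - 1, snd (v i)))"
    have "?c \<in> cell" using v 2 x by (auto simp: cell_def)
    moreover have "bump i ?c = ?w" by (auto simp: bump_def)
    ultimately show ?thesis using tau_eq[OF v, of ?c i] tau_H[OF i] by simp
  next
    case 3
    have c: "bump i ?w \<in> cell" using v 3 x by (auto simp: cell_def bump_def)
    have ch: "?w \<in> chamber" "v \<in> chamber"
      using v cell_ycell[OF v] cell_chamber by (auto simp: ycell_def intro!: ycell_chamber)
    have "tau i = el (bump i ?w) (bump i v)" using tau_eq[OF c v] by simp
    also have "\<dots> = el ?w v"
      by (rule el_act_K[OF chamber_K ch, where \<sigma> = id and j = "\<lambda>m. if m = i then 1 else 0" and k = "\<lambda>_. 0"])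
        (auto simp: permutes_id bump_def surface_act_def prod_eq_iff)
    finally have "el v ?w = inv\<^bsub>FG\<^esub> tau i" using el_inv[OF chamber_K ch(2,1)] by simp
    then show ?thesis using tau_H[OF i] H_inv by simp
  qed
qed

text \<open>These are the heights at which point \<open>m\<close> would pass from one translate of
  \<open>cell\<close> to another.\<close>

definition bad :: "points \<Rightarrow> nat \<Rightarrow> real \<Rightarrow> bool" where
  "bad v m \<beta> \<longleftrightarrow> \<beta> \<in> \<int> \<or> (\<exists>j<n. j \<noteq> m \<and> \<beta> - snd (v j) \<in> \<int>)"

text \<open>By \<open>uniq\<close> at most one face is crossed: none, the level of point
  \<open>i + 1\<close>, or, for the highest point, the top of the unit square.\<close>

lemma y_move_cell:
  assumes v: "v \<in> cell" and i: "i < n" and y: "snd (v i) < y" "\<not> bad v i y"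
    and uniq: "\<And>\<beta> \<beta>'. bad v i \<beta> \<Longrightarrow> bad v i \<beta>' \<Longrightarrow> snd (v i) \<le> \<beta> \<Longrightarrow> \<beta> \<le> y \<Longrightarrow> snd (v i) \<le> \<beta>' \<Longrightarrow> \<beta>' \<le> y \<Longrightarrow> \<beta> = \<beta>'"
    and vY: "\<And>s. snd (v i) \<le> s \<Longrightarrow> s \<le> y \<Longrightarrow> v(i := (fst (v i), s)) \<in> Y"
  shows "el v (v(i := (fst (v i), y))) \<in> H"
proof -
  let ?w = "v(i := (fst (v i), y))"
  have V: "0 < fst (v j)" "fst (v j) < 1" "0 < snd (v j)" "snd (v j) < 1" if "j < n" for j
    using v that by (auto simp: cell_def)
  have Vm: "snd (v j) < snd (v k)" if "j < k" "k < n" for j k using v that by (auto simp: cell_def)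
  have bad_other: "bad v i (snd (v j))" if "j < n" "j \<noteq> i" for j using that by (auto simp: bad_def)
  have bad_1: "bad v i 1" by (simp add: bad_def)
  show ?thesis
  proof (cases "Suc i < n")
    case True
    show ?thesis
    proof (cases "y < snd (v (Suc i))")
      case y_small: True
      have "?w \<in> cell" unfolding cell_def
      proof (intro CollectI conjI allI impI)
        fix j k assume "j < k" "k < n"
        then show "snd (?w j) < snd (?w k)"
          using Vm[of j k] Vm[of "Suc i" k] y y_small by (cases "k = Suc i") (auto intro: less_trans)
      qed (use V y y_small V[OF True] in \<open>auto intro: less_trans\<close>)
      then show ?thesis using el_cell[OF v] H_one by simp
    next
      case False
      have yb: "bad v i (snd (v (Suc i)))" using bad_other True by simp
      then have y_big: "snd (v (Suc i)) < y" using False y(2) by (cases "y = snd (v (Suc i))") auto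
      \<comment> \<open>The level of point \<open>i + 1\<close> uses up the only bad height, so
        \<open>y\<close> stays below all later ones.\<close>
      have up: "y < \<beta>" if "bad v i \<beta>" "snd (v (Suc i)) < \<beta>" for \<beta>
        using uniq[OF that(1) yb] that(2) y_big Vm[of i "Suc i"] True by force
      have y1: "y < 1" using up[OF bad_1] V[OF True] by simp
      have yk: "y < snd (v k)" if "Suc i < k" "k < n" for k
        using up[OF bad_other[of k]] that Vm by simp
      have c: "swap i ?w \<in> cell" unfolding cell_def
      proof (intro CollectI conjI allI impI)
        fix j assume "j < n"
        then show "0 < fst (swap i ?w j)" "fst (swap i ?w j) < 1" "0 < snd (swap i ?w j)" "snd (swap i ?w j) < 1"
          using V[OF transpose_bound[OF True, of j]] V[OF i] V[OF True] y y1 by (auto simp: swap_def)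
      next
        fix j k assume jk: "j < k" "k < n"
        consider "j = i" "k = Suc i" | "j = i" "Suc i < k" | "j = Suc i" "Suc i < k" | "j < i" "k = i" | "j < i" "k = Suc i" | "j \<notin> {i, Suc i}" "k \<notin> {i, Suc i}"
          using jk by force
        then show "snd (swap i ?w j) < snd (swap i ?w k)"
        proof cases
          case 1 then show ?thesis using y_big by simp
        next
          case 2 then show ?thesis using Vm[of "Suc i" k] jk by (simp add: swap_other)
        next
          case 3 then show ?thesis using yk jk by (simp add: swap_other)
        next
          case 4 then show ?thesis using Vm[of j "Suc i"] True by (simp add: swap_other)
        next
          case 5 then show ?thesis using Vm[of j i] i y by (simp add: swap_other)
        next
          case 6 then show ?thesis using Vm[of j k] jk by (simp add: swap_other)
        qed
      qed
      \<comment> \<open>Otherwise the two points would collide at the moment of equal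
        height.\<close>
      have xne: "fst (v i) \<noteq> fst (v (Suc i))"
      proof
        assume e: "fst (v i) = fst (v (Suc i))"
        let ?u = "v(i := (fst (v i), snd (v (Suc i))))"
        have "?u \<in> Y" using vY[of "snd (v (Suc i))"] y_big Vm[of i "Suc i"] True by simp
        then have "(?u i, ?u (Suc i)) \<notin> R" using True i unfolding Y_def by (metis (mono_tags, lifting) mem_Collect_eq n_not_Suc_n)
        moreover have "?u i = ?u (Suc i)" using e by (simp add: prod_eq_iff)
        ultimately show False by (metis surface_rel_refl)
      qed
      show ?thesis
      proof (cases "fst (v i) < fst (v (Suc i))")
        case xl: True
        have "el v (swap i (swap i ?w)) = sig i" by (rule sig_eq[OF v xl c _ True]) (use xl in simp)
        then show ?thesis using sig_H[OF True] by simp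
      next
        \<comment> \<open>With point \<open>i\<close> on the right, the reversed and relabelled
          crossing is the one described by \<open>sig i\<close>.\<close>
        case xg: False
        then have "el (swap i ?w) (swap i v) = sig i" using xne by (intro sig_eq c v True) auto
        moreover have W: "?w \<in> wall i 0" "v \<in> wall i 0"
        proof -
          show "v \<in> wall i 0" using xg xne V[OF i] V[OF True] True by (intro ycell_wall cell_ycell v) auto
          have "swap i (swap i ?w) \<in> wall i 0"
            by (rule swap_wall[OF cell_ycell[OF c] True]) (use xg xne V[OF i] V[OF True] in auto)
          then show "?w \<in> wall i 0" by simp
        qed
        moreover have "el (swap i ?w) (swap i v) = el ?w v"
          by (rule el_act_K[OF seg_closed_wall wall_Y[OF True] W, where \<sigma> = "Transposition.transpose i (Suc i)" and j = "\<lambda>_. 0" and k = "\<lambda>_. 0"])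
            (use True i in \<open>auto simp: surface_act_def swap_def intro!: permutes_swap_id\<close>)
        ultimately have "el v ?w = inv\<^bsub>FG\<^esub> sig i"
          using el_inv[OF seg_closed_wall wall_Y[OF True] W(2,1)] by simp
        then show ?thesis using sig_H[OF True] H_inv by simp
      qed
    qed
  next
    case False
    then have iN: "Suc i = n" using i by simp
    show ?thesis
    proof (cases "y < 1")
      case True
      have "?w \<in> cell" unfolding cell_def
      proof (intro CollectI conjI allI impI)
        fix j k assume "j < k" "k < n"
        then show "snd (?w j) < snd (?w k)" using Vm[of j k] y iN by (auto intro: less_trans)
      qed (use V y V[OF i] True in \<open>auto intro: less_trans\<close>)
      then show ?thesis using el_cell[OF v] H_one by simp
    next
      case False
      have y1: "1 < y" using False y(2) bad_1 by (cases "y = 1") auto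
      \<comment> \<open>The lowest point raised by one period; it bounds \<open>y\<close> because 1
        is already the one bad height passed. The indices 0 and \<open>i\<close> differ since
        \<open>n\<close> is at least 2.\<close>
      have "bad v i (1 + snd (v 0))" using n2 iN by (auto simp: bad_def intro!: exI[of _ 0])
      then have y2: "y < 1 + snd (v 0)"
        using uniq[OF _ bad_1] y1 V[OF i] V[of 0] i by force
      \<comment> \<open>The configuration after the exit, pulled back into \<open>cell\<close>: the
        former highest point enters at the bottom, reflected in the twisted case, so that
        \<open>spin c\<close> is the target.\<close>
      define c where "c = (\<lambda>m. if m = 0 then ((if tw then 1 - fst (v i) else fst (v i)), y - 1) else v (m - 1))"
      have "c \<in> cell" unfolding cell_def
      proof (intro CollectI conjI allI impI)
        fix j k assume jk: "j < k" "k < n"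
        show "snd (c j) < snd (c k)"
        proof (cases "j = 0")
          case True
          moreover have "k - 1 < n" using jk by simp
          ultimately show ?thesis using Vm[of 0 "k - 1"] jk y2 by (cases "k = 1") (auto simp: c_def)
        next
          case False
          then show ?thesis using Vm[of "j - 1" "k - 1"] jk by (auto simp: c_def)
        qed
      next
        fix j assume "j < n"
        then show "0 < fst (c j)" "fst (c j) < 1" "0 < snd (c j)" "snd (c j) < 1"
          using V[OF i] V[of "j - 1"] V[of 0] y1 y2 by (auto simp: c_def)
      qed
      then have "el v (spin c) = om" by (rule om_eq[OF v])
      moreover have "el v (spin c) = el v ?w"
      proof (rule el_cong)
        fix m assume "m < n"
        then consider "Suc m < n" | "m = i" using iN by linarith
        then show "spin c m = ?w m"
          using iN by cases (auto simp: spin_simps c_def)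
      qed simp
      ultimately show ?thesis using om_H by simp
    qed
  qed
qed

text \<open>Reduces moves of one point to configurations in \<open>cell\<close>, where the moving
  point \<open>m\<close> occupies slot \<open>i\<close>.\<close>

lemma normal_move:
  assumes v: "generic v" and m: "m < n" and Y: "\<And>t. t \<in> {0..1} \<Longrightarrow> seg v (v(m := p)) t \<in> Y"
  obtains \<sigma> j k i where "\<sigma> permutes {..<n}" "act_all \<sigma> j k v \<in> cell" "i < n" "\<sigma> i = m"
    "el v (v(m := p)) = el (act_all \<sigma> j k v) ((act_all \<sigma> j k v)(i := surface_act tw (j i) (k i) p))"
proof -
  obtain \<sigma> j k where \<sigma>: "\<sigma> permutes {..<n}" and c: "act_all \<sigma> j k v \<in> cell"
    using generic_normal_form[OF v] by blast
  define i where "i = inv_into UNIV \<sigma> m"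
  have i: "\<sigma> i = m" using permutes_inverses[OF \<sigma>] by (simp add: i_def)
  have iN: "i < n" using permutes_in_image[OF \<sigma>, of i] i m by simp
  have "el (act_all \<sigma> j k v) ((act_all \<sigma> j k v)(i := surface_act tw (j i) (k i) p)) = el v (v(m := p))"
  proof (rule el_act[OF \<sigma>, where j = j and k = k])
    fix l
    have "\<sigma> l = m \<longleftrightarrow> l = i" using i permutes_inj[OF \<sigma>] by (auto simp: inj_eq)
    then show "((act_all \<sigma> j k v)(i := surface_act tw (j i) (k i) p)) l = surface_act tw (j l) (k l) ((v(m := p)) (\<sigma> l))"
      by (auto simp: act_all_def)
  qed (use Y in \<open>auto simp: act_all_def\<close>)
  then show ?thesis using that[OF \<sigma> c iN i] by simp
qed

lemma x_move:
  assumes v: "generic v" and m: "m < n" and x: "x \<notin> \<int>" "\<bar>x - fst (v m)\<bar> < 1"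
  shows "el v (v(m := (x, snd (v m)))) \<in> H"
proof -
  let ?p = "(x, snd (v m))"
  have "seg v (v(m := ?p)) t \<in> Y" for t
  proof (rule snd_generic_Y)
    fix i j assume ij: "i < n" "j < n" "i \<noteq> j"
    have "snd (seg v (v(m := ?p)) t l) = snd (v l)" for l by (simp add: algebra_simps)
    then show "snd (seg v (v(m := ?p)) t i) - snd (seg v (v(m := ?p)) t j) \<notin> \<int>"
      using v ij unfolding generic_def by metis
  qed
  then obtain \<sigma> j k i where \<sigma>: "\<sigma> permutes {..<n}" and c: "act_all \<sigma> j k v \<in> cell" and i: "i < n" "\<sigma> i = m"
    and el: "el v (v(m := ?p)) = el (act_all \<sigma> j k v) ((act_all \<sigma> j k v)(i := surface_act tw (j i) (k i) ?p))"
    using normal_move[OF v m, of ?p] by metis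
  let ?u = "act_all \<sigma> j k v"
  have ui: "?u i = surface_act tw (j i) (k i) (v m)" by (simp add: act_all_def i)
  have 01: "0 < fst (?u i)" "fst (?u i) < 1" using c i by (auto simp: cell_def)
  define x' where "x' = fst (surface_act tw (j i) (k i) ?p)"
  have "surface_act tw (j i) (k i) ?p = (x', snd (?u i))" by (simp add: x'_def ui surface_act_def)
  moreover have "x' \<notin> \<int>" using x(1) by (auto simp: x'_def surface_act_def)
  moreover have "\<bar>x' - fst (?u i)\<bar> < 1" using x(2) by (auto simp: x'_def ui surface_act_def)
  ultimately show ?thesis
    using x_move_cell[OF c i(1), of x'] 01 unfolding el by force
qed

text \<open>Deck transformations preserve the upward direction and shift heights by integers, so bad
  heights of the normal form correspond to bad heights of \<open>v\<close>.\<close>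

lemma y_move_single:
  assumes v: "generic v" and i: "m < n" and y: "snd (v m) < y" "\<not> bad v m y"
    and uniq: "\<And>\<beta> \<beta>'. bad v m \<beta> \<Longrightarrow> bad v m \<beta>' \<Longrightarrow> snd (v m) \<le> \<beta> \<Longrightarrow> \<beta> \<le> y \<Longrightarrow> snd (v m) \<le> \<beta>' \<Longrightarrow> \<beta>' \<le> y \<Longrightarrow> \<beta> = \<beta>'"
    and vY: "\<And>s. snd (v m) \<le> s \<Longrightarrow> s \<le> y \<Longrightarrow> v(m := (fst (v m), s)) \<in> Y"
  shows "el v (v(m := (fst (v m), y))) \<in> H"
proof -
  let ?p = "(fst (v m), y)"
  have "seg v (v(m := ?p)) t \<in> Y" if t: "t \<in> {0..1}" for t
  proof -
    have "seg v (v(m := ?p)) t = v(m := (fst (v m), (1 - t) * snd (v m) + t * y))"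
      by (rule ext) (simp add: prod_eq_iff algebra_simps)
    moreover have "snd (v m) \<le> (1 - t) * snd (v m) + t * y" "(1 - t) * snd (v m) + t * y \<le> y"
      using segment_bound_lemma[of "snd (v m)" "snd (v m)" y t] convex_bound_le[of "snd (v m)" y y "1 - t" t] y t by auto
    ultimately show ?thesis using vY by simp
  qed
  then obtain \<sigma> j k i where \<sigma>: "\<sigma> permutes {..<n}" and c: "act_all \<sigma> j k v \<in> cell" and i: "i < n" "\<sigma> i = m"
    and el: "el v (v(m := ?p)) = el (act_all \<sigma> j k v) ((act_all \<sigma> j k v)(i := surface_act tw (j i) (k i) ?p))"
    using normal_move[OF v assms(2), of ?p] by metis
  let ?u = "act_all \<sigma> j k v"
  have \<sigma>n: "\<sigma> l < n \<longleftrightarrow> l < n" "\<sigma> l = m \<longleftrightarrow> l = i" for l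
    using permutes_in_image[OF \<sigma>, of l] i permutes_inj[OF \<sigma>] by (auto simp: inj_eq)
  have su: "snd (?u l) = snd (v (\<sigma> l)) + of_int (k l)" for l by (simp add: act_all_def surface_act_def)
  have B: "bad v m (\<beta> - of_int (k i))" if bb: "bad ?u i \<beta>" for \<beta>
  proof -
    have "\<beta> - of_int (k i) - snd (v (\<sigma> l)) = (\<beta> - snd (?u l)) + of_int (k l - k i)" for l
      by (simp add: su)
    then have "\<beta> - of_int (k i) - snd (v (\<sigma> l)) \<in> \<int>" if "\<beta> - snd (?u l) \<in> \<int>" for l
      using that by (metis Ints_add Ints_of_int)
    then show ?thesis using bb \<sigma>n unfolding bad_def by (metis Ints_diff Ints_of_int)
  qed
  have p: "surface_act tw (j i) (k i) ?p = (fst (?u i), y + of_int (k i))"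
    by (simp add: act_all_def surface_act_def i)
  show ?thesis unfolding el p
  proof (rule y_move_cell[OF c i(1)])
    show "snd (?u i) < y + of_int (k i)" using y by (simp add: su i)
    show "\<not> bad ?u i (y + of_int (k i))" using B[of "y + of_int (k i)"] y by auto
  next
    fix \<beta> \<beta>' assume A: "bad ?u i \<beta>" "bad ?u i \<beta>'" "snd (?u i) \<le> \<beta>" "\<beta> \<le> y + of_int (k i)" "snd (?u i) \<le> \<beta>'" "\<beta>' \<le> y + of_int (k i)"
    have "\<beta> - of_int (k i) = \<beta>' - of_int (k i)"
      by (rule uniq[OF B[OF A(1)] B[OF A(2)]]) (use A(3-6) in \<open>auto simp: su i\<close>)
    then show "\<beta> = \<beta>'" by simp
  next
    fix s assume s: "snd (?u i) \<le> s" "s \<le> y + of_int (k i)"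
    have Y: "v(m := (fst (v m), s - of_int (k i))) \<in> Y" using s by (intro vY) (auto simp: su i)
    show "?u(i := (fst (?u i), s)) \<in> Y"
    proof (rule act_in_Y[OF Y \<sigma>])
      fix l assume "l < n"
      have "(?u(i := (fst (?u i), s))) l = surface_act tw (j l) (k l) ((v(m := (fst (v m), s - of_int (k i)))) (\<sigma> l))"
        using \<sigma>n(2)[of l] by (cases "l = i") (simp_all add: act_all_def surface_act_def i(2))
      then show "((v(m := (fst (v m), s - of_int (k i)))) (\<sigma> l), (?u(i := (fst (?u i), s))) l) \<in> R"
        using surface_rel_act by metis
    qed
  qed
qed

end

section \<open>Boxes and perturbations into general position\<close>

context surface_braids
begin

definition box :: "points \<Rightarrow> real \<Rightarrow> points set" where
  "box p e = {v. \<forall>i<n. \<bar>fst (v i) - fst (p i)\<bar> < e \<and> \<bar>snd (v i) - snd (p i)\<bar> < e}"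

lemma seg_closed_box: "seg_closed (box p e)"
  unfolding seg_closed_def
proof (intro ballI)
  fix v w t assume vw: "v \<in> box p e" "w \<in> box p e" and t: "t \<in> {0..1::real}"
  have *: "\<bar>(1 - t) * x + t * x' - c\<bar> < e" if "\<bar>x - c\<bar> < e" "\<bar>x' - c\<bar> < e" for x x' c
  proof -
    have "x - c < e" "x' - c < e" "- e < x - c" "- e < x' - c" "0 \<le> t" "t \<le> 1" using that t by auto
    note convex_less[OF this(1,2,5,6)] convex_less[OF this(3,4,5,6)]
    then show ?thesis by (simp add: algebra_simps abs_less_iff)
  qed
  show "seg v w t \<in> box p e" using vw * by (simp add: box_def)
qed

text \<open>Heights at different indices lie in different cosets of the rationals, even across two
  such configurations, so replacing one by the other point by point never produces congruent
  heights. The factor \<open>Suc i\<close> is never 0, which also separates them from rational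
  heights.\<close>

definition irr :: "points \<Rightarrow> bool" where
  "irr v \<longleftrightarrow> (\<forall>i<n. fst (v i) - irrational \<in> \<rat> \<and> snd (v i) - of_int (int (Suc i)) * irrational \<in> \<rat>)"

definition rat :: "points \<Rightarrow> bool" where
  "rat v \<longleftrightarrow> (\<forall>i<n. snd (v i) \<in> \<rat>)"

lemma irrD: "irr v \<Longrightarrow> i < n \<Longrightarrow> snd (v i) - of_int (int (Suc i)) * irrational \<in> \<rat>"
  unfolding irr_def by blast

lemma irr_cross:
  assumes "irr v" "irr v'" "i < n" "j < n" "i \<noteq> j"
  shows "snd (v i) - snd (v' j) \<notin> \<int>"
proof -
  have "(snd (v i) - of_int (int (Suc i)) * irrational) - (snd (v' j) - of_int (int (Suc j)) * irrational) \<in> \<rat>"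
    using assms by (intro Rats_diff irrD)
  also have "(snd (v i) - of_int (int (Suc i)) * irrational) - (snd (v' j) - of_int (int (Suc j)) * irrational)
     = (snd (v i) - snd (v' j)) - of_int (int i - int j) * irrational"
    by (simp add: algebra_simps)
  finally show ?thesis using irrational_multiple assms(5) Ints_imp_Rats by (metis eq_iff_diff_eq_0 of_nat_eq_iff)
qed

lemma irr_generic: "irr v \<Longrightarrow> generic v"
proof -
  assume v: "irr v"
  have "fst (v i) \<notin> \<int>" "snd (v i) \<notin> \<int>" if "i < n" for i
  proof -
    have *: "fst (v i) - of_int 1 * irrational \<in> \<rat>" "snd (v i) - of_int (int (Suc i)) * irrational \<in> \<rat>"
      using v that unfolding irr_def of_int_1 mult_1_left by blast+
    from irrational_multiple[OF *(1) one_neq_zero] show "fst (v i) \<notin> \<int>" using Ints_imp_Rats by blast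
    have "int (Suc i) \<noteq> 0" by simp
    from irrational_multiple[OF *(2) this] show "snd (v i) \<notin> \<int>" using Ints_imp_Rats by blast
  qed
  then show ?thesis using irr_cross[OF v v] by (auto simp: generic_def)
qed

lemma irr_rat_cross:
  assumes "irr v" "rat v'" "i < n" "j < n"
  shows "snd (v i) - snd (v' j) \<notin> \<int>" "snd (v' j) - snd (v i) \<notin> \<int>"
proof -
  have "(snd (v i) - of_int (int (Suc i)) * irrational) - snd (v' j) \<in> \<rat>"
    using assms by (intro Rats_diff[OF irrD]) (auto simp: rat_def)
  then have "(snd (v i) - snd (v' j)) - of_int (int (Suc i)) * irrational \<in> \<rat>" by (simp add: algebra_simps)
  then have *: "snd (v i) - snd (v' j) \<notin> \<rat>" by (rule irrational_multiple) simp
  then show "snd (v i) - snd (v' j) \<notin> \<int>" using Ints_imp_Rats by blast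
  show "snd (v' j) - snd (v i) \<notin> \<int>"
    using * Ints_imp_Rats Ints_minus[of "snd (v' j) - snd (v i)"] by auto
qed

lemma ex_irr:
  assumes "0 < e"
  obtains v where "irr v" "v \<in> box p e"
proof -
  have "\<exists>r. fst r - irrational \<in> \<rat> \<and> snd r - of_int (int (Suc i)) * irrational \<in> \<rat> \<and>
      \<bar>fst r - fst (p i)\<bar> < e \<and> \<bar>snd r - snd (p i)\<bar> < e" for i
  proof -
    obtain x where "x - irrational \<in> \<rat>" "\<bar>x - fst (p i)\<bar> < e" by (rule Rats_translate_dense[OF assms])
    moreover obtain y where "y - of_int (int (Suc i)) * irrational \<in> \<rat>" "\<bar>y - snd (p i)\<bar> < e"
      by (rule Rats_translate_dense[OF assms])
    ultimately show ?thesis by (intro exI[of _ "(x, y)"]) simp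
  qed
  then obtain v where "\<And>i. fst (v i) - irrational \<in> \<rat> \<and> snd (v i) - of_int (int (Suc i)) * irrational \<in> \<rat> \<and>
      \<bar>fst (v i) - fst (p i)\<bar> < e \<and> \<bar>snd (v i) - snd (p i)\<bar> < e" by metis
  then show ?thesis using that[of v] by (simp add: irr_def box_def)
qed

lemma box_mono:
  assumes "v \<in> box p d" "p \<in> box p' d'" "d + d' \<le> e"
  shows "v \<in> box p' e"
  unfolding box_def
proof (intro CollectI allI impI)
  fix i assume i: "i < n"
  have "\<bar>fst (v i) - fst (p i)\<bar> < d" "\<bar>snd (v i) - snd (p i)\<bar> < d"
    "\<bar>fst (p i) - fst (p' i)\<bar> < d'" "\<bar>snd (p i) - snd (p' i)\<bar> < d'"
    using assms i by (auto simp: box_def)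
  then show "\<bar>fst (v i) - fst (p' i)\<bar> < e \<and> \<bar>snd (v i) - snd (p' i)\<bar> < e" using assms(3) by linarith
qed

lemma box_self: "0 < e \<Longrightarrow> p \<in> box p e"
  by (simp add: box_def)

lemma path_box_margin:
  assumes P: "\<And>i. i < n \<Longrightarrow> continuous_on {0..1::real} (\<lambda>t. P t i)" "\<And>t. t \<in> {0..1} \<Longrightarrow> P t \<in> Y"
  obtains e where "0 < e" "e \<le> 1/4" "\<And>t. t \<in> {0..1} \<Longrightarrow> box (P t) e \<subseteq> Y"
proof -
  obtain e where e: "e > 0" "\<And>t v w i j. t \<in> {0..1} \<Longrightarrow> i < n \<Longrightarrow> j < n \<Longrightarrow> i \<noteq> j \<Longrightarrow>
     dist v (P t i) < e \<Longrightarrow> dist w (P t j) < e \<Longrightarrow> (v, w) \<notin> R"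
    using Y_margin[OF P] by metis
  \<comment> \<open>A distance in the plane is at most the sum of the coordinate distances, hence
    \<open>e/2\<close>; the bound 1/4 later keeps horizontal moves inside a box shorter than
    1.\<close>
  have "box (P t) (min (1/4) (e/2)) \<subseteq> Y" if t: "t \<in> {0..1}" for t
  proof
    fix v assume v: "v \<in> box (P t) (min (1/4) (e/2))"
    have d: "dist (v i) (P t i) < e" if "i < n" for i
    proof -
      have "dist (v i) (P t i) \<le> \<bar>fst (v i) - fst (P t i)\<bar> + \<bar>snd (v i) - snd (P t i)\<bar>"
        unfolding dist_prod_def dist_real_def using sqrt_sum_squares_le_sum_abs by force
      also have "\<dots> < e" using v that unfolding box_def by force
      finally show ?thesis .
    qed
    show "v \<in> Y" unfolding Y_def using e(2)[OF t _ _ _ d d] by auto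
  qed
  then show ?thesis using that[of "min (1/4) (e/2)"] e(1) by auto
qed

end

section \<open>Generation of the braid group by the face classes\<close>

context framed_braids
begin

lemma generic_upd_y:
  assumes "generic v" "\<not> bad v m y"
  shows "generic (v(m := (fst (v m), y)))"
proof -
  have "snd (v j) - y \<notin> \<int>" if "j < n" "j \<noteq> m" for j
  proof
    assume "snd (v j) - y \<in> \<int>"
    then have "y - snd (v j) \<in> \<int>" using Ints_minus[of "snd (v j) - y"] by simp
    then show False using assms(2) that by (auto simp: bad_def)
  qed
  then show ?thesis using assms by (auto simp: generic_def bad_def)
qed

lemma bad_upd [simp]: "bad (v(m := p)) m = bad v m"
  by (auto simp: bad_def fun_eq_iff)

lemma finite_bad: "finite ({\<beta>. bad v m \<beta>} \<inter> {a..a'})"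
proof (rule finite_subset)
  show "{\<beta>. bad v m \<beta>} \<inter> {a..a'} \<subseteq> ({\<beta>. \<beta> - 0 \<in> \<int>} \<inter> {a..a'}) \<union> (\<Union>j<n. {\<beta>. \<beta> - snd (v j) \<in> \<int>} \<inter> {a..a'})"
    by (auto simp: bad_def)
qed (intro finite_UnI finite_UN_I finite_translated_Ints finite_lessThan)

text \<open>Cutting at good heights leaves pieces with at most one bad height; triangles in
  \<open>K\<close> put the pieces together.\<close>

lemma y_move_up:
  assumes K: "seg_closed K" "K \<subseteq> Y"
    and v: "generic v" and m: "m < n" and y: "snd (v m) < y" "\<not> bad v m y"
    and vK: "\<And>s. snd (v m) \<le> s \<Longrightarrow> s \<le> y \<Longrightarrow> v(m := (fst (v m), s)) \<in> K"
  shows "el v (v(m := (fst (v m), y))) \<in> H"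
proof -
  let ?w = "\<lambda>s. v(m := (fst (v m), s))"
  have "el (?w (snd (v m))) (?w y) \<in> H"
  proof (rule split_at_bad_values[where B = "{\<beta>. bad v m \<beta>}" and P = "\<lambda>c d. el (?w c) (?w d) \<in> H"])
    have "snd (v m) - snd (v j) \<notin> \<int>" if "j < n" "j \<noteq> m" for j using v m that by (auto simp: generic_def)
    moreover have "snd (v m) \<notin> \<int>" using v m by (auto simp: generic_def)
    ultimately show "snd (v m) \<notin> {\<beta>. bad v m \<beta>}" by (auto simp: bad_def)
  next
    fix c d
    assume cd: "snd (v m) \<le> c" "c < d" "d \<le> y" "c \<notin> {\<beta>. bad v m \<beta>}" "d \<notin> {\<beta>. bad v m \<beta>}"
      and u: "\<And>\<beta> \<beta>'. \<beta> \<in> {\<beta>. bad v m \<beta>} \<Longrightarrow> \<beta>' \<in> {\<beta>. bad v m \<beta>} \<Longrightarrow> c \<le> \<beta> \<Longrightarrow> \<beta> \<le> d \<Longrightarrow> c \<le> \<beta>' \<Longrightarrow> \<beta>' \<le> d \<Longrightarrow> \<beta> = \<beta>'"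
    have "el (?w c) ((?w c)(m := (fst ((?w c) m), d))) \<in> H"
    proof (rule y_move_single)
      show "generic (?w c)" using generic_upd_y[OF v] cd by simp
      fix s assume "snd (?w c m) \<le> s" "s \<le> d"
      then show "(?w c)(m := (fst (?w c m), s)) \<in> Y" using vK[of s] K cd by auto
    qed (use m cd u in auto)
    then show "el (?w c) (?w d) \<in> H" by simp
  next
    fix c d e assume A: "snd (v m) \<le> c" "c < d" "d < e" "e \<le> y" "el (?w c) (?w d) \<in> H" "el (?w d) (?w e) \<in> H"
    then show "el (?w c) (?w e) \<in> H"
      using el_triangle[OF K vK[of c] vK[of d] vK[of e]] H_mult[OF A(5,6)] by simp
  qed (use y finite_bad in auto)
  then show ?thesis by simp
qed

lemma y_move:
  assumes K: "seg_closed K" "K \<subseteq> Y"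
    and v: "generic v" and m: "m < n" and y: "\<not> bad v m y"
    and vK: "\<And>s. min (snd (v m)) y \<le> s \<Longrightarrow> s \<le> max (snd (v m)) y \<Longrightarrow> v(m := (fst (v m), s)) \<in> K"
  shows "el v (v(m := (fst (v m), y))) \<in> H"
proof -
  let ?w = "v(m := (fst (v m), y))"
  have KK: "v \<in> K" "?w \<in> K" using vK[of "snd (v m)"] vK[of y] by auto
  consider "snd (v m) < y" | "snd (v m) = y" | "y < snd (v m)" by linarith
  then show ?thesis
  proof cases
    case 1
    then show ?thesis using vK by (intro y_move_up[OF K v m _ y]) auto
  next
    case 2
    then show ?thesis using el_refl[of v] KK K H_one by auto
  next
    case 3
    have nb: "\<not> bad v m (snd (v m))" using v m by (auto simp: generic_def bad_def)
    have "el ?w (?w(m := (fst (?w m), snd (v m)))) \<in> H"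
      using 3 vK nb by (intro y_move_up[OF K generic_upd_y[OF v y] m]) auto
    then have "el ?w v \<in> H" by simp
    then show ?thesis using H_inv el_inv[OF K KK] by metis
  qed
qed

text \<open>The points are moved one after another, each first horizontally, then vertically. The
  hypothesis \<open>cross\<close> keeps the intermediate configurations generic, and the box keeps
  the vertical moves inside \<open>Y\<close>.\<close>

lemma box_move:
  assumes e: "e \<le> 1/4" and K: "box p e \<subseteq> Y" and v: "v \<in> box p e" "v' \<in> box p e" "generic v" "generic v'"
    and cross: "\<And>i j. i < n \<Longrightarrow> j < n \<Longrightarrow> i \<noteq> j \<Longrightarrow> snd (v i) - snd (v' j) \<notin> \<int>"
  shows "el v v' \<in> H"
proof -
  define U where "U m i = (if i < m then v' i else v i)" for m i
  note KK = seg_closed_box[of p e] K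
  have cross': "snd (v' i) - snd (v j) \<notin> \<int>" if "i < n" "j < n" "i \<noteq> j" for i j
  proof
    assume "snd (v' i) - snd (v j) \<in> \<int>"
    then have "snd (v j) - snd (v' i) \<in> \<int>" using Ints_minus[of "snd (v' i) - snd (v j)"] by simp
    then show False using cross[of j i] that by simp
  qed
  have gen: "generic (U m)" for m
    using v(3,4) cross cross' by (simp add: generic_def U_def)
  have inb: "U m \<in> box p e" for m using v by (auto simp: box_def U_def)
  have near: "\<bar>fst (v' m) - fst (p m)\<bar> < e" "\<bar>fst (v m) - fst (p m)\<bar> < e"
     "\<bar>snd (v' m) - snd (p m)\<bar> < e" "\<bar>snd (v m) - snd (p m)\<bar> < e" if "m < n" for m
    using v that unfolding box_def by blast+
  have "m \<le> n \<Longrightarrow> el v (U m) \<in> H" for m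
  proof (induction m)
    case 0
    have "U 0 = v" by (simp add: U_def fun_eq_iff)
    then show ?case using el_refl[of v] v K H_one by auto
  next
    case (Suc m)
    have m: "m < n" using Suc.prems by simp
    define c where "c = (U m)(m := (fst (v' m), snd (U m m)))"
    have um: "U m m = v m" by (simp add: U_def)
    have sc: "snd (c i) = snd (U m i)" for i by (simp add: c_def)
    have cm: "fst (c m) = fst (v' m)" by (simp add: c_def)
    have cb: "c \<in> box p e" using inb[of m] near[OF m] um by (auto simp: box_def c_def)
    have 1: "el (U m) c \<in> H"
      unfolding c_def
    proof (rule x_move[OF gen m])
      show "fst (v' m) \<notin> \<int>" using v(4) m by (simp add: generic_def)
      show "\<bar>fst (v' m) - fst (U m m)\<bar> < 1" using e near[OF m] unfolding um by linarith
    qed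
    have gc: "generic c"
      unfolding generic_def
    proof (intro allI impI conjI)
      fix i assume i: "i < n"
      show "fst (c i) \<notin> \<int>"
        using gen[of m] v(4) i by (cases "i = m") (simp_all add: c_def generic_def)
      show "snd (c i) \<notin> \<int>" unfolding sc using gen[of m] i by (simp add: generic_def)
      fix j assume "j < n" "i \<noteq> j"
      then show "snd (c i) - snd (c j) \<notin> \<int>" unfolding sc using gen[of m] i by (simp add: generic_def)
    qed
    have su: "U (Suc m) = c(m := (fst (c m), snd (v' m)))" by (auto simp: fun_eq_iff U_def c_def less_Suc_eq)
    have "bad c m = bad (U (Suc m)) m" unfolding su by simp
    moreover have "\<not> bad (U (Suc m)) m (snd (v' m))"
    proof -
      have "snd (v' m) - snd (U (Suc m) j) \<notin> \<int>" if "j < n" "j \<noteq> m" for j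
      proof -
        have "snd (U (Suc m) m) - snd (U (Suc m) j) \<notin> \<int>" using gen[of "Suc m"] m that unfolding generic_def by blast
        then show ?thesis by (simp add: U_def)
      qed
      moreover have "snd (v' m) \<notin> \<int>" using v(4) m by (simp add: generic_def)
      ultimately show ?thesis unfolding bad_def by blast
    qed
    ultimately have nb: "\<not> bad c m (snd (v' m))" by simp
    have 2: "el c (U (Suc m)) \<in> H"
      unfolding su
    proof (rule y_move[OF KK gc m nb])
      fix s assume s: "min (snd (c m)) (snd (v' m)) \<le> s" "s \<le> max (snd (c m)) (snd (v' m))"
      then have "\<bar>s - snd (p m)\<bar> < e" using near[OF m] unfolding sc um by linarith
      then show "c(m := (fst (c m), s)) \<in> box p e" using cb m by (auto simp: box_def)
    qed
    have "el v (U m) \<cdot> (el (U m) c \<cdot> el c (U (Suc m))) \<in> H"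
      using Suc.IH 1 2 m by (intro H_mult) auto
    then show ?case
      unfolding el_triangle[OF KK inb cb inb] el_triangle[OF KK v(1) inb inb] .
  qed
  from this[of n] have "el v (U n) \<in> H" by simp
  moreover have "el v (U n) = el v v'" by (rule el_cong) (auto simp: U_def)
  ultimately show ?thesis by simp
qed

text \<open>Each short piece of the path is compared, inside one box, with an edge between nearby
  \<open>irr\<close> configurations. Adjacent corrections cancel, so only those at the two ends
  remain; there the path is generic and \<open>rat\<close>, so \<open>box_move\<close> applies to
  them as well.\<close>

lemma transport_in_H:
  assumes P: "\<And>i. i < n \<Longrightarrow> continuous_on {0..1::real} (\<lambda>t. P t i)" "\<And>t. t \<in> {0..1} \<Longrightarrow> P t \<in> Y"
    and ends: "generic (P 0)" "rat (P 0)" "generic (P 1)" "rat (P 1)"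
  shows "transport (\<lambda>t. q (P t)) \<in> H"
proof -
  obtain e where e: "0 < e" "e \<le> 1/4" "\<And>t. t \<in> {0..1} \<Longrightarrow> box (P t) e \<subseteq> Y"
    using path_box_margin[OF P] by metis
  have KK: "seg_closed (box (P t) e)" "box (P t) e \<subseteq> Y" if "t \<in> {0..1}" for t
    using seg_closed_box e(3)[OF that] by auto
  let ?p = "\<lambda>t. q (P t)"
  have p: "pathin UC ?p" by (rule pathin_q[OF P])
  define T where "T a c = transport (segment_of_path ?p a c)" for a c
  have Tc: "T a c \<in> carrier FG" if "0 \<le> a" "a \<le> c" "c \<le> 1" for a c
    unfolding T_def using that by (intro transport_closed pathin_segment p)
  have Pe: "P t \<in> box (P t) e" for t by (rule box_self[OF e(1)])
  have half: "v \<in> box (P t) e" if "v \<in> box (P t) (e/2)" for v t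
    using box_mono[OF that box_self[of "e/2" "P t"]] e(1) by simp
  \<comment> \<open>Quantifying over all nearby \<open>irr\<close> configurations makes the property
    additive: any common \<open>w\<close> at the intermediate time may be chosen.\<close>
  define Q where "Q a c \<longleftrightarrow> (0 \<le> a \<longrightarrow> a \<le> c \<longrightarrow> c \<le> 1 \<longrightarrow> (\<forall>v v'. irr v \<longrightarrow> irr v' \<longrightarrow> v \<in> box (P a) (e/2) \<longrightarrow>
      v' \<in> box (P c) (e/2) \<longrightarrow> el v (P a) \<cdot> (T a c \<cdot> el (P c) v') \<in> H))" for a c
  have "Q 0 1"
  proof (rule Bolzano)
    fix a d c assume Q: "Q a d" "Q d c" and adc: "a \<le> d" "d \<le> c"
    show "Q a c" unfolding Q_def
    proof (intro impI allI)
      fix v v' assume A: "0 \<le> a" "a \<le> c" "c \<le> 1" "irr v" "irr v'" "v \<in> box (P a) (e/2)" "v' \<in> box (P c) (e/2)"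
      obtain w where w: "irr w" "w \<in> box (P d) (e/2)" using ex_irr[of "e/2"] e(1) by auto
      let ?x = "el v (P a)" and ?y = "el (P c) v'" and ?w = "el (P d) w" and ?w' = "el w (P d)"
      have 1: "?x \<cdot> (T a d \<cdot> ?w) \<in> H" and 2: "?w' \<cdot> (T d c \<cdot> ?y) \<in> H"
        using Q A adc w unfolding Q_def by auto
      have d01: "d \<in> {0..1}" "a \<in> {0..1}" "c \<in> {0..1}" using A adc by auto
      have C: "?x \<in> carrier FG" "?y \<in> carrier FG" "?w \<in> carrier FG" "?w' \<in> carrier FG"
        using el_closed[OF KK[OF d01(1)]] el_closed[OF KK[OF d01(2)]] el_closed[OF KK[OF d01(3)]] half A w Pe by auto
      have ww: "?w \<cdot> ?w' = \<one>\<^bsub>FG\<^esub>"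
        using el_triangle[OF KK[OF d01(1)] Pe half[OF w(2)] Pe] el_refl[OF P(2)[OF d01(1)]] by simp
      have TT: "T a c = T a d \<cdot> T d c" unfolding T_def using A adc by (intro transport_segments p) auto
      note TC = Tc[of a d] Tc[of d c]
      have "(?x \<cdot> (T a d \<cdot> ?w)) \<cdot> (?w' \<cdot> (T d c \<cdot> ?y))
          = ?x \<cdot> (T a d \<cdot> ((?w \<cdot> ?w') \<cdot> (T d c \<cdot> ?y)))"
        using C TC A adc by (simp add: m_assoc)
      also have "\<dots> = ?x \<cdot> (T a c \<cdot> ?y)"
        unfolding ww TT using C TC A adc by (simp add: m_assoc)
      finally show "?x \<cdot> (T a c \<cdot> ?y) \<in> H" using H_mult[OF 1 2] by simp
    qed
  next
    fix x :: real assume x: "0 \<le> x" "x \<le> 1"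
    have x01: "x \<in> {0..1}" using x by simp
    have "\<exists>d>0. \<forall>t\<in>{0..1}. dist t x < d \<longrightarrow> dist (P t i) (P x i) < e/2" if "i < n" for i
      using P(1)[OF that] e(1) x01 unfolding continuous_on_iff by (meson half_gt_zero)
    then obtain d where d: "\<And>i. i < n \<Longrightarrow> d i > 0 \<and> (\<forall>t\<in>{0..1}. dist t x < d i \<longrightarrow> dist (P t i) (P x i) < e/2)"
      by metis
    let ?d = "Min (insert 1 (d ` {..<n}))"
    have near: "P t \<in> box (P x) (e/2)" if t: "t \<in> {0..1}" "dist t x < ?d" for t
      unfolding box_def
    proof (intro CollectI allI impI)
      fix i assume i: "i < n"
      then have "dist t x < d i" using t by (auto simp: Min_gr_iff)
      then have "dist (P t i) (P x i) < e/2" using d[OF i] t by blast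
      then show "\<bar>fst (P t i) - fst (P x i)\<bar> < e/2 \<and> \<bar>snd (P t i) - snd (P x i)\<bar> < e/2"
        using dist_fst_le[of "P t i" "P x i"] dist_snd_le[of "P t i" "P x i"] by (simp add: dist_real_def)
    qed
    show "\<exists>d>0. \<forall>a c. a \<le> x \<and> x \<le> c \<and> c - a < d \<longrightarrow> Q a c"
    proof (intro exI[of _ ?d] conjI allI impI)
      show "?d > 0" using d by (subst Min_gr_iff) auto
      fix a c assume ac: "a \<le> x \<and> x \<le> c \<and> c - a < ?d"
      show "Q a c" unfolding Q_def
      proof (intro impI allI)
        fix v v' assume A: "0 \<le> a" "a \<le> c" "c \<le> 1" "irr v" "irr v'" "v \<in> box (P a) (e/2)" "v' \<in> box (P c) (e/2)"
        have seg_in: "P t \<in> box (P x) (e/2)" if "a \<le> t" "t \<le> c" for t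
        proof (rule near)
          have "dist t x \<le> c - a" using that ac by (auto simp: dist_real_def)
          then show "dist t x < ?d" using ac by linarith
        qed (use that A in auto)
        have B: "P a \<in> box (P x) e" "P c \<in> box (P x) e" "v \<in> box (P x) e" "v' \<in> box (P x) e"
          using box_mono[OF A(6) seg_in[of a]] box_mono[OF A(7) seg_in[of c]] half seg_in A(2) by auto
        have ac01: "a + t * (c - a) \<in> {0..1}" if "t \<in> {0..1}" for t
          using segment_param_bounds[of a c t] A that by auto
        \<comment> \<open>The piece stays in one box inside \<open>Y\<close>, so it can be
          straightened to its chord.\<close>
        have "path_homotopic UC (\<lambda>t. q (P (a + t * (c - a)))) (\<lambda>t. q (seg (P a) (P c) t))"
        proof (rule path_homotopic_lift)
          fix i assume "i < n"
          then show "continuous_on {0..1} (\<lambda>t. P (a + t * (c - a)) i)"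
            using ac01 by (intro continuous_on_compose2[OF P(1)] continuous_intros) auto
        next
          fix s t :: real assume st: "s \<in> {0..1}" "t \<in> {0..1}"
          have "P (a + t * (c - a)) \<in> box (P x) e"
            using segment_param_bounds[of a c t] A st by (intro half seg_in) auto
          moreover have "seg (P a) (P c) t \<in> box (P x) e" using B seg_closed_box st by (simp add: seg_closed_def)
          ultimately show "seg (P (a + t * (c - a))) (seg (P a) (P c) t) s \<in> Y"
            using seg_closed_box[of "P x" e] st e(3)[OF x01] unfolding seg_closed_def by blast
        qed (auto intro: continuous_seg)
        then have T: "T a c = el (P a) (P c)"
          by (simp add: T_def el_def line_def segment_of_path_def transport_homotopic)
        have "el v (P a) \<cdot> (T a c \<cdot> el (P c) v') = el v v'"
          unfolding T using B by (simp add: el_triangle[OF KK[OF x01]])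
        also have "el v v' \<in> H"
          by (rule box_move[OF e(2) e(3)[OF x01] B(3,4)]) (use A irr_generic irr_cross in auto)
        finally show "el v (P a) \<cdot> (T a c \<cdot> el (P c) v') \<in> H" .
      qed
    qed
  qed simp
  obtain v where v: "irr v" "v \<in> box (P 0) (e/2)" using ex_irr[of "e/2"] e(1) by auto
  obtain v' where v': "irr v'" "v' \<in> box (P 1) (e/2)" using ex_irr[of "e/2"] e(1) by auto
  have "(0::real) \<in> {0..1}" "(1::real) \<in> {0..1}" by auto
  note K0 = KK[OF this(1)] and K1 = KK[OF this(2)]
  let ?x = "el v (P 0)" and ?y = "el (P 1) v'"
  have main: "?x \<cdot> (T 0 1 \<cdot> ?y) \<in> H" using \<open>Q 0 1\<close> v v' by (simp add: Q_def)
  have x: "el v (P 0) \<in> H"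
    by (rule box_move[OF e(2) K0(2) half[OF v(2)] Pe irr_generic[OF v(1)] ends(1)])
      (use irr_rat_cross(1)[OF v(1) ends(2)] in auto)
  have y: "el (P 1) v' \<in> H"
    by (rule box_move[OF e(2) K1(2) Pe half[OF v'(2)] ends(3) irr_generic[OF v'(1)]])
      (use irr_rat_cross(2)[OF v'(1) ends(4)] in auto)
  have C: "?x \<in> carrier FG" "?y \<in> carrier FG" "T 0 1 \<in> carrier FG"
    using el_closed[OF K0 half[OF v(2)] Pe] el_closed[OF K1 Pe half[OF v'(2)]] Tc[of 0 1] by auto
  have "inv\<^bsub>FG\<^esub> ?x \<cdot> (?x \<cdot> (T 0 1 \<cdot> ?y)) \<cdot> inv\<^bsub>FG\<^esub> ?y \<in> H"
    by (intro H_mult H_inv main x y)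
  also have "inv\<^bsub>FG\<^esub> ?x \<cdot> (?x \<cdot> (T 0 1 \<cdot> ?y)) \<cdot> inv\<^bsub>FG\<^esub> ?y = T 0 1"
    using C by (simp add: m_assoc flip: m_assoc[of "inv\<^bsub>FG\<^esub> ?x" ?x])
  finally show ?thesis by (simp add: T_def segment_of_path_def)
qed

text \<open>A loop at \<open>q v0\<close> lifts to a path from \<open>v0\<close> to a permuted deck
  translate of \<open>v0\<close>. Deck transformations change coordinates by integers and possibly a
  horizontal sign, so the far end is generic with rational heights too.\<close>

lemma H_carrier: "H = carrier FG"
proof
  show "H \<subseteq> carrier FG" using generate_incl[OF gens_closed] .
  show "carrier FG \<subseteq> H"
  proof
    fix g assume g: "g \<in> carrier FG"
    have v0Y: "v0 \<in> Y" using v0_cell cell_chamber chamber_Y by blast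
    obtain p where p: "pathin UC p" "p 0 = q v0" "p 1 = q v0" "transport p = g"
      using transport_surj[OF q_in_topspace[OF v0Y] g] by blast
    obtain P where P: "P 0 = v0" "\<And>i. i < n \<Longrightarrow> continuous_on {0..1} (\<lambda>t. P t i)"
      "\<And>t. t \<in> {0..1} \<Longrightarrow> P t \<in> Y" "\<And>t. t \<in> {0..1} \<Longrightarrow> q (P t) = p t"
      using path_lifting[OF p(1) v0Y] p(2) by metis
    have "q v0 = q (P 1)" using P(4)[of 1] p(3) by simp
    then obtain \<sigma> where \<sigma>: "\<sigma> permutes {..<n}" "\<And>i. i < n \<Longrightarrow> (v0 (\<sigma> i), P 1 i) \<in> R"
      using q_eq_iff[OF v0Y, of "P 1"] P(3) by auto
    have \<sigma>n: "\<sigma> i < n" if "i < n" for i using permutes_in_image[OF \<sigma>(1), of i] that by simp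
    have "\<exists>j k. P 1 i = surface_act tw j k (v0 (\<sigma> i))" if "i < n" for i
      using \<sigma>(2)[OF that] by (auto simp: surface_rel_def)
    then obtain j k where P1: "\<And>i. i < n \<Longrightarrow> P 1 i = surface_act tw (j i) (k i) (v0 (\<sigma> i))" by metis
    have Ints01: "x \<notin> \<int>" if "0 < x" "x < 1" for x :: real using that by (auto elim!: Ints_cases)
    have v0b: "0 < fst (v0 i)" "fst (v0 i) < 1" "0 < snd (v0 i)" "snd (v0 i) < 1" if "i < n" for i
      using v0_cell that by (auto simp: cell_def)
    have v0d: "snd (v0 i) - snd (v0 j) \<notin> \<int>" if ij: "i < n" "j < n" "i \<noteq> j" for i j
    proof
      assume "snd (v0 i) - snd (v0 j) \<in> \<int>"
      then obtain z where z: "snd (v0 i) - snd (v0 j) = of_int z" by (auto elim: Ints_cases)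
      then have "z = 0" using v0b[OF ij(1)] v0b[OF ij(2)] by linarith
      then have "snd (v0 i) = snd (v0 j)" using z by simp
      then show False using ij by (simp add: v0_def)
    qed
    have gen0: "generic v0" using v0b Ints01 v0d by (simp add: generic_def)
    have rat0: "rat v0" by (simp add: rat_def v0_def)
    have rat1: "rat (P 1)" using P1 rat0 \<sigma>n by (simp add: rat_def surface_act_def)
    have "snd (P 1 i) - snd (P 1 l) \<notin> \<int>" if il: "i < n" "l < n" "i \<noteq> l" for i l
    proof
      assume "snd (P 1 i) - snd (P 1 l) \<in> \<int>"
      moreover have "snd (v0 (\<sigma> i)) - snd (v0 (\<sigma> l)) = (snd (P 1 i) - snd (P 1 l)) + of_int (k l - k i)"
        using P1 il by (simp add: surface_act_def)
      ultimately have "snd (v0 (\<sigma> i)) - snd (v0 (\<sigma> l)) \<in> \<int>" by (metis Ints_add Ints_of_int)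
      moreover have "\<sigma> i \<noteq> \<sigma> l" using permutes_inj[OF \<sigma>(1)] il by (auto simp: inj_eq)
      ultimately show False using v0d \<sigma>n il by blast
    qed
    moreover have "fst (P 1 i) \<notin> \<int> \<and> snd (P 1 i) \<notin> \<int>" if "i < n" for i
      using P1[OF that] Ints01 v0b[OF \<sigma>n[OF that]] by (auto simp: surface_act_def)
    ultimately have gen1: "generic (P 1)" by (simp add: generic_def)
    have "transport (\<lambda>t. q (P t)) \<in> H"
      using P(1) gen0 rat0 gen1 rat1 by (intro transport_in_H P(2,3)) auto
    moreover have "transport (\<lambda>t. q (P t)) = transport p"
      by (rule transport_homotopic[OF path_homotopic_reparam[OF p(1), of id id]]) (use P(4) in auto)
    ultimately show "g \<in> H" using p(4) by simp
  qed
qed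

end

section \<open>Relations between the generators\<close>

context framed_braids
begin

text \<open>The loop around the codimension two stratum where point \<open>i\<close> sits on the line \<open>x = 1\<close> at the
  same height as point \<open>i + 1\<close>.\<close>

lemma tau_sig_relation:
  assumes i: "Suc i < n"
  shows "tau i \<cdot> sig i = inv\<^bsub>FG\<^esub> (sig i) \<cdot> tau (Suc i)"
proof -
  define X where "X x x' m = ((if m = i then x else if m = Suc i then x' else fst (v0 m)), snd (v0 m))" for x x' m
  have Xs: "X x x' i = (x, snd (v0 i))" "X x x' (Suc i) = (x', snd (v0 (Suc i)))"
    "m \<noteq> i \<Longrightarrow> m \<noteq> Suc i \<Longrightarrow> X x x' m = v0 m" for x x' m
    by (auto simp: X_def)
  have Xy: "ycell (X x x')" for x x' using cell_ycell[OF v0_cell] by (simp add: ycell_def X_def)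
  have Xc: "X x x' \<in> cell" if "0 < x" "x < 1" "0 < x'" "x' < 1" for x x'
    using v0_cell that by (auto simp: cell_def X_def)
  have b1: "bump i (X x x') = X (x + 1) x'" for x x' by (auto simp: bump_def X_def fun_eq_iff)
  have b2: "bump (Suc i) (X x x') = X x (x' + 1)" for x x' by (auto simp: bump_def X_def fun_eq_iff)
  note W = seg_closed_wall wall_Y[OF i]
  \<comment> \<open>The horizontal differences at the four corners are 1/4, 3/4, 3/4, 1/4, so the
    quadrilateral stays in \<open>wall i 0\<close>. In slot \<open>i\<close> the coordinate passes 1
    from \<open>A\<close> to \<open>B\<close> and from \<open>Dp\<close> to \<open>C\<close>;
    heights are exchanged from \<open>B\<close> to \<open>C\<close> and from \<open>Dp\<close> to
    \<open>A\<close>.\<close>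
  define A where "A = X (3/4) (1/2)"
  define B where "B = X (5/4) (1/2)"
  define C where "C = swap i (X (1/2) (5/4))"
  define Dp where "Dp = swap i (X (1/2) (3/4))"
  have W0: "A \<in> wall i 0" "B \<in> wall i 0" "C \<in> wall i 0" "Dp \<in> wall i 0"
    unfolding A_def B_def C_def Dp_def
    by (rule ycell_wall[OF Xy i] swap_wall[OF Xy i]; simp add: Xs)+
  have AB: "el A B = tau i"
    using tau_eq[of A "X (1/4) (1/2)" i] by (simp add: A_def B_def Xc b1)
  have BC: "el B C = sig i"
  proof -
    \<comment> \<open>Point \<open>i\<close> is moved back by one period, which places it to the
      left of its neighbour.\<close>
    have "el B C = el (X (1/4) (1/2)) (swap i (X (1/2) (1/4)))"
    proof (rule el_act_K[OF W, where \<sigma> = id and j = "\<lambda>m. if m = i then 1 else 0" and k = "\<lambda>_. 0"])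
      show "X (1/4) (1/2) \<in> wall i (-1)" by (rule ycell_wall[OF Xy i]) (simp_all add: Xs)
      show "swap i (X (1/2) (1/4)) \<in> wall i (-1)" by (rule swap_wall[OF Xy i]) (simp_all add: Xs)
      show "C m = surface_act tw (if m = i then 1 else 0) 0 (swap i (X (1/2) (1/4)) (id m))" for m
        by (cases "m = i \<or> m = Suc i") (auto simp: C_def surface_act_def Xs swap_other)
    qed (auto simp: permutes_id B_def X_def surface_act_def)
    also have "\<dots> = sig i" by (rule sig_eq[OF Xc _ Xc _ i]) (simp_all add: Xs)
    finally show ?thesis .
  qed
  have tr: "Transposition.transpose i (Suc i) permutes {..<n}" using i by (intro permutes_swap_id) auto
  have DC: "el Dp C = tau (Suc i)"
  proof -
    \<comment> \<open>Once the exchange of labels is undone, the moving point has index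
      \<open>i + 1\<close>.\<close>
    have "el Dp C = el (X (1/2) (3/4)) (X (1/2) (5/4))"
      by (rule el_act_K[OF chamber_K ycell_chamber[OF Xy] ycell_chamber[OF Xy] tr, where j = "\<lambda>_. 0" and k = "\<lambda>_. 0"])
        (simp_all add: Dp_def C_def swap_def surface_act_def)
    also have "\<dots> = tau (Suc i)"
      using tau_eq[of "X (1/2) (3/4)" "X (1/2) (1/4)" "Suc i"] by (simp add: Xc b2)
    finally show ?thesis .
  qed
  have DA: "el Dp A = sig i"
  proof -
    have "el Dp A = el (X (1/2) (3/4)) (swap i A)"
    proof (rule el_act_K[OF W _ _ tr, where j = "\<lambda>_. 0" and k = "\<lambda>_. 0"])
      show "X (1/2) (3/4) \<in> wall i (-1)" by (rule ycell_wall[OF Xy i]) (simp_all add: Xs)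
      show "swap i A \<in> wall i (-1)" unfolding A_def by (rule swap_wall[OF Xy i]) (simp_all add: Xs)
    qed (simp_all add: Dp_def swap_def surface_act_def)
    also have "\<dots> = sig i" unfolding A_def by (rule sig_eq[OF Xc _ Xc _ i]) (simp_all add: Xs)
    finally show ?thesis .
  qed
  have "tau i \<cdot> sig i = el A C" using el_triangle[OF W W0(1-3)] by (simp add: AB BC)
  also have "\<dots> = el A Dp \<cdot> el Dp C" using el_triangle[OF W W0(1,4,3)] by simp
  also have "el A Dp = inv\<^bsub>FG\<^esub> (sig i)" using el_inv[OF W W0(1,4)] by (simp add: DA)
  finally show ?thesis by (simp add: DC)
qed

text \<open>Two ways around a parallelogram in \<open>chamber\<close>. The last factor still has to
  be evaluated by finding which point sits in slot \<open>i\<close> after the passage through the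
  top.\<close>

lemma bump_spin:
  "tau i \<cdot> om = om \<cdot> el (spin v0) (bump i (spin v0))"
proof -
  have ch: "v0 \<in> chamber" "bump i v0 \<in> chamber" "spin v0 \<in> chamber" "bump i (spin v0) \<in> chamber"
  proof -
    show "spin v0 \<in> chamber" by (intro spin_chamber cell_ycell v0_cell)
    then show "bump i (spin v0) \<in> chamber" by (auto simp: chamber_def bump_def)
  qed (use v0_cell cell_chamber bump_chamber in auto)
  have "el (bump i v0) (bump i (spin v0)) = om"
    unfolding om_def
    by (rule el_act_K[OF chamber_K ch(1,3), where \<sigma> = id and j = "\<lambda>m. if m = i then 1 else 0" and k = "\<lambda>_. 0"])
      (auto simp: permutes_id bump_def surface_act_def prod_eq_iff)
  then show ?thesis
    using el_triangle[OF chamber_K ch(1,2,4)] el_triangle[OF chamber_K ch(1,3,4)]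
    by (simp add: tau_def om_def)
qed

lemma el_spin:
  assumes "v \<in> chamber" "w \<in> chamber"
  shows "el (spin v) (spin w) = el v w"
  by (rule el_act_K[OF chamber_K assms cyc_permutes, where j = "\<lambda>m. if Suc m = n \<and> tw then 1 else 0"
        and k = "\<lambda>m. if Suc m = n then 1 else 0"]) (auto simp: spin_def act_all_def)

text \<open>After the passage through the top, slot \<open>i\<close> holds the former point
  \<open>i + 1\<close>.\<close>

lemma tau_om_relation:
  assumes "Suc i < n"
  shows "tau i \<cdot> om = om \<cdot> tau (Suc i)"
proof -
  have "el (spin v0) (bump i (spin v0)) = el (spin v0) (spin (bump (Suc i) v0))"
  proof (rule el_cong)
    fix m assume "m < n"
    then consider "Suc m < n" | "Suc m = n" by linarith
    then show "bump i (spin v0) m = spin (bump (Suc i) v0) m"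
      using assms by cases (auto simp: bump_def spin_simps)
  qed simp
  also have "\<dots> = tau (Suc i)"
    unfolding tau_def using v0_cell cell_chamber bump_chamber by (intro el_spin) auto
  finally show ?thesis using bump_spin by simp
qed

text \<open>The last slot now holds the reflected point 0, so its turn to the right is a turn of
  point 0 to the left. This is the source of the dimension lost for the Klein bottle.\<close>

lemma tau_om_relation_twisted:
  assumes tw and i: "Suc i = n"
  shows "tau i \<cdot> om = om \<cdot> inv\<^bsub>FG\<^esub> (tau 0)"
proof -
  let ?u = "v0(0 := v0 0 - (1, 0))"
  have ch: "?u \<in> chamber" "v0 \<in> chamber"
    using v0_cell cell_chamber cell_ycell[OF v0_cell] by (auto simp: ycell_def intro!: ycell_chamber)
  have "el (spin v0) (bump i (spin v0)) = el (spin v0) (spin ?u)"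
  proof (rule el_cong)
    fix m assume "m < n"
    then consider "Suc m < n" "m \<noteq> i" | "m = i" using i by linarith
    then show "bump i (spin v0) m = spin ?u m"
    proof cases
      case 1
      have "bump i (spin v0) m = spin v0 m" using 1(2) by (simp add: bump_def)
      then show ?thesis by (simp add: spin_simps(1)[OF 1(1)])
    next
      case 2
      have "spin v i = (1 - fst (v 0), snd (v 0) + 1)" for v
        using if_P[OF \<open>tw\<close>] spin_simps(2)[OF i] by metis
      moreover have "bump i (spin v0) i = spin v0 i + (1, 0)" by (simp add: bump_def)
      ultimately show ?thesis unfolding 2 by simp
    qed
  qed simp
  also have "\<dots> = el v0 ?u" using ch by (rule el_spin[rotated])
  also have "\<dots> = inv\<^bsub>FG\<^esub> (el ?u v0)" using el_inv[OF chamber_K ch(2,1)] by simp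
  also have "el ?u v0 = el v0 (bump 0 v0)"
    by (rule el_act_K[OF chamber_K ch, symmetric, where \<sigma> = id and j = "\<lambda>m. if m = 0 then 1 else 0" and k = "\<lambda>_. 0"])
      (auto simp: permutes_id bump_def surface_act_def prod_eq_iff)
  finally show ?thesis using bump_spin by (simp add: tau_def)
qed

lemma character_tau:
  assumes \<xi>: "\<xi> \<in> characters FG" and i: "i < n"
  shows "\<xi> (tau i) = \<xi> (tau 0)"
  using i
proof (induction i)
  case (Suc i)
  then show ?case
    using arg_cong[OF tau_om_relation[OF Suc.prems], of \<xi>] by (simp add: character_mult[OF \<xi>] tau_closed om_closed)
qed simp

text \<open>The two \<open>tau\<close> terms cancel in the relation, which leaves twice the value
  equal to 0.\<close>

lemma character_sig:
  assumes \<xi>: "\<xi> \<in> characters FG" and i: "Suc i < n"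
  shows "\<xi> (sig i) = 0"
proof -
  have "\<xi> (tau i) + \<xi> (sig i) = - \<xi> (sig i) + \<xi> (tau (Suc i))"
    using arg_cong[OF tau_sig_relation[OF i], of \<xi>]
    by (simp add: character_mult[OF \<xi>] character_inv[OF \<xi>] tau_closed sig_closed i)
  then show ?thesis using character_tau[OF \<xi>, of i] character_tau[OF \<xi> i] i by simp
qed

lemma character_tau_twisted:
  assumes \<xi>: "\<xi> \<in> characters FG" and tw
  shows "\<xi> (tau 0) = 0"
proof -
  have i: "Suc (n - 1) = n" using n2 by simp
  have "\<xi> (tau (n - 1)) = - \<xi> (tau 0)"
    using arg_cong[OF tau_om_relation_twisted[OF \<open>tw\<close> i], of \<xi>]
    by (simp add: character_mult[OF \<xi>] character_inv[OF \<xi>] tau_closed om_closed)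
  then show ?thesis using character_tau[OF \<xi>, of "n - 1"] n2 by simp
qed

text \<open>The upper bound on the dimension: two parameters for the torus, one for the Klein
  bottle.\<close>

lemma character_determined:
  assumes \<xi>: "\<xi> \<in> characters FG" and om: "\<xi> om = 0" and tau: "\<not> tw \<Longrightarrow> \<xi> (tau 0) = 0"
    and g: "g \<in> carrier FG"
  shows "\<xi> g = 0"
proof -
  have "\<xi> (tau 0) = 0"
    using tau character_tau_twisted[OF \<xi>] by blast
  then have gens0: "\<xi> x = 0" if "x \<in> gens" for x
    using that om character_tau[OF \<xi>] character_sig[OF \<xi>] by (auto simp: gens_def)
  have "g \<in> generate FG gens" using g H_carrier by simp
  then show ?thesis
  proof (induction rule: generate.induct)
    case (eng h1 h2)
    then show ?case using generate_in_carrier[OF gens_closed] by (simp add: character_mult[OF \<xi>])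
  qed (use gens0 gens_closed in \<open>auto simp: character_one[OF \<xi>] character_inv[OF \<xi>] subset_iff\<close>)
qed

end

context group
begin

lemma character_linear_combination:
  assumes "\<xi> \<in> characters G" "\<psi> \<in> characters G"
  shows "(\<lambda>g\<in>carrier G. r * \<xi> g + s * \<psi> g) \<in> characters G"
  using assms by (auto simp: characters_def hom_def real_group_def algebra_simps)

end

section \<open>Existence of a frame\<close>

text \<open>The hypothesis \<open>h\<close> says that the frame is extended along \<open>p\<close>
  without a twist, so the based loop runs out and back along one frame path.\<close>

lemma (in framed_space) transport_trivial:
  assumes p: "pathin X p" and h: "path_homotopic X (concat_paths (\<kappa> (p 0)) p) (\<kappa> (p 1))"
  shows "transport p = \<one>\<^bsub>FG\<^esub>"
proof -
  have k: "pathin X (\<kappa> (p 0))" "\<kappa> (p 0) 1 = p 0" "pathin X (\<kappa> (p 1))" "\<kappa> (p 1) 0 = b" "\<kappa> (p 1) 1 = p 1"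
    using pathin_ends[OF p] frame by auto
  have r: "path_homotopic X (reverse_path (\<kappa> (p 1))) (reverse_path (\<kappa> (p 1)))"
    using k by (simp add: path_homotopic_refl pathin_reverse)
  have "path_homotopic X (based_loop p) (concat_paths (concat_paths (\<kappa> (p 0)) p) (reverse_path (\<kappa> (p 1))))"
    unfolding based_loop_def
    by (rule path_homotopic_sym, rule path_homotopic_assoc) (use p k in \<open>auto simp: pathin_reverse\<close>)
  also have "path_homotopic X \<dots> (concat_paths (\<kappa> (p 1)) (reverse_path (\<kappa> (p 1))))"
    by (rule path_homotopic_concat[OF h r]) (simp add: k)
  also have "path_homotopic X \<dots> (\<lambda>_. b)"
    using path_homotopic_reverse_right[OF k(3)] k(4) by simp
  finally show ?thesis
    using based_loop[OF p] by (simp add: transport_def one_fundamental_group loop_class_eqI)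
qed

context surface_braids
begin

text \<open>A small perturbation makes the configuration generic, its normal form has the same
  projection, and segments inside \<open>cell\<close> reach \<open>v0\<close>.\<close>

lemma path_component_v0:
  assumes v: "v \<in> Y"
  shows "path_component_of UC (q v) (q v0)"
proof -
  obtain e where e: "0 < e" "box v e \<subseteq> Y"
    using path_box_margin[of "\<lambda>_. v"] v by (metis atLeastAtMost_iff continuous_on_const order_refl zero_le_one)
  obtain w where w: "irr w" "w \<in> box v e" using ex_irr[OF e(1)] by blast
  obtain \<sigma> j k where \<sigma>: "\<sigma> permutes {..<n}" "act_all \<sigma> j k w \<in> cell"
    using generic_normal_form[OF irr_generic[OF w(1)]] by blast
  let ?c = "act_all \<sigma> j k w"
  have "q w = q ?c"
    by (rule q_act[OF _ \<sigma>(1)]) (use w(2) e(2) surface_rel_act in \<open>auto simp: act_all_def\<close>)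
  moreover have "path_component_of UC (q v) (q w)"
    using pathin_line[OF seg_closed_box e(2) box_self[OF e(1)] w(2)] unfolding path_component_of_def by force
  moreover have "path_component_of UC (q ?c) (q v0)"
  proof -
    have "pathin UC (line ?c v0)"
      using cell_chamber chamber_Y by (intro pathin_line[OF seg_closed_cell _ \<sigma>(2) v0_cell]) auto
    then show ?thesis unfolding path_component_of_def by force
  qed
  ultimately show ?thesis by (metis path_component_of_trans)
qed

text \<open>On the image of \<open>cell\<close> the frame is one fixed path followed by a straight
  segment from \<open>v0\<close>, so triangles make the edges inside \<open>cell\<close> trivial;
  elsewhere any path will do.\<close>

lemma ex_frame:
  assumes b: "b \<in> topspace UC"
  obtains \<kappa> where "framed_braids tw n b \<kappa>"
proof -
  have pc: "path_component_of UC b u" if u: "u \<in> topspace UC" for u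
    using path_component_v0 b u unfolding topspace_UC
    by (metis (no_types, lifting) imageE path_component_of_sym path_component_of_trans)
  have cellY: "cell \<subseteq> Y" using cell_chamber chamber_Y by blast
  then have "q v0 \<in> topspace UC" using v0_cell q_in_topspace by blast
  then obtain \<delta> where \<delta>: "pathin UC \<delta>" "\<delta> 0 = b" "\<delta> 1 = q v0" using pc unfolding path_component_of_def by blast
  define P where "P u = (SOME p. pathin UC p \<and> p 0 = b \<and> p 1 = u)" for u
  have P: "pathin UC (P u) \<and> P u 0 = b \<and> P u 1 = u" if u: "u \<in> topspace UC" for u
  proof -
    obtain p where "pathin UC p \<and> p 0 = b \<and> p 1 = u" using pc[OF u] unfolding path_component_of_def by blast
    then show ?thesis unfolding P_def by (rule someI[of "\<lambda>p. pathin UC p \<and> p 0 = b \<and> p 1 = u"])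
  qed
  define c where "c u = (SOME v. v \<in> cell \<and> q v = u)" for u
  have c: "c (q v) \<in> cell \<and> q (c (q v)) = q v" if v: "v \<in> cell" for v
    unfolding c_def by (rule someI[of "\<lambda>w. w \<in> cell \<and> q w = q v" v]) (use v in simp)
  define \<kappa> where "\<kappa> u = (if u \<in> q ` cell then concat_paths \<delta> (line v0 (c u)) else P u)" for u
  have \<kappa>_cell: "\<kappa> (q v) = concat_paths \<delta> (line v0 v)" if v: "v \<in> cell" for v
  proof -
    \<comment> \<open>The chosen representative may differ from \<open>v\<close> only at indices
      that the projection ignores.\<close>
    have "line v0 (c (q v)) = line v0 v"
      unfolding line_def using q_inj_on_cell[of "c (q v)" v] c[OF v] v
      by (intro ext q_cong) (simp add: seg_def)
    then show ?thesis using v by (simp add: \<kappa>_def)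
  qed
  have lin: "pathin UC (line v w)" if "v \<in> cell" "w \<in> cell" for v w
    by (rule pathin_line[OF seg_closed_cell cellY that])
  interpret F: framed_space UC b \<kappa>
  proof
    fix u assume u: "u \<in> topspace UC"
    show "pathin UC (\<kappa> u) \<and> \<kappa> u 0 = b \<and> \<kappa> u 1 = u"
    proof (cases "u \<in> q ` cell")
      case True
      then obtain v where v: "v \<in> cell" "u = q v" by blast
      then show ?thesis using \<delta> lin[OF v0_cell v(1)] by (simp add: \<kappa>_cell pathin_concat)
    next
      case False
      then show ?thesis using P[OF u] by (simp add: \<kappa>_def)
    qed
  qed (rule b)
  have "framed_braids tw n b \<kappa>"
  proof unfold_locales
    fix v w assume vw: "v \<in> cell" "w \<in> cell"
    show "F.transport (line v w) = \<one>\<^bsub>fundamental_group UC b\<^esub>"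
    proof (rule F.transport_trivial[OF lin[OF vw]])
      have "path_homotopic UC (concat_paths (concat_paths \<delta> (line v0 v)) (line v w))
         (concat_paths \<delta> (concat_paths (line v0 v) (line v w)))"
        by (rule path_homotopic_assoc) (use \<delta> lin v0_cell vw in auto)
      also have "path_homotopic UC \<dots> (concat_paths \<delta> (line v0 w))"
        by (rule path_homotopic_concat)
          (use \<delta> path_homotopic_triangle[OF seg_closed_cell cellY v0_cell vw] in \<open>auto simp: path_homotopic_refl\<close>)
      finally show "path_homotopic UC (concat_paths (\<kappa> (line v w 0)) (line v w)) (\<kappa> (line v w 1))"
        using vw by (simp add: \<kappa>_cell)
    qed
  qed
  then show ?thesis using that by blast
qed

end

section \<open>The character sphere of the braid group\<close>

lemma nonzero_character_value:
  assumes "\<xi> \<in> nonzero_characters G"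
  shows "\<exists>g\<in>carrier G. \<xi> g \<noteq> 0"
proof (rule ccontr)
  assume "\<not> ?thesis"
  then have "\<xi> = (\<lambda>g\<in>carrier G. 0)"
    using assms by (intro extensionalityI[of _ "carrier G"]) (auto simp: nonzero_characters_def characters_def)
  then show False using assms by (simp add: nonzero_characters_def)
qed

text \<open>Needed because the theorem has one clause per surface, and the clause for the other
  surface is vacuous only if the topologies differ. The coordinate 1/3 works because its double is
  no integer: the twisted translate \<open>(-1/3, 1)\<close> is not a torus translate of
  \<open>(1/3, 0)\<close>.\<close>

lemma surface_torus_neq_klein: "surface False \<noteq> surface True"
proof
  assume "surface False = surface True"
  then have "surface_rel False `` {(1/3, 0)} \<in> range (\<lambda>p. surface_rel True `` {p})"
    using topspace_surface[of True] topspace_surface[of False] by auto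
  then obtain p where p: "surface_rel False `` {(1/3, 0)} = surface_rel True `` {p}" by blast
  then have "(p, (1/3, 0)) \<in> surface_rel True" using surface_rel_refl[of "(1/3, 0)" False] by blast
  then have "(p, surface_act True 0 1 (1/3, 0)) \<in> surface_rel True"
    using surface_rel_trans surface_rel_act by blast
  then have "((1/3, 0), surface_act True 0 1 (1/3, 0)) \<in> surface_rel False" using p by blast
  then obtain j k where "surface_act True 0 1 (1/3, 0) = surface_act False j k (1/3, 0)"
    unfolding surface_rel_def by blast
  then have "real_of_int (3 * j) = real_of_int (- 2)" by (simp add: surface_act_def)
  then have "3 * j = - 2" by (simp only: of_int_eq_iff)
  then show False by presburger
qed

section \<open>Comparing the central loops with the generators\<close>

context framed_braids
begin

lemma finitely_generated: "finitely_generated_group FG"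
  unfolding finitely_generated_group_def finite_generating_set_def
  using finite_gens gens_closed H_carrier is_group by blast

text \<open>A dimension count made explicit: characters embed into the plane by their values at
  \<open>tau 0\<close> and \<open>om\<close>, and \<phi>, \<psi> are independent by duality, so they
  span.\<close>

lemma dual_characters_torus:
  assumes ntw: "\<not> tw" and \<phi>: "\<phi> \<in> characters FG" "\<psi> \<in> characters FG" and z: "x \<in> carrier FG" "y \<in> carrier FG"
    and dual: "\<phi> x = 1" "\<phi> y = 0" "\<psi> x = 0" "\<psi> y = 1"
    and \<xi>: "\<xi> \<in> characters FG" and g: "g \<in> carrier FG"
  shows "\<xi> g = \<xi> x * \<phi> g + \<xi> y * \<psi> g"
proof -
  note lin = character_linear_combination
  have zero: "\<eta> h = 0" if "\<eta> \<in> characters FG" "\<eta> (tau 0) = 0" "\<eta> om = 0" "h \<in> carrier FG" for \<eta> h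
    using character_determined[OF that(1)] that by blast
  \<comment> \<open>The determinant of \<phi> and \<psi> in the coordinates given by
    \<open>tau 0\<close> and \<open>om\<close>.\<close>
  define \<Delta> where "\<Delta> = \<phi> (tau 0) * \<psi> om - \<psi> (tau 0) * \<phi> om"
  \<comment> \<open>The error of the claimed expansion; it vanishes at \<open>x\<close> and
    \<open>y\<close>.\<close>
  define \<eta> where "\<eta> = (\<lambda>g\<in>carrier FG. 1 * \<xi> g + (-1) * (\<lambda>g\<in>carrier FG. \<xi> x * \<phi> g + \<xi> y * \<psi> g) g)"
  have \<eta>: "\<eta> \<in> characters FG" unfolding \<eta>_def by (intro lin \<phi> \<xi>)
  have \<eta>0: "\<eta> x = 0" "\<eta> y = 0" using z dual by (simp_all add: \<eta>_def)
  note C = tau_closed[of 0] om_closed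
  \<comment> \<open>Cramer's rule: both sides agree at \<open>tau 0\<close> and \<open>om\<close>,
    hence everywhere.\<close>
  have eqs: "\<Delta> * \<eta> h = (\<eta> (tau 0) * \<psi> om - \<eta> om * \<psi> (tau 0)) * \<phi> h + (\<eta> om * \<phi> (tau 0) - \<eta> (tau 0) * \<phi> om) * \<psi> h"
    if h: "h \<in> carrier FG" for h
  proof -
    define a b' where "a = \<eta> (tau 0) * \<psi> om - \<eta> om * \<psi> (tau 0)" and "b' = \<eta> om * \<phi> (tau 0) - \<eta> (tau 0) * \<phi> om"
    define \<theta> where "\<theta> = (\<lambda>g\<in>carrier FG. \<Delta> * \<eta> g + (-1) * (\<lambda>g\<in>carrier FG. a * \<phi> g + b' * \<psi> g) g)"
    have "\<theta> \<in> characters FG" unfolding \<theta>_def by (intro lin \<phi> \<eta>)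
    moreover have "\<theta> (tau 0) = 0" "\<theta> om = 0"
      using C by (simp_all add: \<theta>_def \<Delta>_def a_def b'_def algebra_simps)
    ultimately have "\<theta> h = 0" using zero h by blast
    then show ?thesis using h by (simp add: \<theta>_def a_def b'_def)
  qed
  have 1: "\<eta> (tau 0) * \<psi> om - \<eta> om * \<psi> (tau 0) = 0" "\<eta> om * \<phi> (tau 0) - \<eta> (tau 0) * \<phi> om = 0"
    using eqs[OF z(1)] eqs[OF z(2)] dual \<eta>0 by simp_all
  \<comment> \<open>A vanishing determinant would give a nontrivial combination of \<phi> and \<psi>
    equal to 0, contrary to their values at \<open>x\<close> and \<open>y\<close>.\<close>
  have "\<Delta> \<noteq> 0"
  proof
    assume \<Delta>: "\<Delta> = 0"
    have comb: "r * \<phi> h + s * \<psi> h = 0" if "r * \<phi> (tau 0) + s * \<psi> (tau 0) = 0" "r * \<phi> om + s * \<psi> om = 0" "h \<in> carrier FG" for r s h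
      using zero[OF lin[OF \<phi>, of r s], of h] that C by simp
    have "\<psi> om = 0 \<and> \<phi> om = 0"
      using comb[of "\<psi> om" "- \<phi> om" x] comb[of "\<psi> om" "- \<phi> om" y] \<Delta> z dual by (simp add: \<Delta>_def mult.commute)
    moreover have "\<psi> (tau 0) = 0 \<and> \<phi> (tau 0) = 0"
      using comb[of "\<psi> (tau 0)" "- \<phi> (tau 0)" x] comb[of "\<psi> (tau 0)" "- \<phi> (tau 0)" y] \<Delta> z dual by (simp add: \<Delta>_def mult.commute)
    ultimately have "\<phi> x = 0" using comb[of 1 0 x] z by simp
    then show False using dual by simp
  qed
  moreover have "\<Delta> * \<eta> g = 0" using eqs[OF g] 1 by simp
  ultimately have "\<eta> g = 0" by simp
  then show ?thesis using g by (simp add: \<eta>_def)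
qed

text \<open>Here \<open>om\<close> alone detects every character, so any two are
  proportional.\<close>

lemma dual_characters_klein:
  assumes tw: tw and \<phi>: "\<phi> \<in> characters FG" and z: "y \<in> carrier FG" and dual: "\<phi> y = 1"
    and \<xi>: "\<xi> \<in> characters FG" and g: "g \<in> carrier FG"
  shows "\<xi> g = \<xi> y * \<phi> g"
proof -
  note lin = character_linear_combination
  have zero: "\<eta> h = 0" if "\<eta> \<in> characters FG" "\<eta> om = 0" "h \<in> carrier FG" for \<eta> h
    using character_determined[OF that(1)] that tw by blast
  have *: "\<phi> om * \<xi> h = \<xi> om * \<phi> h" if h: "h \<in> carrier FG" for h
    using zero[OF lin[OF \<xi> \<phi>, of "\<phi> om" "- \<xi> om"], of h] h om_closed by simp
  have "\<phi> om \<noteq> 0" using zero[OF \<phi> _ z] dual by auto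
  moreover have "\<phi> om * \<xi> g = \<phi> om * (\<xi> y * \<phi> g)" using *[OF g] *[OF z] dual by simp
  ultimately show ?thesis by simp
qed

text \<open>Normalised displacement characters are dual to the loops of the two unit translations,
  hence a basis; by the resulting expansion a nonzero character cannot vanish on both loops.\<close>

lemma character_sphere_torus:
  assumes ntw: "\<not> tw" and v: "v \<in> Y" "b = q v"
  shows "character_sphere_topology FG homeomorphic_space nsphere 1"
    and "\<xi> \<in> nonzero_characters FG \<Longrightarrow> \<exists>z\<in>carrier FG. (\<forall>g\<in>carrier FG. z \<cdot> g = g \<cdot> z) \<and> \<xi> z \<noteq> 0"
proof -
  define z where "z i = loop_class UC b (flow_loop (if i = 0 then (1, 0) else (0, 1)) v)" for i :: nat
  have zi: "z i = loop_class UC b (flow_loop (of_int (if i = 0 then 1 else 0), of_int (if i = 0 then 0 else 1)) v)" for i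
    by (simp add: z_def)
  have zC: "z i \<in> carrier FG" for i
    unfolding zi v(2) carrier_fundamental_group
    by (intro imageI flow_loop_in_loops v(1)) (use ntw in auto)
  have central: "z i \<cdot> g = g \<cdot> z i" if "g \<in> carrier FG" for i g
    unfolding zi v(2)
    by (rule flow_loop_central[OF v(1)]) (use ntw that v(2) in auto)
  obtain \<phi>x where x: "\<phi>x \<in> characters FG" "\<And>(e :: real \<times> real) j k. e = (of_int j, of_int k) \<Longrightarrow> (tw \<Longrightarrow> fst e = 0 \<and> even k) \<Longrightarrow>
       \<phi>x (loop_class UC b (flow_loop e v)) = real n * fst e"
    using displacement_character[of fst v] ntw v by metis
  obtain \<phi>y where y: "\<phi>y \<in> characters FG" "\<And>(e :: real \<times> real) j k. e = (of_int j, of_int k) \<Longrightarrow> (tw \<Longrightarrow> fst e = 0 \<and> even k) \<Longrightarrow>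
       \<phi>y (loop_class UC b (flow_loop e v)) = real n * snd e"
    using displacement_character[of snd v] v by metis
  \<comment> \<open>Each of the \<open>n\<close> points is displaced by one period, hence the
    division by \<open>n\<close>. The zero term gives the form of
    \<open>character_linear_combination\<close>.\<close>
  define \<phi> where "\<phi> i = (if i = 0 then (\<lambda>g\<in>carrier FG. (1 / real n) * \<phi>x g + 0 * \<phi>y g)
     else (\<lambda>g\<in>carrier FG. (1 / real n) * \<phi>y g + 0 * \<phi>x g))" for i :: nat
  have \<phi>: "\<phi> i \<in> characters FG" for i
    using character_linear_combination[OF x(1) y(1), of "1 / real n" 0]
      character_linear_combination[OF y(1) x(1), of "1 / real n" 0] by (auto simp: \<phi>_def)
  have xz: "\<phi>x (z i) = real n * (if i = 0 then 1 else 0)" and yz: "\<phi>y (z i) = real n * (if i = 0 then 0 else 1)" for i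
    unfolding zi using ntw by (subst x(2) y(2); auto)+
  have dual: "\<phi> i (z j) = (if i = j then 1 else 0)" if "i \<le> 1" "j \<le> 1" for i j
    using that zC n2 by (auto simp: \<phi>_def xz yz le_Suc_eq)
  have span: "\<xi> g = (\<Sum>i\<le>1. \<xi> (z i) * \<phi> i g)" if "\<xi> \<in> characters FG" "g \<in> carrier FG" for \<xi> g
    using dual_characters_torus[OF ntw \<phi>[of 0] \<phi>[of 1] zC[of 0] zC[of 1] _ _ _ _ that] dual by simp
  show "character_sphere_topology FG homeomorphic_space nsphere 1"
    by (rule character_sphere_homeomorphic_nsphere[of 1 z FG \<phi>]) (use zC \<phi> dual span is_group in auto)
  assume \<xi>: "\<xi> \<in> nonzero_characters FG"
  have "\<exists>i. \<xi> (z i) \<noteq> 0"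
  proof (rule ccontr)
    assume "\<not> ?thesis"
    then have "\<xi> g = 0" if "g \<in> carrier FG" for g using span[of \<xi> g] \<xi> that by (simp add: nonzero_characters_def)
    then show False using nonzero_character_value[OF \<xi>] by blast
  qed
  then show "\<exists>z\<in>carrier FG. (\<forall>g\<in>carrier FG. z \<cdot> g = g \<cdot> z) \<and> \<xi> z \<noteq> 0"
    using zC central by blast
qed

lemma character_sphere_klein:
  assumes tw: tw and v: "v \<in> Y" "b = q v"
  shows "character_sphere_topology FG homeomorphic_space nsphere 0"
    and "\<xi> \<in> nonzero_characters FG \<Longrightarrow> \<exists>z\<in>carrier FG. (\<forall>g\<in>carrier FG. z \<cdot> g = g \<cdot> z) \<and> \<xi> z \<noteq> 0"
proof -
  \<comment> \<open>Two vertical periods, because only an even number of them undoes the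
    reflection.\<close>
  define z where "z = loop_class UC b (flow_loop (of_int 0, of_int 2) v)"
  have zC: "z \<in> carrier FG"
    unfolding z_def v(2) carrier_fundamental_group
    by (rule imageI, rule flow_loop_in_loops[OF v(1) _ refl]) auto
  have central: "z \<cdot> g = g \<cdot> z" if "g \<in> carrier FG" for g
    unfolding z_def v(2)
    by (rule flow_loop_central[OF v(1) _ refl]) (use that v(2) in auto)
  obtain \<phi>y where y: "\<phi>y \<in> characters FG" "\<And>(e :: real \<times> real) j k. e = (of_int j, of_int k) \<Longrightarrow> (tw \<Longrightarrow> fst e = 0 \<and> even k) \<Longrightarrow>
       \<phi>y (loop_class UC b (flow_loop e v)) = real n * snd e"
    using displacement_character[of snd v] v by metis
  \<comment> \<open>All \<open>n\<close> points rise by 2, so the total displacement is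
    \<open>2 * real n\<close>.\<close>
  define \<phi> where "\<phi> = (\<lambda>g\<in>carrier FG. (1 / (2 * real n)) * \<phi>y g + 0 * \<phi>y g)"
  have \<phi>: "\<phi> \<in> characters FG"
    unfolding \<phi>_def using y(1) character_linear_combination by blast
  have "\<phi>y z = real n * snd (of_int 0 :: real, of_int 2 :: real)"
    unfolding z_def by (rule y(2)[OF refl]) auto
  then have dual: "\<phi> z = 1" using zC n2 by (simp add: \<phi>_def)
  have span: "\<xi> g = \<xi> z * \<phi> g" if "\<xi> \<in> characters FG" "g \<in> carrier FG" for \<xi> g
    by (rule dual_characters_klein[OF tw \<phi> zC dual that])
  show "character_sphere_topology FG homeomorphic_space nsphere 0"
    by (rule character_sphere_homeomorphic_nsphere[of 0 "\<lambda>_. z" FG "\<lambda>_. \<phi>"]) (use zC \<phi> dual span is_group in auto)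
  assume \<xi>: "\<xi> \<in> nonzero_characters FG"
  have "\<xi> z \<noteq> 0"
  proof
    assume "\<xi> z = 0"
    then have "\<xi> g = 0" if "g \<in> carrier FG" for g using span[of \<xi> g] \<xi> that by (simp add: nonzero_characters_def)
    then show False using nonzero_character_value[OF \<xi>] by blast
  qed
  then show "\<exists>z\<in>carrier FG. (\<forall>g\<in>carrier FG. z \<cdot> g = g \<cdot> z) \<and> \<xi> z \<noteq> 0"
    using zC central by blast
qed

end

theorem theorem1p2:
  fixes M :: "(real \<times> real) set topology" and n :: nat
    and b :: "(nat \<Rightarrow> (real \<times> real) set) set"
  assumes "M = torus \<or> M = klein_bottle"
    and "n \<ge> 2"
    and "b \<in> topspace (unordered_configuration_space M n)"
  shows "finitely_generated_group (braid_group M n b) \<and>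
    (\<forall>X. finite_generating_set (braid_group M n b) X \<longrightarrow>
       BNS_Sigma1 (braid_group M n b) X = character_sphere (braid_group M n b)) \<and>
    (M = torus \<longrightarrow>
       character_sphere_topology (braid_group M n b) homeomorphic_space nsphere 1) \<and>
    (M = klein_bottle \<longrightarrow>
       character_sphere_topology (braid_group M n b) homeomorphic_space nsphere 0)"
proof -
  have main: "finitely_generated_group (braid_group (surface tw) n b) \<and>
    (\<forall>X. finite_generating_set (braid_group (surface tw) n b) X \<longrightarrow>
       BNS_Sigma1 (braid_group (surface tw) n b) X = character_sphere (braid_group (surface tw) n b)) \<and>
    character_sphere_topology (braid_group (surface tw) n b) homeomorphic_space nsphere (if tw then 0 else 1)"
    if b: "b \<in> topspace (unordered_configuration_space (surface tw) n)" for tw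
  proof -
    interpret surface_braids tw n by unfold_locales (rule assms(2))
    obtain \<kappa> where "framed_braids tw n b \<kappa>" by (rule ex_frame[OF b])
    then interpret framed_braids tw n b \<kappa> .
    obtain v where v: "v \<in> Y" "b = q v" using b by (auto simp: topspace_UC)
    have G: "braid_group (surface tw) n b = FG" by (simp add: braid_group_def)
    have "BNS_Sigma1 FG X = character_sphere FG" if "finite_generating_set FG X" for X
      using BNS_Sigma1_full[OF is_group that] character_sphere_torus(2)[OF _ v] character_sphere_klein(2)[OF _ v]
      by blast
    then show ?thesis
      unfolding G using finitely_generated character_sphere_torus(1)[OF _ v] character_sphere_klein(1)[OF _ v]
      by simp
  qed
  have T: "torus = surface False" "klein_bottle = surface True"
    by (simp_all add: torus_def klein_bottle_def surface_def surface_rel_torus surface_rel_klein)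
  from assms(1) show ?thesis
    using main[of False] main[of True] assms(3) surface_torus_neq_klein unfolding T by auto
qed

end
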